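(* Fix $A\in\mathbb{C}^{n\times n}$ and $\varepsilon>0$. Let $Q\in\mathbb{C}^{n\times\ell}$ be Haar distributed on the set of $n\times\ell$ complex matrices with orthonormal columns. Then $$\Pr\big(\sigma_{\min}(Q^*AQ)\le\varepsilon\big)\le c_{1,\ell,n}\,\frac{\varepsilon}{\sigma_\ell(A)},\qquad\text{where } c_{1,\ell,n}=24\,\ell^3(n-1).$$
   Context: $\sigma_1(A)\ge\cdots\ge\sigma_n(A)$ are the singular values of $A$, so $\sigma_\ell(A)$ is the $\ell$-th largest, and $\sigma_{\min}$ denotes the least singular value. $Q^*$ is the conjugate transpose of $Q$.
   Formalization: The formal theorem assumes n ≥ 2; for n = ℓ = 1 the constant 24ℓ³(n−1) is 0, while for A = (a) with 0 < |a| ≤ ε the probability is 1, so the statement fails there. *)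

theory Defs
  imports "HOL-Probability.Probability" "HOL-Computational_Algebra.Polynomial"
begin

text \<open>
  An \<open>m \<times> k\<close> complex matrix has type \<open>complex^'k^'m\<close> with \<open>m = CARD('m)\<close>, \<open>k = CARD('k)\<close>.
\<close>

definition conj_transpose :: "complex^'k^'m \<Rightarrow> complex^'m^'k" where
  "conj_transpose A = (\<chi> i j. cnj (A $ j $ i))"

definition unitary :: "complex^'n^'n \<Rightarrow> bool" where
  "unitary U \<longleftrightarrow> conj_transpose U ** U = mat 1 \<and> U ** conj_transpose U = mat 1"

definition charpoly :: "complex^'n^'n \<Rightarrow> complex poly" where
  "charpoly M = det (mat [:0, 1:] - (\<chi> i j. [:M $ i $ j:]))"

text \<open>
  The singular values of a square matrix \<open>A\<close>: the square roots of the eigenvalues of \<open>A\<^sup>* A\<close>,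
  with multiplicity.  These eigenvalues are real and nonnegative; \<open>Re\<close> only adjusts the type.
\<close>

definition singular_values :: "complex^'n^'n \<Rightarrow> real multiset" where
  "singular_values A = image_mset (\<lambda>z. sqrt (Re z)) (proots (charpoly (conj_transpose A ** A)))"

text \<open>Indexed from 1, for \<open>1 \<le> k \<le> n\<close>; the value is meaningless for any other \<open>k\<close>.\<close>

definition singular_value :: "nat \<Rightarrow> complex^'n^'n \<Rightarrow> real" where
  "singular_value k A = rev (sorted_list_of_multiset (singular_values A)) ! (k - 1)"

definition sigma_min :: "complex^'n^'n \<Rightarrow> real" where
  "sigma_min A = Min (set_mset (singular_values A))"

definition orthonormal_columns :: "(complex^'l^'n) set" where
  "orthonormal_columns = {Q. conj_transpose Q ** Q = mat 1}"

text \<open>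
  The Haar distribution on the matrices with orthonormal columns is the unique Borel probability
  measure on this set that is invariant under the transitive action \<open>Q \<mapsto> U Q\<close> of the unitary
  group.  It is represented as a measure on the Borel sets of the whole matrix space that is
  concentrated on \<open>orthonormal_columns\<close>.  Such a measure exists only if \<open>CARD('l) \<le> CARD('n)\<close>.
\<close>

definition haar_distribution :: "(complex^'l^'n) measure \<Rightarrow> bool" where
  "haar_distribution \<mu> \<longleftrightarrow>
     prob_space \<mu> \<and> sets \<mu> = sets borel \<and>
     (AE Q in \<mu>. Q \<in> orthonormal_columns) \<and>
     (\<forall>U. unitary U \<longrightarrow> distr \<mu> borel (\<lambda>Q. U ** Q) = \<mu>)"

end

theory Submission imports Defs begin

text \<open>
  Let \<open>M = Q\<^sup>* A Q\<close>, let \<open>q\<close> be the column \<open>k\<close> of \<open>Q\<close> and \<open>Q\<^sub>1\<close> the matrix of the other columns.  The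
  entry \<open>(k, k)\<close> of the inverse of \<open>M\<close> is \<open>1 / (q\<^sup>* B q)\<close> for the Schur complement
  \<open>B = A - A Q\<^sub>1 (Q\<^sub>1\<^sup>* A Q\<^sub>1)\<^sup>-\<^sup>1 Q\<^sub>1\<^sup>* A\<close>, which depends only on \<open>Q\<^sub>1\<close>, is annihilated by \<open>Q\<^sub>1\<close> on both
  sides, and differs from \<open>A\<close> by a matrix of rank less than \<open>l\<close>, so that its norm is at least
  \<open>\<sigma>\<^sub>l(A)\<close>.  Given \<open>Q\<^sub>1\<close>, the vector \<open>q\<close> is a normalised projection of a Gaussian vector \<open>g\<close>, and it
  suffices to bound the probability that \<open>|g\<^sup>* B g| \<le> \<delta> |g|\<^sup>2\<close>.  In the direction where the
  numerical radius \<open>w \<ge> \<sigma>\<^sub>l(A) / 2\<close> is attained, the form splits as \<open>w |z|\<^sup>2 + h\<close> with \<open>h\<close>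
  independent of \<open>z\<close>, so that \<open>z\<close> is confined to an annulus of area of order \<open>\<delta> / w\<close>.

  The Haar distribution is also invariant under right multiplication by unitary matrices, so the
  same bound holds for \<open>x\<^sup>* M\<^sup>-\<^sup>1 x\<close> with any unit vector \<open>x\<close>.  Polarisation bounds every entry of the
  inverse by these forms at fewer than \<open>3 l\<^sup>2 / 2\<close> unit vectors, and a union bound concludes.
\<close>

section \<open>Complex inner product and unitary matrices\<close>

text \<open>The constant multiplies the successive losses. If \<open>|M u| \<le> \<epsilon>\<close>
  for a unit vector \<open>u\<close>, the inverse of \<open>M\<close> has norm at least
  \<open>1/\<epsilon>\<close>, hence an entry of modulus at least \<open>1/(l \<epsilon>)\<close>,
  hence a test form of modulus at least \<open>1/(2 l \<epsilon>)\<close>; so each form is tested at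
  \<open>\<delta> = 2 l \<epsilon>\<close>. One form costs about
  \<open>8 \<delta> / \<sigma>\<close> times \<open>n - 1\<close>, where \<open>n - 1\<close> is the
  mean squared length of the Gaussian coordinates orthogonal to the maximising direction, to which
  the area of the annulus is proportional. With at most \<open>(3 l^2 - l) / 2\<close> forms this is
  \<open>24 l^3 (n - 1)\<close> to first order in \<open>\<epsilon>\<close>; the spared
  \<open>l / 2\<close> forms absorb the second order. Inverses require invertibility, and the
  compression of \<open>A\<close> may be singular. The estimate is therefore made for
  \<open>A + t I\<close> with small \<open>t > 0\<close>, and \<open>t\<close> tends to 0. For this
  reason \<open>\<sigma>_l(A)\<close> enters only as a lower bound for \<open>A\<close> on a fixed
  \<open>l\<close>-dimensional subspace: a shift by \<open>t\<close> lowers such a bound by at most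
  \<open>t\<close>.\<close>

definition cdot :: "complex^'n \<Rightarrow> complex^'n \<Rightarrow> complex" where
  "cdot x y = (\<Sum>i\<in>UNIV. cnj (x $ i) * y $ i)"

lemma cdot_simps [simp]:
  "cdot (x + x') y = cdot x y + cdot x' y" "cdot x (y + y') = cdot x y + cdot x y'"
  "cdot (x - x') y = cdot x y - cdot x' y" "cdot x (y - y') = cdot x y - cdot x y'"
  "cdot (- x) y = - cdot x y" "cdot x (- y) = - cdot x y"
  "cdot (c *s x) y = cnj c * cdot x y" "cdot x (c *s y) = c * cdot x y"
  "cdot 0 y = 0" "cdot x 0 = 0"
  "cdot (r *\<^sub>R x) y = of_real r * cdot x y" "cdot x (r *\<^sub>R y) = of_real r * cdot x y"
  unfolding cdot_def
  by (simp_all add: algebra_simps sum.distrib sum_subtractf sum_negf sum_distrib_left scaleR_conv_of_real[where 'a=complex])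

lemma cnj_cdot: "cnj (cdot x y) = cdot y x"
  by (simp add: cdot_def mult.commute)

lemma cdot_eq_0_sym: "cdot x y = 0 \<longleftrightarrow> cdot y x = 0"
  by (metis cnj_cdot complex_cnj_zero_iff)

lemma Re_cdot_commute: "Re (cdot x y) = Re (cdot y x)"
  by (metis cnj_cdot cnj.simps(1))

lemma norm_vec_sq: "(norm (x :: complex^'n))\<^sup>2 = (\<Sum>i\<in>UNIV. (cmod (x $ i))\<^sup>2)"
  by (simp add: norm_vec_def L2_set_def sum_nonneg)

lemma cdot_self: "cdot x x = of_real ((norm x)\<^sup>2)"
  unfolding norm_vec_sq of_real_sum complex_norm_square by (simp add: cdot_def mult.commute)

lemma norm_add_sq: "(norm (x + y))\<^sup>2 = (norm x)\<^sup>2 + 2 * Re (cdot x y) + (norm y)\<^sup>2"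
proof -
  have "complex_of_real ((norm (x + y))\<^sup>2) = cdot x x + (cdot x y + cdot y x) + cdot y y"
    unfolding cdot_self[symmetric] by simp
  then have "Re (complex_of_real ((norm (x + y))\<^sup>2)) = Re (cdot x x + (cdot x y + cdot y x) + cdot y y)"
    by (rule arg_cong)
  then show ?thesis by (simp add: cdot_self Re_cdot_commute[of y x] del: of_real_power)
qed

lemma cdot_axis: "cdot (axis k 1) y = y $ k"
proof -
  have "cdot (axis k 1) y = (\<Sum>i\<in>UNIV. if i = k then y $ i else 0)"
    unfolding cdot_def by (rule sum.cong) (auto simp: axis_def)
  then show ?thesis by simp
qed

lemma norm_axis_complex: "norm (axis k (1::complex)) = 1"
proof -
  have "complex_of_real ((norm (axis k (1::complex)))\<^sup>2) = 1"
    unfolding cdot_self[symmetric] cdot_axis by (simp add: axis_def)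
  then have "(norm (axis k (1::complex)))\<^sup>2 = 1" by (simp only: of_real_eq_1_iff)
  then show ?thesis by (simp add: power2_eq_1_iff)
qed

lemma norm_vector_scalar_mult: "norm (c *s (x :: complex^'n)) = cmod c * norm x"
proof -
  have "(norm (c *s x))\<^sup>2 = (cmod c * norm x)\<^sup>2"
    by (simp add: norm_vec_sq power_mult_distrib norm_mult sum_distrib_left)
  then show ?thesis by (simp add: power2_eq_iff_nonneg)
qed

lemma scaleR_eq_smult: "r *\<^sub>R (x :: complex^'n) = of_real r *s x"
  by (simp add: vec_eq_iff scaleR_conv_of_real[where 'a=complex])

lemma cdot_matrix: "cdot x (A *v y) = cdot (conj_transpose A *v x) y"
proof -
  have "cdot x (A *v y) = (\<Sum>i\<in>UNIV. \<Sum>j\<in>UNIV. cnj (x $ i) * (A $ i $ j * y $ j))"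
    by (simp add: cdot_def matrix_vector_mult_def sum_distrib_left)
  also have "\<dots> = (\<Sum>j\<in>UNIV. \<Sum>i\<in>UNIV. cnj (x $ i) * (A $ i $ j * y $ j))"
    by (rule sum.swap)
  also have "\<dots> = cdot (conj_transpose A *v x) y"
    by (simp add: cdot_def matrix_vector_mult_def conj_transpose_def sum_distrib_left
        sum_distrib_right algebra_simps)
  finally show ?thesis .
qed

lemma cdot_smult_form:
  "cdot (of_real r *s x) (H *v (of_real r *s x)) = of_real (r\<^sup>2) * cdot x (H *v x)"
  by (simp add: vector_scalar_commute power2_eq_square)

lemma mat_vec: "mat t *v x = t *s (x :: complex^'n)"
  by (simp add: matrix_vector_mult_def mat_def vec_eq_iff if_distribR if_distrib[of "\<lambda>t. t * _"] cong: if_cong)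

lemma conj_transpose_conj_transpose [simp]: "conj_transpose (conj_transpose A) = A"
  by (simp add: conj_transpose_def vec_eq_iff)

lemma conj_transpose_mult: "conj_transpose (A ** B) = conj_transpose B ** conj_transpose A"
  by (simp add: conj_transpose_def matrix_matrix_mult_def vec_eq_iff mult.commute)

lemma conj_transpose_mat1 [simp]: "conj_transpose (mat 1) = mat 1"
  by (simp add: conj_transpose_def mat_def vec_eq_iff)

lemma cdot_conj_transpose: "cdot x (conj_transpose A *v y) = cdot (A *v x) y"
  by (simp add: cdot_matrix)

lemma orthonormal_columns_iff:
  "Q \<in> orthonormal_columns \<longleftrightarrow>
    (\<forall>i j. cdot (column i Q) (column j Q) = (if i = j then 1 else 0))"
  by (simp add: orthonormal_columns_def vec_eq_iff matrix_matrix_mult_def conj_transpose_def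
      cdot_def column_def mat_def)

lemma orthonormal_columns_cdot:
  assumes "Q \<in> orthonormal_columns"
  shows "cdot (Q *v x) (Q *v y) = cdot x y"
proof -
  have "cdot (Q *v x) (Q *v y) = cdot ((conj_transpose Q ** Q) *v x) y"
    by (simp only: cdot_matrix matrix_vector_mul_assoc)
  then show ?thesis using assms by (simp add: orthonormal_columns_def)
qed

lemma orthonormal_columns_norm:
  assumes "Q \<in> orthonormal_columns"
  shows "norm (Q *v x) = norm x"
  using orthonormal_columns_cdot[OF assms, of x x]
  by (simp only: cdot_self of_real_eq_iff power2_eq_iff_nonneg norm_ge_zero)

lemma unitary_iff: "unitary U \<longleftrightarrow> U \<in> orthonormal_columns"
  by (auto simp: unitary_def orthonormal_columns_def matrix_left_right_inverse)

lemma unitary_mat1: "unitary (mat 1)"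
  by (simp add: unitary_def)

lemma orthonormal_columns_mult:
  assumes "Q \<in> orthonormal_columns" "R \<in> orthonormal_columns"
  shows "Q ** R \<in> orthonormal_columns"
proof -
  have "conj_transpose (Q ** R) ** (Q ** R) = conj_transpose R ** (conj_transpose Q ** Q) ** R"
    by (simp add: conj_transpose_mult matrix_mul_assoc)
  then show ?thesis using assms by (simp add: orthonormal_columns_def)
qed

lemma unitary_mult: "unitary U \<Longrightarrow> unitary V \<Longrightarrow> unitary (U ** V)"
  by (simp add: unitary_iff orthonormal_columns_mult)

lemma column_mult: "column j (A ** B) = A *v column j B"
  by (simp add: column_def matrix_matrix_mult_def matrix_vector_mult_def vec_eq_iff)

lemma column_eq_axis: "column k A = A *v axis k 1"
  by (simp add: column_def matrix_vector_mult_def axis_def vec_eq_iff if_distrib cong: if_cong)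

lemma norm_column_orthonormal:
  assumes "Q \<in> orthonormal_columns"
  shows "norm (column j Q) = 1"
  using orthonormal_columns_norm[OF assms, of "axis j 1"]
  by (simp add: column_eq_axis norm_axis_complex)

text \<open>
  The map is the reflection \<open>I - w w\<^sup>* / (w\<^sup>* u)\<close> with \<open>w = u - v\<close>; the complex number
  \<open>w\<^sup>* u\<close> in place of \<open>|w|\<^sup>2 / 2\<close> is what makes it send \<open>u\<close> to \<open>v\<close>.
\<close>

lemma unitary_maps_unit_vector:
  fixes u v :: "complex^'n"
  assumes "norm u = 1" "norm v = 1"
  obtains S where "unitary S" "S *v u = v"
    "\<And>x. cdot x u = 0 \<Longrightarrow> cdot x v = 0 \<Longrightarrow> S *v x = x"
proof (cases "u = v")
  case True
  then show ?thesis using that[of "mat 1"] by (simp add: unitary_mat1)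
next
  case False
  define w where "w = u - v"
  define a where "a = cdot w u"
  have a: "a = 1 - cdot v u" by (simp add: a_def w_def cdot_self assms)
  \<comment> \<open>For unit vectors \<open>|u - v|^2 = 2 Re a\<close>. This identity cancels the
    cross terms when \<open>S\<close> is shown to preserve \<open>cdot\<close>, and it gives
    \<open>a \<noteq> 0\<close>.\<close>
  have ww: "cdot w w = a + cnj a"
    unfolding w_def a cdot_simps by (simp add: cnj_cdot cdot_self assms)
  have "w \<noteq> 0" using False by (simp add: w_def)
  then have "cdot w w \<noteq> 0" by (simp add: cdot_self)
  then have a0: "a \<noteq> 0" using ww by auto
  define S where "S = (\<chi> i j. (if i = j then 1 else 0) - w $ i * cnj (w $ j) / a)"
  have S: "S *v x = x - (cdot w x / a) *s w" for x
  proof -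
    have "(\<Sum>j\<in>UNIV. ((if i = j then 1 else 0) - w $ i * cnj (w $ j) / a) * x $ j) =
        (\<Sum>j\<in>UNIV. (if i = j then x $ j else 0) - w $ i / a * (cnj (w $ j) * x $ j))" for i
      by (rule sum.cong) (auto simp: field_simps)
    then show ?thesis
      unfolding sum_subtractf sum_distrib_left[symmetric] cdot_def[symmetric]
      by (simp add: S_def vec_eq_iff matrix_vector_mult_def)
  qed
  have "cdot (S *v x) (S *v y) = cdot x y" for x y
  proof -
    have xw: "cnj (cdot w x) = cdot x w" by (rule cnj_cdot)
    have "cdot (S *v x) (S *v y) = cdot x y - cdot w y / a * cdot x w - cdot x w / cnj a * cdot w y
       + cdot x w / cnj a * (cdot w y / a) * (a + cnj a)"
      by (simp add: S xw ww[symmetric] algebra_simps)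
    also have "\<dots> = cdot x y" using a0 by (simp add: field_simps)
    finally show ?thesis .
  qed
  then have "S \<in> orthonormal_columns"
    by (auto simp: orthonormal_columns_iff column_eq_axis cdot_axis) (auto simp: axis_def)
  moreover have "S *v u = v" using a0 by (simp add: S a_def[symmetric]) (simp add: w_def)
  moreover have "S *v x = x" if "cdot x u = 0" "cdot x v = 0" for x
  proof -
    have "cdot x w = 0" using that by (simp add: w_def)
    then have "cdot w x = 0" by (rule cdot_eq_0_sym[THEN iffD1])
    then show ?thesis by (simp add: S)
  qed
  ultimately show ?thesis using that[of S] by (simp add: unitary_iff)
qed

lemma unitary_first_column:
  fixes v :: "complex^'n"
  assumes "norm v = 1"
  obtains W where "unitary W" "W *v axis k 1 = v"
  using unitary_maps_unit_vector[OF norm_axis_complex assms, of k] that by metis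

text \<open>Columns are moved into place one at a time. The reflection that moves column
  \<open>k\<close> fixes everything orthogonal to both its old and its new position, in particular
  the columns already placed.\<close>

lemma unitary_transitive:
  fixes X Y :: "complex^'l^'n"
  assumes "X \<in> orthonormal_columns" "Y \<in> orthonormal_columns"
  obtains U where "unitary U" "U ** X = Y"
proof -
  have "\<exists>U. unitary U \<and> (\<forall>j\<in>J. U *v column j X = column j Y)" if "finite J" for J
    using that
  proof (induction J)
    case empty
    then show ?case using unitary_mat1 by blast
  next
    case (insert k J)
    then obtain U where U: "unitary U" "\<And>j. j \<in> J \<Longrightarrow> U *v column j X = column j Y" by blast
    have UX: "U ** X \<in> orthonormal_columns"
      using U assms by (simp add: unitary_iff orthonormal_columns_mult)
    have 1: "norm (U *v column k X) = 1" "norm (column k Y) = 1"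
      using norm_column_orthonormal[OF UX, of k] norm_column_orthonormal[OF assms(2)]
      by (simp_all add: column_mult)
    obtain S where S: "unitary S" "S *v (U *v column k X) = column k Y"
        "\<And>x. cdot x (U *v column k X) = 0 \<Longrightarrow> cdot x (column k Y) = 0 \<Longrightarrow> S *v x = x"
      using unitary_maps_unit_vector[OF 1] by metis
    have "(S ** U) *v column j X = column j Y" if "j \<in> insert k J" for j
    proof (cases "j = k")
      case True
      then show ?thesis using S by (simp add: matrix_vector_mul_assoc[symmetric])
    next
      case False
      then have j: "U *v column j X = column j Y" using that U by auto
      have "cdot (column j Y) (U *v column k X) = 0"
        using UX False unfolding orthonormal_columns_iff j[symmetric] column_mult by auto
      moreover have "cdot (column j Y) (column k Y) = 0"
        using assms(2) False unfolding orthonormal_columns_iff by auto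
      ultimately show ?thesis using S(3) j by (simp add: matrix_vector_mul_assoc[symmetric])
    qed
    moreover have "unitary (S ** U)" using S U unitary_mult by blast
    ultimately show ?case by blast
  qed
  from this[of UNIV] obtain U where U: "unitary U" "\<And>j. U *v column j X = column j Y" by auto
  have "U ** X = Y" using U(2)
    by (simp add: column_mult[symmetric]) (simp add: column_def vec_eq_iff)
  with U that show ?thesis by blast
qed

section \<open>First-order conditions and the spectral theorem for Hermitian matrices\<close>

lemma nonneg_affine_imp_const:
  fixes a b :: real
  assumes "\<And>t. 0 \<le> a + t * b"
  shows "b = 0"
proof (rule ccontr)
  assume "b \<noteq> 0"
  then show False using assms[of "- (a + 1) / b"] by simp
qed

lemma nonneg_quadratic_imp_linear_zero:
  fixes b c :: real
  assumes "\<And>t. 0 \<le> t * b + t\<^sup>2 * c"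
  shows "b = 0"
proof (rule ccontr)
  assume b: "b \<noteq> 0"
  have c: "c \<ge> \<bar>b\<bar>" using assms[of 1] assms[of "-1"] by auto
  then have "c > 0" using b by linarith
  have "- b / (2 * c) * b + (- b / (2 * c))\<^sup>2 * c = - (b\<^sup>2 / (4 * c))"
    using \<open>c > 0\<close> by (simp add: field_simps power2_eq_square)
  moreover have "b\<^sup>2 / (4 * c) > 0" using b \<open>c > 0\<close> by simp
  ultimately show False using assms[of "- b / (2 * c)"] by linarith
qed

lemma compact_attains_sup_on_subspace:
  fixes f :: "complex^'n \<Rightarrow> real" and C :: "(complex^'n) set"
  assumes "closed C" "x0 \<in> C" "norm x0 = 1" "continuous_on UNIV f"
  obtains v where "v \<in> C" "norm v = 1" "\<And>x. x \<in> C \<Longrightarrow> norm x = 1 \<Longrightarrow> f x \<le> f v"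
proof -
  have "compact (sphere 0 1 \<inter> C)" using assms(1) by (intro compact_Int_closed) auto
  moreover have "sphere 0 1 \<inter> C \<noteq> {}" using assms by auto
  ultimately obtain v where "v \<in> sphere 0 1 \<inter> C" "\<forall>y\<in>sphere 0 1 \<inter> C. f y \<le> f v"
    using continuous_attains_sup assms(4) continuous_on_subset by (metis subset_UNIV)
  then show ?thesis using that[of v] by auto
qed

lemma continuous_on_cdot [continuous_intros]:
  assumes "continuous_on S f" "continuous_on S g"
  shows "continuous_on S (\<lambda>x. cdot (f x) (g x))"
  unfolding cdot_def using assms by (intro continuous_intros)

lemma continuous_on_matrix_mult [continuous_intros]:
  fixes f :: "_ \<Rightarrow> complex^'m^'n" and g :: "_ \<Rightarrow> complex^'k^'m"
  assumes "continuous_on S f" "continuous_on S g"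
  shows "continuous_on S (\<lambda>x. f x ** g x)"
  unfolding matrix_matrix_mult_def using assms by (intro continuous_intros)

lemma continuous_on_matrix_vector_mult' [continuous_intros]:
  fixes f :: "_ \<Rightarrow> complex^'m^'n" and g :: "_ \<Rightarrow> complex^'m"
  assumes "continuous_on S f" "continuous_on S g"
  shows "continuous_on S (\<lambda>x. f x *v g x)"
  unfolding matrix_vector_mult_def using assms by (intro continuous_intros)

lemma continuous_on_conj_transpose [continuous_intros]:
  assumes "continuous_on S f"
  shows "continuous_on S (\<lambda>x. conj_transpose (f x))"
  unfolding conj_transpose_def using assms by (intro continuous_intros)

lemma continuous_on_complex_det [continuous_intros]:
  fixes f :: "_ \<Rightarrow> complex^'n^'n"
  assumes "continuous_on S f"
  shows "continuous_on S (\<lambda>x. det (f x))"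
  unfolding det_def using assms by (intro continuous_intros)

text \<open>The Rayleigh quotient is maximised over the unit vectors of the complement
  \<open>C\<close> of the columns in \<open>J\<close>; column \<open>k\<close> shows that there are
  such vectors. \<open>C\<close> is invariant under \<open>H\<close> because those columns are
  eigenvectors.\<close>

lemma hermitian_eigenvector_in_complement:
  fixes H U :: "complex^'n^'n"
  assumes H: "conj_transpose H = H" and U: "unitary U" and k: "k \<notin> J"
    and J: "\<And>j. j \<in> J \<Longrightarrow> \<exists>d::real. H *v column j U = of_real d *s column j U"
  obtains v and d :: real where "norm v = 1" "H *v v = of_real d *s v"
    "\<And>j. j \<in> J \<Longrightarrow> cdot (column j U) v = 0"
proof -
  have Uo: "U \<in> orthonormal_columns" using U by (simp add: unitary_iff)
  define C where "C = {x. \<forall>j\<in>J. cdot (column j U) x = 0}"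
  have C_eq: "C = (\<Inter>j\<in>J. {x. cdot (column j U) x = 0})" by (auto simp: C_def)
  have "closed C" unfolding C_eq
    by (intro closed_INT ballI closed_Collect_eq continuous_intros)
  moreover have "column k U \<in> C" using Uo k unfolding orthonormal_columns_iff C_def by auto
  moreover have cont: "continuous_on UNIV (\<lambda>x. Re (cdot x (H *v x)))"
    by (intro continuous_intros)
  ultimately obtain v where v: "v \<in> C" "norm v = 1"
    "\<And>x. x \<in> C \<Longrightarrow> norm x = 1 \<Longrightarrow> Re (cdot x (H *v x)) \<le> Re (cdot v (H *v v))"
    using compact_attains_sup_on_subspace[of C, OF _ _ norm_column_orthonormal[OF Uo, of k] cont] by blast
  define d where "d = Re (cdot v (H *v v))"
  have Hsym: "cdot x (H *v y) = cdot (H *v x) y" for x y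
    using cdot_matrix[of x H y] H by simp
  have scC: "c *s x \<in> C" "x + y \<in> C" "x - y \<in> C" if "x \<in> C" "y \<in> C" for c x y
    using that by (auto simp: C_def)
  have HC: "H *v x \<in> C" if "x \<in> C" for x
  proof -
    have "cdot (column j U) (H *v x) = 0" if "j \<in> J" for j
      using J[OF that] \<open>x \<in> C\<close> that by (auto simp: Hsym C_def)
    then show ?thesis by (simp add: C_def)
  qed
  have le: "Re (cdot x (H *v x)) \<le> d * (norm x)\<^sup>2" if "x \<in> C" for x
  proof (cases "x = 0")
    case False
    define y where "y = complex_of_real (1 / norm x) *s x"
    have x: "x = of_real (norm x) *s y" using False by (simp add: y_def vec_eq_iff)
    have "norm y = 1" using False by (simp add: y_def norm_vector_scalar_mult norm_divide)
    then have "Re (cdot y (H *v y)) \<le> d" using scC v(3) that unfolding d_def y_def by blast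
    moreover have "cdot x (H *v x) = of_real ((norm x)\<^sup>2) * cdot y (H *v y)"
      by (subst (1 2) x, simp only: cdot_smult_form)
    ultimately show ?thesis
      using mult_left_mono[of "Re (cdot y (H *v y))" d "(norm x)\<^sup>2"]
      by (simp add: mult.commute[of d] del: of_real_power)
  qed (simp add: matrix_vector_mult_0_right)
  \<comment> \<open>The residual stays in \<open>C\<close>, so moving \<open>v\<close> along it is
    admissible. The slack in \<open>le\<close> then has linear coefficient \<open>-2 |y|^2\<close>,
    which must vanish.\<close>
  define y where "y = H *v v - of_real d *s v"
  have yC: "y \<in> C" using HC scC v(1) by (simp add: y_def)
  have "0 \<le> t * (- 2 * Re (cdot y y)) + t\<^sup>2 * (d * (norm y)\<^sup>2 - Re (cdot y (H *v y)))" for t :: real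
  proof -
    let ?z = "v + of_real t *s y"
    have zC: "?z \<in> C" using yC v(1) scC by simp
    have n: "(norm ?z)\<^sup>2 = 1 + 2 * t * Re (cdot v y) + t\<^sup>2 * (norm y)\<^sup>2"
    proof -
      have "cdot v (of_real t *s y) = of_real t * cdot v y" by simp
      then show ?thesis
        by (simp add: norm_add_sq v(2) norm_vector_scalar_mult power_mult_distrib)
    qed
    have q: "Re (cdot ?z (H *v ?z)) = d + 2 * t * Re (cdot y (H *v v)) + t\<^sup>2 * Re (cdot y (H *v y))"
      by (simp add: matrix_vector_right_distrib vector_scalar_commute d_def Hsym[of v y]
          Re_cdot_commute[of "H *v v" y] power2_eq_square algebra_simps)
    have yy: "Re (cdot y y) = Re (cdot y (H *v v)) - d * Re (cdot v y)"
    proof -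
      have "cdot y y = cdot y (H *v v) - of_real d * cdot y v" by (subst (2) y_def) simp
      then show ?thesis by (simp add: Re_cdot_commute[of y v])
    qed
    show ?thesis using le[OF zC] unfolding n q yy by (simp add: algebra_simps)
  qed
  then have "- 2 * Re (cdot y y) = 0" by (rule nonneg_quadratic_imp_linear_zero)
  then have "y = 0" by (simp add: cdot_self)
  then have "H *v v = of_real d *s v" by (simp add: y_def)
  moreover have "cdot (column j U) v = 0" if "j \<in> J" for j using v(1) that by (simp add: C_def)
  ultimately show ?thesis using that v(2) by blast
qed

text \<open>Induction on the set of columns that are already eigenvectors. A reflection carries
  column \<open>k\<close> to the new eigenvector and fixes the earlier ones, which are orthogonal to
  both.\<close>

lemma hermitian_diagonalizable:
  fixes H :: "complex^'n^'n"
  assumes H: "conj_transpose H = H"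
  obtains U and d :: "'n \<Rightarrow> real" where "unitary U" "\<And>j. H *v column j U = of_real (d j) *s column j U"
proof -
  have "\<exists>U. unitary U \<and> (\<forall>j\<in>J. \<exists>d::real. H *v column j U = of_real d *s column j U)"
    if "finite J" for J
    using that
  proof (induction J)
    case empty
    then show ?case using unitary_mat1 by blast
  next
    case (insert k J)
    then obtain U where U: "unitary U"
      "\<And>j. j \<in> J \<Longrightarrow> \<exists>d::real. H *v column j U = of_real d *s column j U" by blast
    obtain v d where v: "norm v = 1" "H *v v = of_real d *s v"
      "\<And>j. j \<in> J \<Longrightarrow> cdot (column j U) v = 0"
      using hermitian_eigenvector_in_complement[OF H U(1) insert.hyps(2) U(2)] by blast
    have Uo: "U \<in> orthonormal_columns" using U by (simp add: unitary_iff)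
    obtain S where S: "unitary S" "S *v column k U = v"
        "\<And>x. cdot x (column k U) = 0 \<Longrightarrow> cdot x v = 0 \<Longrightarrow> S *v x = x"
      using unitary_maps_unit_vector[OF norm_column_orthonormal[OF Uo] v(1)] by metis
    have "column j (S ** U) = column j U" if "j \<in> J" for j
      unfolding column_mult
    proof (rule S(3))
      show "cdot (column j U) (column k U) = 0"
        using Uo that insert.hyps unfolding orthonormal_columns_iff by auto
    qed (use v that in auto)
    moreover have "column k (S ** U) = v" by (simp add: column_mult S)
    ultimately have "\<exists>d::real. H *v column j (S ** U) = of_real d *s column j (S ** U)"
      if "j \<in> insert k J" for j using that U(2) v(2) by auto
    then show ?case using unitary_mult[OF S(1) U(1)] by blast
  qed
  from this[of UNIV] obtain U where "unitary U"
    "\<forall>j. \<exists>d::real. H *v column j U = of_real d *s column j U" by auto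
  then show ?thesis using that by metis
qed

section \<open>Singular values\<close>

lemma poly_det: "poly (det M) z = det (\<chi> i j. poly (M $ i $ j) z)"
proof -
  have "poly (of_int k) z = of_int k" for k by (simp add: of_int_poly)
  then show ?thesis by (simp add: det_def poly_sum poly_prod)
qed

lemma poly_charpoly: "poly (charpoly M) z = det (mat z - M)"
  unfolding charpoly_def poly_det
  by (rule arg_cong[of _ _ det]) (simp add: vec_eq_iff mat_def)

lemma charpoly_diagonalized:
  fixes H :: "complex^'n^'n"
  assumes U: "unitary U" and d: "\<And>j. H *v column j U = d j *s column j U"
  shows "charpoly H = (\<Prod>i\<in>UNIV. [:- d i, 1:])"
proof -
  define D :: "complex \<Rightarrow> complex^'n^'n" where "D z = (\<chi> i j. if i = j then z - d i else 0)" for z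
  have eq: "(mat z - H) ** U = U ** D z" for z
  proof -
    have "column j ((mat z - H) ** U) = column j (U ** D z)" for j
    proof -
      have "column j ((mat z - H) ** U) = z *s column j U - H *v column j U"
        unfolding column_mult by (simp add: matrix_vector_mult_diff_rdistrib)
          (simp add: matrix_vector_mult_def mat_def vec_eq_iff if_distribR if_distrib[of "\<lambda>t. t * _"] cong: if_cong)
      also have "\<dots> = column j (U ** D z)"
        unfolding d by (simp add: column_def vec_eq_iff matrix_matrix_mult_def D_def if_distrib
            algebra_simps cong: if_cong)
      finally show ?thesis .
    qed
    then show ?thesis by (simp add: column_def vec_eq_iff)
  qed
  have "poly (charpoly H) z = poly (\<Prod>i\<in>UNIV. [:- d i, 1:]) z" for z
  proof -
    have "det U \<noteq> 0" using U unfolding invertible_det_nz[symmetric] unitary_def invertible_def by blast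
    moreover have "det (mat z - H) * det U = det U * det (D z)"
      using arg_cong[OF eq[of z], of det] by (simp add: det_mul)
    moreover have "det (D z) = (\<Prod>i\<in>UNIV. z - d i)"
      by (subst det_diagonal) (simp_all add: D_def)
    ultimately show ?thesis by (simp add: poly_charpoly poly_prod)
  qed
  then show ?thesis by (simp add: poly_eq_poly_eq_iff[symmetric] fun_eq_iff)
qed

text \<open>Bridge from roots of the characteristic polynomial to geometry: for a unit eigenvector
  \<open>u\<close> of the Gram matrix of \<open>A\<close>, the eigenvalue is
  \<open>|A u|^2\<close>.\<close>

lemma singular_basis:
  fixes A :: "complex^'n^'n"
  obtains U where "unitary U"
    "\<And>j. (conj_transpose A ** A) *v column j U = of_real ((norm (A *v column j U))\<^sup>2) *s column j U"
    "singular_values A = image_mset (\<lambda>i. norm (A *v column i U)) (mset_set UNIV)"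
proof -
  let ?H = "conj_transpose A ** A"
  obtain U d where U: "unitary U" "\<And>j. ?H *v column j U = of_real (d j) *s column j U"
    using hermitian_diagonalizable[of ?H] by (auto simp: conj_transpose_mult)
  have d: "d j = (norm (A *v column j U))\<^sup>2" for j
  proof -
    have "cdot (column j U) (column j U) = 1"
      using U unfolding unitary_iff orthonormal_columns_iff by auto
    then have "of_real (d j) = cdot (column j U) (?H *v column j U)" unfolding U(2) by simp
    also have "\<dots> = of_real ((norm (A *v column j U))\<^sup>2)"
      by (simp only: matrix_vector_mul_assoc[symmetric] cdot_conj_transpose cdot_self)
    finally show ?thesis by (simp only: of_real_eq_iff)
  qed
  have "charpoly ?H = (\<Prod>i\<in>UNIV. [:- complex_of_real (d i), 1:])"
    by (rule charpoly_diagonalized[OF U])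
  then have "proots (charpoly ?H) = (\<Sum>i\<in>UNIV. {# complex_of_real (d i) #})"
    by (simp add: proots_prod)
  moreover have "image_mset f (\<Sum>i\<in>S. {# g i #}) = image_mset (\<lambda>i. f (g i)) (mset_set S)"
    if "finite S" for f :: "complex \<Rightarrow> real" and g and S :: "'n set"
    using that by (induction S) auto
  ultimately have "singular_values A = image_mset (\<lambda>i. sqrt (Re (of_real (d i)))) (mset_set UNIV)"
    unfolding singular_values_def by simp
  then have "singular_values A = image_mset (\<lambda>i. norm (A *v column i U)) (mset_set UNIV)"
    by (simp add: d)
  then show ?thesis using that U by (simp add: d)
qed

lemma sigma_min_attained:
  fixes M :: "complex^'n^'n"
  obtains u where "norm u = 1" "norm (M *v u) = sigma_min M"
proof -
  obtain U where U: "unitary U" "singular_values M = image_mset (\<lambda>i. norm (M *v column i U)) (mset_set UNIV)"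
    using singular_basis[of M] by metis
  have "sigma_min M \<in> (\<lambda>i. norm (M *v column i U)) ` UNIV"
    unfolding sigma_min_def U(2) by (simp add: Min_in)
  then obtain i where "sigma_min M = norm (M *v column i U)" by auto
  moreover have "norm (column i U) = 1" using U norm_column_orthonormal by (auto simp: unitary_iff)
  ultimately show ?thesis using that by metis
qed

lemma size_filter_ge_nth_largest:
  fixes ms :: "real multiset"
  assumes "0 < k" "k \<le> size ms"
  defines "c \<equiv> rev (sorted_list_of_multiset ms) ! (k - 1)"
  shows "c \<in># ms" "k \<le> size {# x \<in># ms. c \<le> x #}"
proof -
  define xs where "xs = rev (sorted_list_of_multiset ms)"
  have ms: "mset xs = ms" by (simp add: xs_def)
  then have len: "length xs = size ms" by (metis size_mset)
  have c: "c = xs ! (k - 1)" by (simp add: c_def xs_def)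
  show "c \<in># ms" using assms len ms c by (metis One_nat_def diff_less less_le_trans nth_mem_mset zero_less_one)
  have srt: "sorted (rev xs)" by (simp add: xs_def)
  have "c \<le> x" if "x \<in> set (take k xs)" for x
  proof -
    obtain i where i: "i < k" "x = xs ! i" using \<open>x \<in> _\<close> assms len by (auto simp: in_set_conv_nth)
    have "xs ! (k - 1) \<le> xs ! i"
      using sorted_rev_nth_mono[OF srt, of i "k - 1"] i assms len by auto
    then show ?thesis using i c by simp
  qed
  then have "filter (\<lambda>x. c \<le> x) (take k xs) = take k xs" by (intro filter_True) auto
  then have "filter (\<lambda>x. c \<le> x) xs = take k xs @ filter (\<lambda>x. c \<le> x) (drop k xs)"
    by (metis append_take_drop_id filter_append)
  then have "k \<le> length (filter (\<lambda>x. c \<le> x) xs)" using assms len by simp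
  then show "k \<le> size {# x \<in># ms. c \<le> x #}"
    by (metis mset_filter ms size_mset)
qed

lemma orthonormal_columns_card_le:
  assumes "(Q :: complex^'l^'n) \<in> orthonormal_columns"
  shows "CARD('l) \<le> CARD('n)"
proof -
  have lin: "linear ((*v) Q)"
    by (rule linearI) (simp_all add: matrix_vector_right_distrib scaleR_eq_smult vector_scalar_commute)
  have "x = y" if "Q *v x = Q *v y" for x y
    using orthonormal_columns_norm[OF assms, of "x - y"] that
    by (simp add: matrix_vector_mult_diff_distrib)
  then have inj: "inj ((*v) Q)" by (auto intro: injI)
  have "dim (range ((*v) Q)) = dim (UNIV :: (complex^'l) set)"
    using dim_image_eq[OF lin, of UNIV] inj by simp
  then have "DIM(complex^'l) \<le> DIM(complex^'n)"
    using dim_subset_UNIV[of "range ((*v) Q)"] by simp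
  then show ?thesis by simp
qed

text \<open>One half of the Courant-Fischer principle. \<open>F\<close> collects \<open>l\<close>
  orthonormal eigenvectors of the Gram matrix whose images have length at least
  \<open>\<sigma>_l(A)\<close>; their images under \<open>A\<close> are orthogonal, so the bound
  extends to the span.\<close>

lemma singular_value_subspace:
  fixes A :: "complex^'n^'n"
  assumes "CARD('l) \<le> CARD('n)"
  obtains F :: "complex^'l^'n" where "F \<in> orthonormal_columns"
    "\<And>c. singular_value CARD('l) A * norm c \<le> norm (A *v (F *v c))"
proof -
  obtain U where U: "unitary U"
    "\<And>j. (conj_transpose A ** A) *v column j U = of_real ((norm (A *v column j U))\<^sup>2) *s column j U"
    "singular_values A = image_mset (\<lambda>i. norm (A *v column i U)) (mset_set UNIV)"
    using singular_basis[of A] by blast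
  define s where "s = singular_value CARD('l) A"
  define I where "I = {i. s \<le> norm (A *v column i U)}"
  have sz: "size (singular_values A) = CARD('n)" by (simp add: U(3))
  have "s \<in># singular_values A" and *: "CARD('l) \<le> size {# x \<in># singular_values A. s \<le> x #}"
    using size_filter_ge_nth_largest[of "CARD('l)" "singular_values A"] assms sz
    unfolding s_def singular_value_def by auto
  then have s0: "0 \<le> s" unfolding U(3) by auto
  have "CARD('l) \<le> card I" using * unfolding U(3) filter_mset_image_mset size_image_mset I_def
    by (simp add: filter_mset_mset_set)
  then obtain f :: "'l \<Rightarrow> 'n" where f: "inj f" "range f \<subseteq> I"
    using inj_on_iff_card_le[of "UNIV :: 'l set" I] by auto
  define F :: "complex^'l^'n" where "F = (\<chi> i j. U $ i $ f j)"
  have cF: "column j F = column (f j) U" for j by (simp add: F_def column_def)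
  have Fo: "F \<in> orthonormal_columns"
    using U(1) f(1) unfolding unitary_iff orthonormal_columns_iff cF by (simp add: inj_eq)
  have "s * norm c \<le> norm (A *v (F *v c))" for c
  proof -
    define e :: "complex^'l" where "e = (\<chi> j. of_real ((norm (A *v column (f j) U))\<^sup>2) * c $ j)"
    have "conj_transpose A *v (A *v (F *v c)) = F *v e"
    proof -
      have "conj_transpose A *v (A *v (F *v c)) = ((conj_transpose A ** A) ** F) *v c"
        by (simp only: matrix_vector_mul_assoc matrix_mul_assoc)
      also have "\<dots> = (\<Sum>j\<in>UNIV. c $ j *s column j ((conj_transpose A ** A) ** F))"
        by (rule matrix_mult_sum)
      also have "\<dots> = (\<Sum>j\<in>UNIV. e $ j *s column j F)"
        by (rule sum.cong) (simp_all add: column_mult cF U(2) e_def mult.commute)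
      finally show ?thesis by (simp add: matrix_mult_sum)
    qed
    then have "cdot (A *v (F *v c)) (A *v (F *v c)) = cdot c e"
      by (metis cdot_conj_transpose orthonormal_columns_cdot[OF Fo])
    also have "\<dots> = of_real (\<Sum>j\<in>UNIV. (norm (A *v column (f j) U))\<^sup>2 * (cmod (c $ j))\<^sup>2)"
      by (simp add: cdot_def e_def complex_norm_square mult_ac del: of_real_power)
    finally have "(norm (A *v (F *v c)))\<^sup>2 = (\<Sum>j\<in>UNIV. (norm (A *v column (f j) U))\<^sup>2 * (cmod (c $ j))\<^sup>2)"
      by (simp only: cdot_self of_real_eq_iff)
    also have "\<dots> \<ge> (\<Sum>j\<in>UNIV. s\<^sup>2 * (cmod (c $ j))\<^sup>2)"
    proof (intro sum_mono mult_right_mono)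
      fix j
      have "f j \<in> I" using f by auto
      then show "s\<^sup>2 \<le> (norm (A *v column (f j) U))\<^sup>2" using s0 by (simp add: I_def)
    qed simp
    finally have "(s * norm c)\<^sup>2 \<le> (norm (A *v (F *v c)))\<^sup>2"
      by (simp add: power_mult_distrib norm_vec_sq[of c] sum_distrib_left)
    then show ?thesis by (rule power2_le_imp_le) simp
  qed
  then show ?thesis using that[OF Fo] unfolding s_def by blast
qed

section \<open>Uniformly distributed measures\<close>

text \<open>
  Christensen's argument: average the indicator of \<open>dist x y < r\<close> over \<open>M\<close> and \<open>N\<close> in both orders
  and let \<open>r\<close> tend to 0.
\<close>

lemma uniformly_distributed_le:
  fixes M N :: "'a::{metric_space,second_countable_topology} measure" and h :: "real \<Rightarrow> ennreal"
  assumes [measurable_cong]: "sets M = sets borel" "sets N = sets borel"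
    and "sigma_finite_measure M" "sigma_finite_measure N"
    and S: "AE x in M. x \<in> S" "AE x in N. x \<in> S"
    and ball: "\<And>x r. x \<in> S \<Longrightarrow> 0 < r \<Longrightarrow> emeasure M (ball x r) = h r"
      "\<And>x r. x \<in> S \<Longrightarrow> 0 < r \<Longrightarrow> emeasure N (ball x r) = h r"
    and h: "\<And>r. 0 < r \<Longrightarrow> 0 < h r \<and> h r < \<infinity>"
    and "open U"
  shows "emeasure M U \<le> emeasure N U"
proof -
  interpret M: sigma_finite_measure M by fact
  interpret N: sigma_finite_measure N by fact
  interpret pair_sigma_finite M N ..
  have [measurable]: "U \<in> sets borel" using \<open>open U\<close> by simp
  have [measurable]: "ball x r \<in> sets borel" for x :: 'a and r by simp
  define r where "r n = inverse (real (Suc n))" for n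
  have r: "0 < r n" for n by (simp add: r_def)
  define g where "g n x y = (indicator U x * indicator U y * indicator {p. dist (fst p) (snd p) < r n} (x, y) :: ennreal)"
    for n x y
  have [measurable]: "(\<lambda>(x, y). g n x y) \<in> borel_measurable (M \<Otimes>\<^sub>M N)" for n
    unfolding g_def split_beta' by measurable
  \<comment> \<open>On \<open>U \<inter> S\<close> this is the share, measured by \<open>N\<close>,
    of the ball around \<open>x\<close> that lies in \<open>U\<close>. Since \<open>U\<close> is
    open, it is eventually 1 there, and Fatou's lemma applies.\<close>
  define f where "f n x = (\<integral>\<^sup>+ y. g n x y \<partial>N) * inverse (h (r n))" for n x
  have [measurable]: "f n \<in> borel_measurable M" for n
    unfolding f_def by measurable
  have f: "f n x = indicator U x * (emeasure N (U \<inter> ball x (r n)) * inverse (h (r n)))" for n x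
  proof -
    have "(\<integral>\<^sup>+ y. g n x y \<partial>N) = (\<integral>\<^sup>+ y. indicator U x * indicator (U \<inter> ball x (r n)) y \<partial>N)"
      by (rule nn_integral_cong) (auto simp: g_def indicator_def)
    also have "\<dots> = indicator U x * emeasure N (U \<inter> ball x (r n))"
      by (simp add: nn_integral_cmult)
    finally show ?thesis by (simp add: f_def mult.assoc)
  qed
  have hh: "h (r n) * inverse (h (r n)) = 1" for n
    using h[OF r[of n]] ennreal_mult_divide_eq[of "h (r n)" 1] 
    by (metis ennreal_divide_self infinity_ennreal_def less_irrefl divide_ennreal_def)
  have "AE x in M. indicator U x \<le> liminf (\<lambda>n. f n x)"
    using S(1)
  proof eventually_elim
    case (elim x)
    show ?case
    proof (cases "x \<in> U")
      case True
      then obtain e where e: "0 < e" "ball x e \<subseteq> U" using \<open>open U\<close> open_contains_ball by blast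
      have "r \<longlonglongrightarrow> 0" unfolding r_def by (rule LIMSEQ_inverse_real_of_nat)
      then have "eventually (\<lambda>n. r n < e) sequentially" using e(1) by (rule order_tendstoD)
      then have "eventually (\<lambda>n. f n x = 1) sequentially"
      proof eventually_elim
        case (elim n)
        then have "U \<inter> ball x (r n) = ball x (r n)" using e by auto
        then show ?case using True ball(2)[OF \<open>x \<in> S\<close> r] by (simp add: f hh)
      qed
      then have "(\<lambda>n. f n x) \<longlonglongrightarrow> 1" by (rule tendsto_eventually)
      then have "liminf (\<lambda>n. f n x) = 1" by (intro lim_imp_Liminf) auto
      then show ?thesis using True by simp
    qed simp
  qed
  then have "(\<integral>\<^sup>+ x. indicator U x \<partial>M) \<le> (\<integral>\<^sup>+ x. liminf (\<lambda>n. f n x) \<partial>M)"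
    by (rule nn_integral_mono_AE)
  also have "\<dots> \<le> liminf (\<lambda>n. \<integral>\<^sup>+ x. f n x \<partial>M)"
    by (rule nn_integral_liminf) simp
  also have "\<dots> \<le> liminf (\<lambda>n::nat. emeasure N U)"
  proof (rule Liminf_mono, rule always_eventually, rule allI)
    fix n
    have "(\<integral>\<^sup>+ x. f n x \<partial>M) = (\<integral>\<^sup>+ x. (\<integral>\<^sup>+ y. g n x y \<partial>N) \<partial>M) * inverse (h (r n))"
      unfolding f_def by (rule nn_integral_multc) measurable
    \<comment> \<open>After the swap the inner integral is at most the \<open>M\<close>-measure of a
      ball around \<open>y\<close>, that is \<open>h (r n)\<close>, which cancels the normalisation
      and leaves the \<open>N\<close>-measure of \<open>U\<close>.\<close>
    also have "(\<integral>\<^sup>+ x. (\<integral>\<^sup>+ y. g n x y \<partial>N) \<partial>M) = (\<integral>\<^sup>+ y. (\<integral>\<^sup>+ x. g n x y \<partial>M) \<partial>N)"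
      by (rule Fubini'[symmetric]) measurable
    also have "\<dots> \<le> (\<integral>\<^sup>+ y. indicator U y * h (r n) \<partial>N)"
    proof (rule nn_integral_mono_AE)
      show "AE y in N. (\<integral>\<^sup>+ x. g n x y \<partial>M) \<le> indicator U y * h (r n)"
        using S(2)
      proof eventually_elim
        case (elim y)
        have "(\<integral>\<^sup>+ x. g n x y \<partial>M) \<le> (\<integral>\<^sup>+ x. indicator U y * indicator (ball y (r n)) x \<partial>M)"
          by (rule nn_integral_mono) (auto simp: g_def indicator_def dist_commute)
        also have "\<dots> = indicator U y * emeasure M (ball y (r n))"
          by (simp add: nn_integral_cmult)
        finally show ?case using ball(1)[OF elim r] by simp
      qed
    qed
    also have "\<dots> = emeasure N U * h (r n)" by (simp add: nn_integral_multc)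
    finally show "(\<integral>\<^sup>+ x. f n x \<partial>M) \<le> emeasure N U"
      by (metis (no_types, lifting) hh mult.assoc mult.right_neutral mult_right_mono zero_le)
  qed
  also have "\<dots> = emeasure N U" by (simp add: Liminf_const)
  finally show ?thesis by simp
qed

text \<open>\<open>U\<close> is an isometry, so Lebesgue measure and its image give every ball of
  radius \<open>r\<close> the same volume \<open>h r\<close>. The comparison of uniformly
  distributed measures, used in both directions, makes them agree on open sets, in particular on
  boxes.\<close>

lemma lborel_distr_unitary:
  fixes U :: "complex^'n^'n"
  assumes "unitary U"
  shows "distr lborel borel ((*v) U) = lborel"
proof -
  let ?f = "(*v) U"
  let ?N = "distr lborel borel ?f :: (complex^'n) measure"
  have cont: "continuous_on UNIV ?f" by (intro continuous_intros)
  then have [measurable]: "?f \<in> borel_measurable borel" by (rule borel_measurable_continuous_onI)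
  have Uo: "U \<in> orthonormal_columns" using assms by (simp add: unitary_iff)
  have dist: "dist (U *v x) (U *v y) = dist x y" for x y
    using orthonormal_columns_norm[OF Uo, of "x - y"]
    by (simp add: dist_norm matrix_vector_mult_diff_distrib)
  have inv: "U *v (conj_transpose U *v x) = x" for x
    using assms by (simp add: matrix_vector_mul_assoc unitary_def)
  define h where "h r = emeasure lborel (ball (0::complex^'n) r)" for r
  have ball: "emeasure lborel (ball x r) = h r" if "0 < r" for x :: "complex^'n" and r
    using that by (simp add: h_def emeasure_ball)
  have ball': "emeasure ?N (ball x r) = h r" if "0 < r" for x :: "complex^'n" and r
  proof -
    have "?f -` ball x r = ball (conj_transpose U *v x) r"
    proof (intro set_eqI)
      fix y
      have "dist x (U *v y) = dist (conj_transpose U *v x) y"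
        using dist[of "conj_transpose U *v x" y] by (simp only: inv)
      then show "y \<in> ?f -` ball x r \<longleftrightarrow> y \<in> ball (conj_transpose U *v x) r" by simp
    qed
    then show ?thesis using ball[OF that] by (simp add: emeasure_distr)
  qed
  have h: "0 < h r \<and> h r < \<infinity>" if "0 < r" for r
    using that emeasure_lborel_ball_finite[of "0::complex^'n" r]
    by (auto simp: h_def emeasure_ball unit_ball_vol_pos intro!: ennreal_zero_less_mult_iff[THEN iffD2])
  have sf: "sigma_finite_measure ?N"
  proof (rule sigma_finite_measure.intro, intro exI conjI ballI)
    show "countable (range (\<lambda>n::nat. ball (0::complex^'n) (real n + 1)))" by simp
    show "\<Union> (range (\<lambda>n::nat. ball (0::complex^'n) (real n + 1))) = space ?N"
    proof -
      have "\<exists>n::nat. x \<in> ball 0 (real n + 1)" for x :: "complex^'n"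
      proof -
        obtain n where "norm x \<le> real n" using real_arch_simple by blast
        then have "x \<in> ball 0 (real n + 1)" by simp
        then show ?thesis ..
      qed
      then show ?thesis by auto
    qed
    show "emeasure ?N B \<noteq> \<infinity>" if "B \<in> range (\<lambda>n::nat. ball 0 (real n + 1))" for B
      using that ball' h by (auto simp: less_top[symmetric])
  qed auto
  have eq: "emeasure ?N B = emeasure lborel B" if "open B" for B
    using uniformly_distributed_le[of ?N lborel UNIV h B] uniformly_distributed_le[of lborel ?N UNIV h B]
      ball ball' h sf that lborel.sigma_finite_measure_axioms by (intro antisym) auto
  show ?thesis
  proof (rule lborel_eqI[symmetric])
    show "emeasure ?N (box l u) = (\<Prod>b\<in>Basis. (u - l) \<bullet> b)"
      if "\<And>b. b \<in> Basis \<Longrightarrow> l \<bullet> b \<le> u \<bullet> b" for l u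
      unfolding eq[OF open_box] by (rule emeasure_lborel_box) (rule that)
  qed simp
qed

text \<open>The ball functions \<open>h\<close> and \<open>k\<close> may differ a priori.
  Integrating the indicator of \<open>dist x y < r\<close> in both orders identifies them, because
  both measures have total mass 1.\<close>

lemma uniformly_distributed_unique:
  fixes M N :: "'a::{metric_space,second_countable_topology} measure" and h k :: "real \<Rightarrow> ennreal"
  assumes "prob_space M" "prob_space N"
    and sets [measurable_cong]: "sets M = sets borel" "sets N = sets borel"
    and S: "AE x in M. x \<in> S" "AE x in N. x \<in> S"
    and ball: "\<And>x r. x \<in> S \<Longrightarrow> 0 < r \<Longrightarrow> emeasure M (ball x r) = h r"
      "\<And>x r. x \<in> S \<Longrightarrow> 0 < r \<Longrightarrow> emeasure N (ball x r) = k r"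
  shows "M = N"
proof -
  interpret M: prob_space M by fact
  interpret N: prob_space N by fact
  interpret pair_sigma_finite M N ..
  have [measurable]: "ball x r \<in> sets borel" for x :: 'a and r by simp
  have hk: "h r = k r" if r: "0 < r" for r
  proof -
    let ?g = "\<lambda>x y. indicator {p. dist (fst p) (snd p) < r} (x, y) :: ennreal"
    have "(\<integral>\<^sup>+ x. (\<integral>\<^sup>+ y. ?g x y \<partial>N) \<partial>M) = (\<integral>\<^sup>+ x. k r \<partial>M)"
    proof (rule nn_integral_cong_AE)
      show "AE x in M. (\<integral>\<^sup>+ y. ?g x y \<partial>N) = k r"
        using S(1)
      proof eventually_elim
        case (elim x)
        have "(\<integral>\<^sup>+ y. ?g x y \<partial>N) = (\<integral>\<^sup>+ y. indicator (ball x r) y \<partial>N)"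
          by (rule nn_integral_cong) (simp add: indicator_def)
        then show ?case using ball(2)[OF elim r] by simp
      qed
    qed
    moreover have "(\<integral>\<^sup>+ y. (\<integral>\<^sup>+ x. ?g x y \<partial>M) \<partial>N) = (\<integral>\<^sup>+ y. h r \<partial>N)"
    proof (rule nn_integral_cong_AE)
      show "AE y in N. (\<integral>\<^sup>+ x. ?g x y \<partial>M) = h r"
        using S(2)
      proof eventually_elim
        case (elim y)
        have "(\<integral>\<^sup>+ x. ?g x y \<partial>M) = (\<integral>\<^sup>+ x. indicator (ball y r) x \<partial>M)"
          by (rule nn_integral_cong) (simp add: indicator_def dist_commute)
        then show ?case using ball(1)[OF elim r] by simp
      qed
    qed
    moreover have "(\<integral>\<^sup>+ y. (\<integral>\<^sup>+ x. ?g x y \<partial>M) \<partial>N) = (\<integral>\<^sup>+ x. (\<integral>\<^sup>+ y. ?g x y \<partial>N) \<partial>M)"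
      by (rule Fubini') measurable
    ultimately show ?thesis by (simp add: M.emeasure_space_1 N.emeasure_space_1)
  qed
  obtain x0 where x0: "x0 \<in> S"
    using eventually_happens'[OF M.ae_filter_bot S(1)] by blast
  have pos: "0 < h r \<and> h r < \<infinity>" if r: "0 < r" for r
  proof
    show "h r < \<infinity>" using ball(1)[OF x0 r] M.emeasure_finite by (metis infinity_ennreal_def less_top)
    show "0 < h r"
    proof (rule ccontr)
      assume "\<not> 0 < h r"
      then have h0: "h r = 0" by (simp add: not_less)
      \<comment> \<open>If balls of radius \<open>r\<close> had measure 0, countably many of them
        would cover \<open>S\<close> by the Lindelof property, and \<open>S\<close> would be
        null.\<close>
      obtain F where F: "F \<subseteq> (\<lambda>x. ball x r) ` S" "countable F" "\<Union>F = \<Union>((\<lambda>x. ball x r) ` S)"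
        using Lindelof[of "(\<lambda>x. ball x r) ` S"] by (auto simp: image_iff)
      have "\<Union>F \<in> null_sets M"
      proof (rule null_sets_UN'[where N = "\<lambda>x. x", simplified])
        show "B \<in> null_sets M" if B: "B \<in> F" for B
        proof -
          obtain x where "x \<in> S" "B = ball x r" using F(1) B by auto
          then show ?thesis using ball(1)[OF _ r] h0 by (auto intro!: null_setsI)
        qed
      qed (use F in auto)
      then have "AE x in M. x \<notin> \<Union>F" by (rule AE_not_in)
      then have "AE x in M. False"
        using S(1)
      proof eventually_elim
        case (elim x)
        then show False using F(3) r by (metis UN_I centre_in_ball)
      qed
      then show False using M.AE_False by simp
    qed
  qed
  have eq: "emeasure M B = emeasure N B" if "open B" for B
    using uniformly_distributed_le[of M N S h B] uniformly_distributed_le[of N M S h B]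
      S sets ball hk pos that M.sigma_finite_measure_axioms N.sigma_finite_measure_axioms
    by (intro antisym) auto
  show ?thesis
  proof (rule measure_eqI_generator_eq)
    show "Int_stable {B::'a set. open B}" by (auto simp: Int_stable_def)
    show "{B::'a set. open B} \<subseteq> Pow UNIV" by simp
    show "sets M = sigma_sets UNIV {B. open B}" "sets N = sigma_sets UNIV {B. open B}"
      using sets by (simp_all add: borel_def)
    show "range (\<lambda>_::nat. UNIV) \<subseteq> {B::'a set. open B}" by auto
    show "emeasure M UNIV \<noteq> \<infinity>" by (metis M.emeasure_finite infinity_ennreal_def)
  qed (use eq in auto)
qed

text \<open>The norm of the matrix type is the Frobenius norm. Split by columns, it shows that left
  multiplication by a unitary matrix is an isometry.\<close>

lemma norm_matrix_sq: "(norm (Z :: complex^'l^'n))\<^sup>2 = (\<Sum>j\<in>UNIV. (norm (column j Z))\<^sup>2)"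
proof -
  have "(norm Z)\<^sup>2 = (\<Sum>i\<in>UNIV. \<Sum>j\<in>UNIV. (cmod (Z $ i $ j))\<^sup>2)"
    by (simp add: norm_vec_def[of Z] L2_set_def sum_nonneg norm_vec_sq)
  also have "\<dots> = (\<Sum>j\<in>UNIV. \<Sum>i\<in>UNIV. (cmod (Z $ i $ j))\<^sup>2)" by (rule sum.swap)
  finally show ?thesis by (simp add: norm_vec_sq column_def)
qed

lemma unitary_mult_dist:
  fixes X Y :: "complex^'l^'n"
  assumes "unitary U"
  shows "dist (U ** X) (U ** Y) = dist X Y"
proof -
  have U: "U \<in> orthonormal_columns" using assms by (simp add: unitary_iff)
  have "U ** X - U ** Y = U ** (X - Y)"
    by (simp add: matrix_matrix_mult_def vec_eq_iff sum_subtractf algebra_simps)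
  moreover have "(norm (U ** (X - Y)))\<^sup>2 = (norm (X - Y))\<^sup>2"
    unfolding norm_matrix_sq column_mult orthonormal_columns_norm[OF U] ..
  ultimately show ?thesis by (simp add: dist_norm power2_eq_iff_nonneg)
qed

lemma matrix_mult_borel [measurable]:
  "(\<lambda>Q::complex^'l^'n. U ** Q) \<in> borel_measurable borel"
  "(\<lambda>Q::complex^'l^'n. Q ** V) \<in> borel_measurable borel"
  by (intro borel_measurable_continuous_onI continuous_intros)+

text \<open>The unitary group acts transitively and by isometries, so invariance makes the measure
  uniformly distributed on \<open>orthonormal_columns\<close>; uniqueness of the Haar distribution
  follows.\<close>

lemma haar_distribution_ball:
  fixes \<mu> :: "(complex^'l^'n) measure"
  assumes "haar_distribution \<mu>" "X \<in> orthonormal_columns" "Y \<in> orthonormal_columns"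
  shows "emeasure \<mu> (ball X r) = emeasure \<mu> (ball Y r)"
proof -
  obtain U where U: "unitary U" "U ** X = Y" using unitary_transitive assms by blast
  have sets: "sets \<mu> = sets borel" and inv: "distr \<mu> borel (\<lambda>Q. U ** Q) = \<mu>"
    using assms U by (auto simp: haar_distribution_def)
  have sp: "space \<mu> = UNIV" using sets_eq_imp_space_eq[OF sets] by simp
  have "emeasure \<mu> (ball Y r) = emeasure (distr \<mu> borel (\<lambda>Q. U ** Q)) (ball Y r)"
    by (simp add: inv)
  also have "\<dots> = emeasure \<mu> ((\<lambda>Q. U ** Q) -` ball Y r \<inter> space \<mu>)"
    by (rule emeasure_distr) (simp_all add: measurable_cong_sets[OF sets refl])
  also have "(\<lambda>Q. U ** Q) -` ball Y r \<inter> space \<mu> = ball X r"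
    using unitary_mult_dist[OF U(1), of X] by (auto simp: U(2)[symmetric] sp)
  finally show ?thesis by simp
qed

lemma haar_distribution_unique:
  fixes \<mu> \<nu> :: "(complex^'l^'n) measure"
  assumes "haar_distribution \<mu>" "haar_distribution \<nu>"
  shows "\<mu> = \<nu>"
proof -
  interpret M: prob_space \<mu> using assms by (simp add: haar_distribution_def)
  have ae: "AE Q in \<mu>. Q \<in> orthonormal_columns" using assms by (simp add: haar_distribution_def)
  then obtain X0 :: "complex^'l^'n" where X0: "X0 \<in> orthonormal_columns"
    using eventually_happens'[OF M.ae_filter_bot] by blast
  show ?thesis
    by (rule uniformly_distributed_unique[where S = orthonormal_columns
          and h = "\<lambda>r. emeasure \<mu> (ball X0 r)" and k = "\<lambda>r. emeasure \<nu> (ball X0 r)"])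
      (use assms X0 haar_distribution_ball in \<open>auto simp: haar_distribution_def\<close>)
qed

section \<open>The Gaussian measure\<close>

lemma vec_lambda_measurable [measurable]:
  "vec_lambda \<in> borel_measurable (PiM UNIV (\<lambda>_::'n::finite. lborel :: complex measure))"
proof (subst borel_measurable_euclidean_space, intro ballI)
  fix b :: "complex^'n" assume "b \<in> Basis"
  then obtain i c where b: "b = axis i c" by (auto simp: Basis_vec_def)
  show "(\<lambda>f. vec_lambda f \<bullet> b) \<in> borel_measurable (PiM UNIV (\<lambda>_::'n. lborel :: complex measure))"
    unfolding b inner_axis vec_lambda_beta by measurable
qed

lemma lborel_vec_eq_PiM:
  "(lborel :: (complex^'n) measure) = distr (PiM UNIV (\<lambda>_. lborel)) borel vec_lambda"
proof (rule lborel_eqI)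
  interpret product_sigma_finite "\<lambda>_::'n. lborel :: complex measure" ..
  fix l u :: "complex^'n"
  assume le: "\<And>b. b \<in> Basis \<Longrightarrow> l \<bullet> b \<le> u \<bullet> b"
  have le': "l $ i \<bullet> c \<le> u $ i \<bullet> c" if "c \<in> Basis" for i c
    using le[of "axis i c"] that by (auto simp: inner_axis Basis_vec_def)
  have box: "vec_lambda -` box l u \<inter> space (PiM UNIV (\<lambda>_::'n. lborel :: complex measure))
      = PiE UNIV (\<lambda>i. box (l $ i) (u $ i))"
    by (auto simp: space_PiM mem_box Basis_vec_def inner_axis PiE_def Pi_iff)
  have "emeasure (distr (PiM UNIV (\<lambda>_. lborel)) borel vec_lambda) (box l u) =
      emeasure (PiM UNIV (\<lambda>_. lborel)) (PiE UNIV (\<lambda>i. box (l $ i) (u $ i)))"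
    by (subst emeasure_distr) (simp_all add: box)
  also have "\<dots> = (\<Prod>i\<in>UNIV. emeasure lborel (box (l $ i) (u $ i)))"
    by (rule emeasure_PiM) simp_all
  also have "\<dots> = (\<Prod>i\<in>UNIV. ennreal (\<Prod>c\<in>Basis. (u $ i - l $ i) \<bullet> c))"
    using le' by (intro prod.cong refl emeasure_lborel_box) auto
  also have "\<dots> = ennreal (\<Prod>i\<in>UNIV. \<Prod>c\<in>Basis. (u $ i - l $ i) \<bullet> c)"
    using le' by (intro prod_ennreal prod_nonneg) (auto simp: inner_diff_left)
  also have "(\<Prod>i\<in>UNIV. \<Prod>c\<in>Basis. (u $ i - l $ i) \<bullet> c) =
      (\<Prod>(i,c)\<in>UNIV \<times> Basis. (u - l) \<bullet> axis i c)"
    by (simp add: prod.cartesian_product inner_axis)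
  also have "\<dots> = (\<Prod>b\<in>(\<lambda>(i,c). axis i c) ` (UNIV \<times> Basis). (u - l) \<bullet> b)"
    by (subst prod.reindex) (auto simp: inj_on_def axis_eq_axis case_prod_unfold)
  also have "(\<lambda>(i,c). axis i c) ` (UNIV \<times> Basis) = (Basis :: (complex^'n) set)"
    by (auto simp: Basis_vec_def)
  finally show "emeasure (distr (PiM UNIV (\<lambda>_. lborel)) borel vec_lambda) (box l u) =
      (\<Prod>b\<in>Basis. (u - l) \<bullet> b)" .
qed simp

text \<open>The disc of radius \<open>sqrt a\<close> has area \<open>pi * a\<close>, so
  \<open>|z|^2\<close> has constant density on the half-line. Areas of annuli become lengths of
  intervals, and Gaussian moments become moments of the exponential distribution.\<close>

lemma distr_lborel_cmod_sq:
  "distr lborel borel (\<lambda>z::complex. (cmod z)\<^sup>2) = density lborel (\<lambda>s. ennreal (pi * indicator {0..} s))"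
proof (rule measure_eqI_generator_eq)
  let ?M = "distr lborel borel (\<lambda>z::complex. (cmod z)\<^sup>2)"
  have M: "emeasure ?M {..a} = ennreal (pi * max 0 a)" for a
  proof -
    have "emeasure ?M {..a} = emeasure lborel {z::complex. (cmod z)\<^sup>2 \<le> a}"
      by (subst emeasure_distr) (auto intro: arg_cong[where f = "emeasure lborel"])
    also have "\<dots> = ennreal (pi * max 0 a)"
    proof (cases "0 \<le> a")
      case True
      have "{z::complex. (cmod z)\<^sup>2 \<le> a} = cball 0 (sqrt a)"
        using True by (auto simp: real_le_rsqrt sqrt_ge_absD)
      then show ?thesis using True emeasure_cball[of "sqrt a" "0::complex"]
        by (simp add: unit_ball_vol_2)
    next
      case False
      then have "{z::complex. (cmod z)\<^sup>2 \<le> a} = {}"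
        using order.trans[OF zero_le_power2] by auto
      then show ?thesis using False by simp
    qed
    finally show ?thesis .
  qed
  have N: "emeasure (density lborel (\<lambda>s. ennreal (pi * indicator {0..} s))) {..a} = ennreal (pi * max 0 a)" for a
  proof -
    have "emeasure (density lborel (\<lambda>s. ennreal (pi * indicator {0..} s))) {..a} =
        (\<integral>\<^sup>+ s. ennreal pi * indicator {0..a} s \<partial>lborel)"
      by (subst emeasure_density) (auto intro!: nn_integral_cong simp: indicator_def)
    also have "\<dots> = ennreal pi * emeasure lborel {0..a}" by (simp add: nn_integral_cmult)
    also have "\<dots> = ennreal (pi * max 0 a)"
      by (cases "0 \<le> a") (auto simp: ennreal_mult)
    finally show ?thesis .
  qed
  let ?E = "range (atMost :: real \<Rightarrow> real set)"
  show "Int_stable ?E" by (auto simp: Int_stable_def)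
  show "?E \<subseteq> Pow UNIV" by simp
  show "emeasure ?M X = emeasure (density lborel (\<lambda>s. ennreal (pi * indicator {0..} s))) X" if "X \<in> ?E" for X
    using that M N by auto
  show "sets ?M = sigma_sets UNIV ?E" by (simp add: borel_eq_atMost)
  show "sets (density lborel (\<lambda>s. ennreal (pi * indicator {0..} s))) = sigma_sets UNIV ?E"
    by (simp add: borel_eq_atMost)
  show "range (\<lambda>n::nat. {..real n}) \<subseteq> ?E" by auto
  show "(\<Union>n::nat. {..real n}) = UNIV" using real_arch_simple by auto
  show "emeasure ?M {..real n} \<noteq> \<infinity>" for n by (simp only: M) simp
qed

lemma nn_integral_cmod_sq:
  assumes [measurable]: "f \<in> borel_measurable borel"
  shows "(\<integral>\<^sup>+ z. f ((cmod z)\<^sup>2) \<partial>lborel) = (\<integral>\<^sup>+ s. ennreal pi * (indicator {0..} s * f s) \<partial>lborel)"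
proof -
  have "(\<integral>\<^sup>+ z. f ((cmod z)\<^sup>2) \<partial>lborel) = (\<integral>\<^sup>+ s. f s \<partial>(distr lborel borel (\<lambda>z::complex. (cmod z)\<^sup>2)))"
    by (subst nn_integral_distr) simp_all
  also have "\<dots> = (\<integral>\<^sup>+ s. ennreal (pi * indicator {0..} s) * f s \<partial>lborel)"
    unfolding distr_lborel_cmod_sq by (subst nn_integral_density) simp_all
  finally show ?thesis
    by (simp add: ennreal_mult ennreal_indicator[symmetric] mult.assoc)
qed

lemma gaussian_moments:
  "(\<integral>\<^sup>+ z. ennreal (exp (- (cmod z)\<^sup>2)) \<partial>(lborel :: complex measure)) = ennreal pi"
  "(\<integral>\<^sup>+ z. ennreal ((cmod z)\<^sup>2 * exp (- (cmod z)\<^sup>2)) \<partial>(lborel :: complex measure)) = ennreal pi"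
proof -
  have e: "(\<integral>\<^sup>+ s. ennreal (indicator {0..} s * (exp (- s) * s ^ i)) \<partial>lborel) = ennreal (fact i)" for i
  proof -
    have "(\<integral>\<^sup>+ s. ennreal (erlang_density 0 1 s * s ^ i) \<partial>lborel) = ennreal (fact i)"
      using nn_integral_erlang_ith_moment[of 1 0 i] by simp
    moreover have "erlang_density 0 1 s * s ^ i = indicator {0..} s * (exp (- s) * s ^ i)" for s :: real
      by (auto simp: erlang_density_def indicator_def)
    ultimately show ?thesis by simp
  qed
  have "(\<integral>\<^sup>+ z. ennreal (exp (- (cmod z)\<^sup>2) * ((cmod z)\<^sup>2) ^ i) \<partial>(lborel :: complex measure)) = ennreal pi * ennreal (fact i)" for i
  proof (subst nn_integral_cmod_sq[of "\<lambda>s. ennreal (exp (- s) * s ^ i)"])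
    have "(\<integral>\<^sup>+ s. ennreal pi * (indicator {0..} s * ennreal (exp (- s) * s ^ i)) \<partial>lborel) =
       (\<integral>\<^sup>+ s. ennreal pi * ennreal (indicator {0..} s * (exp (- s) * s ^ i)) \<partial>lborel)"
      by (rule nn_integral_cong) (simp add: indicator_def)
    then show "(\<integral>\<^sup>+ s. ennreal pi * (indicator {0..} s * ennreal (exp (- s) * s ^ i)) \<partial>lborel) = ennreal pi * ennreal (fact i)"
      by (simp add: nn_integral_cmult e)
  qed simp
  from this[of 0] this[of 1] show
    "(\<integral>\<^sup>+ z. ennreal (exp (- (cmod z)\<^sup>2)) \<partial>(lborel :: complex measure)) = ennreal pi"
    "(\<integral>\<^sup>+ z. ennreal ((cmod z)\<^sup>2 * exp (- (cmod z)\<^sup>2)) \<partial>(lborel :: complex measure)) = ennreal pi"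
    by (simp_all add: mult.commute)
qed

text \<open>In \<open>s = |z|^2\<close> the condition is a pair of affine inequalities with positive
  slopes \<open>w - d\<close> and \<open>w + d\<close>, so \<open>s\<close> lies between
  \<open>a\<close> and \<open>b\<close>. Here \<open>b - a\<close> equals
  \<open>2 d (w p - h) / (w^2 - d^2)\<close>, and \<open>- h\<close> is at most
  \<open>w p\<close>.\<close>

lemma annulus_area_le:
  fixes w h p d :: real
  assumes "0 < d" "d < w" "0 \<le> p" "- (w * p) \<le> h"
  shows "(\<integral>\<^sup>+ z. indicator {z. \<bar>w * (cmod z)\<^sup>2 + h\<bar> \<le> d * ((cmod z)\<^sup>2 + p)} z \<partial>(lborel :: complex measure))
    \<le> ennreal (pi * (4 * d * w / (w\<^sup>2 - d\<^sup>2)) * p)"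
proof -
  define S where "S = {s. \<bar>w * s + h\<bar> \<le> d * (s + p)}"
  define a where "a = (- h - d * p) / (w + d)"
  define b where "b = (d * p - h) / (w - d)"
  have pos: "0 < w + d" "0 < w - d" using assms by auto
  have wd: "w\<^sup>2 - d\<^sup>2 = (w + d) * (w - d)" by (simp add: power2_eq_square algebra_simps)
  have [measurable]: "S \<in> sets borel" unfolding S_def by measurable
  have sub: "S \<subseteq> {a..b}"
  proof
    fix s assume "s \<in> S"
    then have "w * s + h \<le> d * (s + p)" "- (w * s + h) \<le> d * (s + p)" by (auto simp: S_def)
    then have "s * (w - d) \<le> d * p - h" "- h - d * p \<le> s * (w + d)" by (auto simp: algebra_simps)
    then show "s \<in> {a..b}" using pos by (simp add: a_def b_def pos_divide_le_eq pos_le_divide_eq)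
  qed
  have ba: "b - a \<le> 4 * d * w / (w\<^sup>2 - d\<^sup>2) * p"
  proof -
    have "b - a = (2 * d * (w * p) - 2 * d * h) / ((w + d) * (w - d))"
      using pos unfolding a_def b_def by (simp add: divide_simps) (simp add: algebra_simps)
    also have "\<dots> \<le> (4 * d * w * p) / ((w + d) * (w - d))"
    proof (rule divide_right_mono)
      have "d * (- h) \<le> d * (w * p)" using assms by (intro mult_left_mono) auto
      then show "2 * d * (w * p) - 2 * d * h \<le> 4 * d * w * p" by (simp add: algebra_simps)
    qed (use pos in simp)
    finally show ?thesis by (simp add: wd)
  qed
  have "(\<integral>\<^sup>+ z. indicator {z. \<bar>w * (cmod z)\<^sup>2 + h\<bar> \<le> d * ((cmod z)\<^sup>2 + p)} z \<partial>(lborel :: complex measure))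
      = (\<integral>\<^sup>+ z. indicator S ((cmod z)\<^sup>2) \<partial>(lborel :: complex measure))"
    by (rule nn_integral_cong) (simp add: S_def indicator_def)
  also have "\<dots> = (\<integral>\<^sup>+ s. ennreal pi * (indicator {0..} s * indicator S s) \<partial>lborel)"
    by (rule nn_integral_cmod_sq) simp
  also have "\<dots> \<le> (\<integral>\<^sup>+ s. ennreal pi * indicator {a..b} s \<partial>lborel)"
    using sub by (intro nn_integral_mono) (auto simp: indicator_def)
  also have "\<dots> = ennreal pi * emeasure lborel {a..b}"
    by (simp add: nn_integral_cmult)
  also have "\<dots> \<le> ennreal pi * ennreal (4 * d * w / (w\<^sup>2 - d\<^sup>2) * p)"
    using ba by (intro mult_left_mono) (cases "a \<le> b"; auto intro: ennreal_leI)+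
  finally show ?thesis by (simp add: ennreal_mult'[symmetric] mult.assoc)
qed

text \<open>Normalised so that the coordinates are independent complex Gaussians with mean square 1;
  the second moment is what produces the factor \<open>n - 1\<close>.\<close>

definition gauss :: "(complex^'n) measure" where
  "gauss = density lborel (\<lambda>x. ennreal (exp (- (norm x)\<^sup>2) / pi ^ CARD('n)))"

lemma sets_gauss [simp, measurable_cong]: "sets gauss = sets borel"
  by (simp add: gauss_def)

lemma space_gauss [simp]: "space gauss = UNIV"
  by (simp add: gauss_def)

lemma distr_gauss_unitary:
  fixes U :: "complex^'n^'n"
  assumes "unitary U"
  shows "distr gauss borel ((*v) U) = gauss"
proof -
  have [measurable]: "(*v) U \<in> borel_measurable borel"
    by (intro borel_measurable_continuous_onI continuous_intros)
  let ?w = "\<lambda>x::complex^'n. ennreal (exp (- (norm x)\<^sup>2) / pi ^ CARD('n))"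
  have w: "?w (U *v x) = ?w x" for x
    using orthonormal_columns_norm[of U x] assms by (simp add: unitary_iff)
  have "density (distr lborel borel ((*v) U)) ?w = distr (density lborel (\<lambda>x. ?w (U *v x))) borel ((*v) U)"
    by (rule density_distr) simp_all
  then show ?thesis unfolding w lborel_distr_unitary[OF assms] gauss_def by simp
qed

lemma nn_integral_gauss:
  assumes [measurable]: "f \<in> borel_measurable borel"
  shows "(\<integral>\<^sup>+ x. f x \<partial>(gauss :: (complex^'n) measure)) =
    (\<integral>\<^sup>+ y. ennreal ((\<Prod>i\<in>UNIV. exp (- (cmod (y i))\<^sup>2)) / pi ^ CARD('n)) * f (vec_lambda y)
      \<partial>PiM UNIV (\<lambda>_. lborel))"
proof -
  have e: "exp (- (norm (vec_lambda y :: complex^'n))\<^sup>2) = (\<Prod>i\<in>UNIV. exp (- (cmod (y i))\<^sup>2))" for y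
    by (simp add: norm_vec_sq exp_sum sum_negf[symmetric])
  have "(\<integral>\<^sup>+ x. f x \<partial>(gauss :: (complex^'n) measure)) =
      (\<integral>\<^sup>+ x. ennreal (exp (- (norm x)\<^sup>2) / pi ^ CARD('n)) * f x \<partial>(lborel :: (complex^'n) measure))"
    unfolding gauss_def by (subst nn_integral_density) simp_all
  also have "\<dots> = (\<integral>\<^sup>+ y. ennreal (exp (- (norm (vec_lambda y :: complex^'n))\<^sup>2) / pi ^ CARD('n)) * f (vec_lambda y)
      \<partial>PiM UNIV (\<lambda>_. lborel))"
    unfolding lborel_vec_eq_PiM by (subst nn_integral_distr) simp_all
  finally show ?thesis unfolding e .
qed

lemma prob_space_gauss: "prob_space (gauss :: (complex^'n) measure)"
proof (rule prob_spaceI)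
  interpret product_sigma_finite "\<lambda>_::'n. lborel :: complex measure" ..
  have "emeasure (gauss :: (complex^'n) measure) (space gauss) = (\<integral>\<^sup>+ x. 1 \<partial>(gauss :: (complex^'n) measure))"
    by simp
  also have "\<dots> = (\<integral>\<^sup>+ y. ennreal (inverse (pi ^ CARD('n))) * (\<Prod>i\<in>UNIV. ennreal (exp (- (cmod (y i))\<^sup>2)))
      \<partial>PiM UNIV (\<lambda>_::'n. lborel))"
    by (subst nn_integral_gauss) (auto intro!: nn_integral_cong
        simp: prod_ennreal ennreal_mult'[symmetric] divide_inverse mult.commute)
  also have "\<dots> = ennreal (inverse (pi ^ CARD('n))) * (\<Prod>i\<in>(UNIV::'n set). ennreal pi)"
  proof (subst nn_integral_cmult)
    have "(\<integral>\<^sup>+ y. (\<Prod>i\<in>UNIV. ennreal (exp (- (cmod (y i))\<^sup>2))) \<partial>PiM UNIV (\<lambda>_::'n. lborel)) =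
        (\<Prod>i\<in>(UNIV::'n set). ennreal pi)"
      by (subst product_nn_integral_prod[of UNIV "\<lambda>_ z. ennreal (exp (- (cmod z)\<^sup>2))"])
        (simp_all add: gaussian_moments)
    then show "ennreal (inverse (pi ^ CARD('n))) * (\<integral>\<^sup>+ y. (\<Prod>i\<in>UNIV. ennreal (exp (- (cmod (y i))\<^sup>2)))
        \<partial>PiM UNIV (\<lambda>_::'n. lborel)) = ennreal (inverse (pi ^ CARD('n))) * (\<Prod>i\<in>(UNIV::'n set). ennreal pi)"
      by simp
  qed simp_all
  also have "\<dots> = 1" by (simp add: ennreal_power ennreal_mult'[symmetric])
  finally show "emeasure (gauss :: (complex^'n) measure) (space gauss) = 1" .
qed

section \<open>Small values of a quadratic form of a Gaussian vector\<close>

text \<open>\<open>w\<close> is the numerical radius, attained by compactness, and \<open>c\<close>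
  is the phase that makes the extremal value real. The last claim is the inequality between operator
  norm and twice the numerical radius, obtained by polarising the sesquilinear form at
  \<open>u\<close> and \<open>B u\<close>.\<close>

lemma numerical_radius:
  fixes B :: "complex^'n^'n"
  assumes u: "u \<noteq> 0" "\<sigma> * norm u \<le> norm (B *v u)"
  obtains v c w where "norm v = 1" "cmod c = 1" "c * cdot v (B *v v) = of_real w"
    "\<And>x. cmod (cdot x (B *v x)) \<le> w * (norm x)\<^sup>2" "\<sigma> \<le> 2 * w"
proof -
  have cont: "continuous_on UNIV (\<lambda>x. cmod (cdot x (B *v x)))" by (intro continuous_intros)
  obtain v where v: "norm v = 1" "\<And>x. norm x = 1 \<Longrightarrow> cmod (cdot x (B *v x)) \<le> cmod (cdot v (B *v v))"
    using compact_attains_sup_on_subspace[OF closed_UNIV UNIV_I norm_axis_complex cont] by auto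
  define w where "w = cmod (cdot v (B *v v))"
  have le: "cmod (cdot x (B *v x)) \<le> w * (norm x)\<^sup>2" for x
  proof (cases "x = 0")
    case False
    define y where "y = complex_of_real (1 / norm x) *s x"
    have x: "x = of_real (norm x) *s y" using False by (simp add: y_def vec_eq_iff)
    have "norm y = 1" using False by (simp add: y_def norm_vector_scalar_mult norm_divide)
    then have "cmod (cdot y (B *v y)) \<le> w" using v by (simp add: w_def)
    moreover have "cdot x (B *v x) = of_real ((norm x)\<^sup>2) * cdot y (B *v y)"
      by (subst (1 2) x, simp only: cdot_smult_form)
    ultimately show ?thesis
      using mult_left_mono[of "cmod (cdot y (B *v y))" w "(norm x)\<^sup>2"]
      by (simp add: norm_mult mult.commute[of w] norm_power)
  qed simp
  \<comment> \<open>If \<open>w = 0\<close> any phase will do; 1 keeps the modulus right where the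
    quotient would be 0.\<close>
  define c where "c = (if w = 0 then 1 else cnj (cdot v (B *v v)) / of_real w)"
  have c: "cmod c = 1" by (simp add: c_def norm_divide w_def)
  have cw: "c * cdot v (B *v v) = of_real w"
    using complex_norm_square[of "cdot v (B *v v)"]
    by (auto simp: c_def w_def[symmetric] field_simps power2_eq_square)
  have "\<sigma> \<le> 2 * w"
  proof -
    define y0 where "y0 = B *v u"
    define a b where "a = norm u" and "b = norm y0"
    have a: "0 < a" using u(1) by (simp add: a_def)
    show ?thesis
    proof (cases "y0 = 0")
      case True
      then have "\<sigma> * norm u \<le> 0" using u(2) by (simp add: y0_def)
      then have "\<sigma> \<le> 0" using u(1) by (simp add: mult_le_0_iff)
      moreover have "0 \<le> w" by (simp add: w_def)
      ultimately show ?thesis by linarith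
    next
      case False
      then have b: "0 < b" by (simp add: b_def)
      \<comment> \<open>The factors give \<open>x\<close> and \<open>y\<close> the common length
        \<open>a * b\<close>. With equal lengths the parallelogram law loses nothing against the
        product of the lengths, which yields the factor 2.\<close>
      define x where "x = complex_of_real b *s u"
      define y where "y = complex_of_real a *s y0"
      have nx: "norm x = a * b" "norm y = a * b" using a b
        by (simp_all add: x_def y_def norm_vector_scalar_mult a_def b_def)
      have yBx: "cdot y (B *v x) = of_real (a * b * b\<^sup>2)"
        by (simp add: x_def y_def vector_scalar_commute y0_def[symmetric] cdot_self b_def)
      define q where "q z = cdot z (B *v z)" for z
      have "4 * cdot y (B *v x) = q (x + y) - q (x - y) + \<i> * q (x + \<i> *s y) - \<i> * q (x - \<i> *s y)"
        by (simp add: q_def vector_scalar_commute matrix_vector_right_distrib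
            matrix_vector_mult_diff_distrib algebra_simps)
      then have "4 * cmod (cdot y (B *v x)) = cmod (q (x + y) - q (x - y) + \<i> * q (x + \<i> *s y) - \<i> * q (x - \<i> *s y))"
        by (metis norm_mult norm_numeral)
      also have "\<dots> \<le> cmod (q (x + y)) + cmod (q (x - y)) + cmod (q (x + \<i> *s y)) + cmod (q (x - \<i> *s y))"
        by (rule order_trans[OF norm_triangle_ineq4] order_trans[OF add_right_mono[OF norm_triangle_ineq]]
           order_trans[OF add_right_mono[OF add_right_mono[OF norm_triangle_ineq4]]])+ (simp add: norm_mult)
      also have "\<dots> \<le> w * (norm (x + y))\<^sup>2 + w * (norm (x - y))\<^sup>2 + w * (norm (x + \<i> *s y))\<^sup>2 + w * (norm (x - \<i> *s y))\<^sup>2"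
        unfolding q_def by (intro add_mono le)
      also have "\<dots> = w * 4 * ((norm x)\<^sup>2 + (norm y)\<^sup>2)"
      proof -
        have "(norm (x + t))\<^sup>2 + (norm (x - t))\<^sup>2 = 2 * ((norm x)\<^sup>2 + (norm t)\<^sup>2)" for t
          using norm_add_sq[of x t] norm_add_sq[of x "- t"] by simp
        note this[of y] this[of "\<i> *s y"]
        moreover have "norm (\<i> *s y) = norm y" by (simp add: norm_vector_scalar_mult)
        moreover have "w * (a + b + (c + d)) = w * (2 * S + 2 * S) \<Longrightarrow> w * a + w * b + w * c + w * d = w * 4 * S"
          for a b c d S :: real by (simp add: algebra_simps)
        ultimately show ?thesis by simp
      qed
      finally have "4 * (a * b * b\<^sup>2) \<le> w * 8 * (a * b)\<^sup>2"
      proof -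
        have "cmod (cdot y (B *v x)) = a * b * b\<^sup>2" using a b by (simp only: yBx norm_of_real) simp
        then show "4 * cmod (cdot y (B *v x)) \<le> w * 4 * ((norm x)\<^sup>2 + (norm y)\<^sup>2) \<Longrightarrow> ?thesis"
          by (simp add: nx)
      qed
      then have "(a * b * b) * b \<le> (a * b * b) * (2 * w * a)"
        by (simp add: power2_eq_square algebra_simps)
      then have "b \<le> 2 * w * a" using a b by (simp add: mult_le_cancel_left)
      then have "\<sigma> * a \<le> 2 * w * a" using u(2) by (simp add: a_def b_def y0_def)
      then show ?thesis using a by simp
    qed
  qed
  with that v(1) c cw le show ?thesis by blast
qed

text \<open>
  \<open>w |x|\<^sup>2 - Re (c x\<^sup>* B x)\<close> is a nonnegative form vanishing at \<open>v\<close>, so it does not change when a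
  multiple of \<open>v\<close> is added to its argument.
\<close>

lemma form_split_at_maximizer:
  fixes B :: "complex^'n^'n"
  assumes c: "cmod c = 1" and w: "c * cdot v (B *v v) = of_real w"
    and le: "\<And>x. cmod (cdot x (B *v x)) \<le> w * (norm x)\<^sup>2"
    and v: "norm v = 1" and x: "cdot v x = 0"
  shows "Re (c * cdot (a *s v + x) (B *v (a *s v + x))) = w * (cmod a)\<^sup>2 + Re (c * cdot x (B *v x))"
proof -
  define z where "z = a *s v"
  define L where "L = Re (c * (cdot z (B *v x) + cdot x (B *v z)))"
  have zz: "c * cdot z (B *v z) = of_real (w * (cmod a)\<^sup>2)"
  proof -
    have "c * cdot z (B *v z) = (a * cnj a) * (c * cdot v (B *v v))"
      by (simp add: z_def vector_scalar_commute)
    then show ?thesis unfolding w complex_norm_square[symmetric] by simp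
  qed
  have exp: "Re (c * cdot (of_real t *s z + x) (B *v (of_real t *s z + x))) =
      t\<^sup>2 * (w * (cmod a)\<^sup>2) + t * L + Re (c * cdot x (B *v x))" for t
  proof -
    have "c * cdot (of_real t *s z + x) (B *v (of_real t *s z + x)) =
       of_real (t\<^sup>2) * (c * cdot z (B *v z)) + of_real t * (c * (cdot z (B *v x) + cdot x (B *v z))) + c * cdot x (B *v x)"
      by (simp add: matrix_vector_right_distrib vector_scalar_commute power2_eq_square algebra_simps)
    then show ?thesis unfolding zz L_def by (simp del: of_real_power)
  qed
  \<comment> \<open>The quadratic terms in \<open>t\<close> cancel because the nonnegative form
    vanishes at \<open>z\<close>. What remains is affine in \<open>t\<close>, so its slope, the
    cross term \<open>L\<close>, is 0.\<close>
  have "0 \<le> (w * (norm x)\<^sup>2 - Re (c * cdot x (B *v x))) + t * (- L)" for t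
  proof -
    let ?y = "of_real t *s z + x"
    have "Re (c * cdot ?y (B *v ?y)) \<le> cmod (c * cdot ?y (B *v ?y))" by (rule complex_Re_le_cmod)
    also have "\<dots> \<le> w * (norm ?y)\<^sup>2" using le by (simp only: norm_mult c mult_1_left)
    also have "(norm ?y)\<^sup>2 = t\<^sup>2 * (cmod a)\<^sup>2 + (norm x)\<^sup>2"
      unfolding norm_add_sq by (simp add: z_def x norm_vector_scalar_mult v norm_mult power_mult_distrib)
    finally show ?thesis unfolding exp by (simp add: algebra_simps)
  qed
  then have "- L = 0" by (rule nonneg_affine_imp_const)
  then have "L = 0" by simp
  with exp[of 1] show ?thesis by (simp add: z_def)
qed

text \<open>After a rotation taking a coordinate axis to \<open>v\<close>, fix all coordinates but
  the one along \<open>v\<close>. The event confines that one to an annulus of area at most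
  \<open>pi * C * p\<close>, where \<open>p\<close> is the squared length of the others; the mean of
  \<open>p\<close> is \<open>n - 1\<close>.\<close>

lemma gauss_quadratic_form_small_ball:
  fixes B :: "complex^'n^'n"
  assumes u: "u \<noteq> 0" "\<sigma> * norm u \<le> norm (B *v u)" and d: "0 < \<delta>" "2 * \<delta> < \<sigma>"
  shows "emeasure gauss {g. cmod (cdot g (B *v g)) \<le> \<delta> * (norm g)\<^sup>2}
    \<le> ennreal (8 * \<delta> * \<sigma> / (\<sigma>\<^sup>2 - 4 * \<delta>\<^sup>2) * (real CARD('n) - 1))"
proof -
  obtain v c w where v: "norm v = 1" and c: "cmod c = 1" and cw: "c * cdot v (B *v v) = of_real w"
    and le: "\<And>x. cmod (cdot x (B *v x)) \<le> w * (norm x)\<^sup>2" and sw: "\<sigma> \<le> 2 * w"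
    using numerical_radius[OF u] by blast
  have dw: "\<delta> < w" using d sw by linarith
  define k :: 'n where "k = undefined"
  define K where "K = UNIV - {k}"
  have K: "finite K" "k \<notin> K" "UNIV = insert k K" by (auto simp: K_def)
  have cardK: "real (card K) = real CARD('n) - 1"
    by (simp add: K_def card_Diff_singleton of_nat_diff Suc_leI)
  obtain W where W: "unitary W" "W *v axis k 1 = v" using unitary_first_column[OF v] by blast
  have Wo: "W \<in> orthonormal_columns" using W by (simp add: unitary_iff)
  interpret product_sigma_finite "\<lambda>_::'n. lborel :: complex measure" ..
  have [measurable]: "(*v) W \<in> borel_measurable borel"
    by (intro borel_measurable_continuous_onI continuous_intros)
  define E where "E = {g. cmod (cdot g (B *v g)) \<le> \<delta> * (norm g)\<^sup>2}"
  have [measurable]: "E \<in> sets borel" unfolding E_def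
    by (intro borel_closed closed_Collect_le continuous_intros)
  define x0 :: "('n \<Rightarrow> complex) \<Rightarrow> complex^'n" where "x0 y = W *v (\<chi> i. if i = k then 0 else y i)" for y
  define h where "h y = Re (c * cdot (x0 y) (B *v x0 y))" for y
  define p where "p y = (\<Sum>i\<in>K. (cmod (y i))\<^sup>2)" for y :: "'n \<Rightarrow> complex"
  define C where "C = 4 * \<delta> * w / (w\<^sup>2 - \<delta>\<^sup>2)"
  have wd: "0 < w\<^sup>2 - \<delta>\<^sup>2" using dw d by (simp add: power_strict_mono)
  have C0: "0 \<le> C" using wd dw d by (simp add: C_def)
  have p0: "0 \<le> p y" for y by (simp add: p_def sum_nonneg)
  have split: "W *v vec_lambda (y(k := z)) = z *s v + x0 y" for y z
  proof -
    have "vec_lambda (y(k := z)) = z *s axis k 1 + (\<chi> i. if i = k then 0 else y i)"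
      by (simp add: vec_eq_iff axis_def)
    then show ?thesis by (simp add: x0_def matrix_vector_right_distrib vector_scalar_commute W)
  qed
  have orth: "cdot v (x0 y) = 0" for y
    unfolding W(2)[symmetric] x0_def orthonormal_columns_cdot[OF Wo] cdot_axis by simp
  have nx0: "(norm (x0 y))\<^sup>2 = p y" for y
  proof -
    have "(norm (x0 y))\<^sup>2 = (\<Sum>i\<in>UNIV. (cmod (if i = k then 0 else y i))\<^sup>2)"
      unfolding x0_def orthonormal_columns_norm[OF Wo] norm_vec_sq by simp
    also have "\<dots> = (\<Sum>i\<in>K. (cmod (if i = k then 0 else y i))\<^sup>2)"
      by (subst K(3)) (simp add: K(1,2))
    finally show ?thesis using K(2) by (auto simp: p_def intro!: sum.cong)
  qed
  have h: "- (w * p y) \<le> h y" for y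
  proof -
    have "\<bar>h y\<bar> \<le> cmod (c * cdot (x0 y) (B *v x0 y))" unfolding h_def by (rule abs_Re_le_cmod)
    also have "\<dots> \<le> w * p y" using le[of "x0 y"] c by (simp add: norm_mult nx0)
    finally show ?thesis by linarith
  qed
  have inE: "\<bar>w * (cmod z)\<^sup>2 + h y\<bar> \<le> \<delta> * ((cmod z)\<^sup>2 + p y)" if "W *v vec_lambda (y(k := z)) \<in> E" for y z
  proof -
    let ?g = "z *s v + x0 y"
    have "w * (cmod z)\<^sup>2 + h y = Re (c * cdot ?g (B *v ?g))"
      unfolding h_def by (rule form_split_at_maximizer[OF c cw le v orth, symmetric])
    then have "\<bar>w * (cmod z)\<^sup>2 + h y\<bar> \<le> cmod (c * cdot ?g (B *v ?g))"
      by (simp add: abs_Re_le_cmod del: times_complex.sel)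
    also have "\<dots> \<le> \<delta> * (norm ?g)\<^sup>2" using that c by (simp add: norm_mult split E_def)
    also have "(norm ?g)\<^sup>2 = (cmod z)\<^sup>2 + p y"
      unfolding norm_add_sq by (simp add: orth norm_vector_scalar_mult v nx0)
    finally show ?thesis .
  qed
  define F where "F y = ennreal ((\<Prod>i\<in>UNIV. exp (- (cmod (y i))\<^sup>2)) / pi ^ CARD('n)) *
      indicator E (W *v vec_lambda y)" for y
  have [measurable]: "(\<lambda>y. W *v vec_lambda y) \<in> borel_measurable (PiM UNIV (\<lambda>_::'n. lborel :: complex measure))"
    by (rule measurable_compose[OF vec_lambda_measurable]) simp
  have [measurable]: "F \<in> borel_measurable (PiM UNIV (\<lambda>_::'n. lborel))"
    unfolding F_def by measurable
  have inner: "(\<integral>\<^sup>+ z. F (y(k := z)) \<partial>lborel) \<le>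
      ennreal (pi * C / pi ^ CARD('n)) * (\<Sum>j\<in>K. \<Prod>i\<in>K. ennreal ((if i = j then (cmod (y i))\<^sup>2 else 1) * exp (- (cmod (y i))\<^sup>2)))"
    for y
  proof -
    let ?e = "(\<Prod>i\<in>K. exp (- (cmod (y i))\<^sup>2)) / pi ^ CARD('n)"
    have "F (y(k := z)) \<le> ennreal ?e * indicator {z. \<bar>w * (cmod z)\<^sup>2 + h y\<bar> \<le> \<delta> * ((cmod z)\<^sup>2 + p y)} z" for z
    proof -
      have "(\<Prod>i\<in>UNIV. exp (- (cmod ((y(k := z)) i))\<^sup>2)) = exp (- (cmod z)\<^sup>2) * (\<Prod>i\<in>K. exp (- (cmod (y i))\<^sup>2))"
        by (subst K(3), subst prod.insert) (use K(1,2) in \<open>auto intro!: prod.cong\<close>)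
      \<comment> \<open>The density in the coordinate \<open>z\<close> is replaced by its maximum,
        so only the area of the annulus counts.\<close>
      also have "\<dots> \<le> 1 * (\<Prod>i\<in>K. exp (- (cmod (y i))\<^sup>2))"
        by (intro mult_right_mono prod_nonneg) auto
      finally have "ennreal ((\<Prod>i\<in>UNIV. exp (- (cmod ((y(k := z)) i))\<^sup>2)) / pi ^ CARD('n)) \<le> ennreal ?e"
        by (intro ennreal_leI divide_right_mono) auto
      then show ?thesis
        unfolding F_def by (intro mult_mono) (auto simp: indicator_def inE)
    qed
    then have "(\<integral>\<^sup>+ z. F (y(k := z)) \<partial>lborel) \<le>
        (\<integral>\<^sup>+ z. ennreal ?e * indicator {z. \<bar>w * (cmod z)\<^sup>2 + h y\<bar> \<le> \<delta> * ((cmod z)\<^sup>2 + p y)} z \<partial>lborel)"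
      by (intro nn_integral_mono)
    also have "\<dots> = ennreal ?e * (\<integral>\<^sup>+ z. indicator {z. \<bar>w * (cmod z)\<^sup>2 + h y\<bar> \<le> \<delta> * ((cmod z)\<^sup>2 + p y)} z \<partial>lborel)"
      by (rule nn_integral_cmult) measurable
    also have "\<dots> \<le> ennreal ?e * ennreal (pi * C * p y)"
      unfolding C_def by (intro mult_left_mono annulus_area_le d dw p0 h) simp
    also have "\<dots> = ennreal (pi * C / pi ^ CARD('n) * (\<Sum>j\<in>K. (cmod (y j))\<^sup>2 * (\<Prod>i\<in>K. exp (- (cmod (y i))\<^sup>2))))"
    proof -
      have "0 \<le> ?e" by (intro divide_nonneg_pos prod_nonneg) auto
      moreover have "?e * (pi * C * p y) =
          pi * C / pi ^ CARD('n) * (\<Sum>j\<in>K. (cmod (y j))\<^sup>2 * (\<Prod>i\<in>K. exp (- (cmod (y i))\<^sup>2)))"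
        by (simp add: p_def sum_distrib_right[symmetric])
      ultimately show ?thesis by (simp only: ennreal_mult'[symmetric])
    qed
    \<comment> \<open>Each summand becomes a product over coordinates with one second-moment factor,
      so that its integral factorises; every factor integrates to \<open>pi\<close>.\<close>
    also have "(\<Sum>j\<in>K. (cmod (y j))\<^sup>2 * (\<Prod>i\<in>K. exp (- (cmod (y i))\<^sup>2))) =
        (\<Sum>j\<in>K. \<Prod>i\<in>K. (if i = j then (cmod (y i))\<^sup>2 else 1) * exp (- (cmod (y i))\<^sup>2))"
      using K(1) by (intro sum.cong) (auto simp: prod.distrib)
    also have "ennreal (pi * C / pi ^ CARD('n) * \<dots>) = ennreal (pi * C / pi ^ CARD('n)) *
        (\<Sum>j\<in>K. \<Prod>i\<in>K. ennreal ((if i = j then (cmod (y i))\<^sup>2 else 1) * exp (- (cmod (y i))\<^sup>2)))"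
    proof -
      have "ennreal (r * (\<Sum>j\<in>K. \<Prod>i\<in>K. a j i)) = ennreal r * (\<Sum>j\<in>K. \<Prod>i\<in>K. ennreal (a j i))"
        if "\<And>i j. 0 \<le> a j i" "0 \<le> r" for a and r :: real
        using that by (simp add: ennreal_mult sum_nonneg prod_nonneg prod_ennreal sum_ennreal)
      then show ?thesis by this (use C0 in auto)
    qed
    finally show ?thesis .
  qed
  have mom: "(\<integral>\<^sup>+ z. ennreal ((if b then (cmod z)\<^sup>2 else 1) * exp (- (cmod z)\<^sup>2)) \<partial>lborel) = ennreal pi" for b
    using gaussian_moments by (cases b) simp_all
  have "emeasure gauss E = emeasure (distr gauss borel ((*v) W)) E"
    by (simp add: distr_gauss_unitary[OF W(1)])
  also have "\<dots> = (\<integral>\<^sup>+ g. indicator E g \<partial>distr gauss borel ((*v) W))" by simp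
  also have "\<dots> = (\<integral>\<^sup>+ g. indicator E (W *v g) \<partial>gauss)"
    by (rule nn_integral_distr) simp_all
  also have "\<dots> = (\<integral>\<^sup>+ y. F y \<partial>PiM UNIV (\<lambda>_. lborel))"
    unfolding F_def by (rule nn_integral_gauss[of "\<lambda>x. indicator E (W *v x)"]) measurable
  also have "\<dots> = (\<integral>\<^sup>+ y. (\<integral>\<^sup>+ z. F (y(k := z)) \<partial>lborel) \<partial>PiM K (\<lambda>_. lborel))"
    using product_nn_integral_insert[OF K(1,2), of F] unfolding K(3)[symmetric] by simp
  also have "\<dots> \<le> (\<integral>\<^sup>+ y. ennreal (pi * C / pi ^ CARD('n)) *
      (\<Sum>j\<in>K. \<Prod>i\<in>K. ennreal ((if i = j then (cmod (y i))\<^sup>2 else 1) * exp (- (cmod (y i))\<^sup>2))) \<partial>PiM K (\<lambda>_. lborel))"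
    by (intro nn_integral_mono inner)
  also have "\<dots> = ennreal (pi * C / pi ^ CARD('n)) * (\<Sum>j\<in>K. \<integral>\<^sup>+ y.
      (\<Prod>i\<in>K. ennreal ((if i = j then (cmod (y i))\<^sup>2 else 1) * exp (- (cmod (y i))\<^sup>2))) \<partial>PiM K (\<lambda>_. lborel))"
    by (simp add: nn_integral_cmult nn_integral_sum)
  also have "\<dots> = ennreal (pi * C / pi ^ CARD('n)) * (\<Sum>j\<in>K. \<Prod>i\<in>K. ennreal pi)"
  proof -
    have "(\<integral>\<^sup>+ y. (\<Prod>i\<in>K. ennreal ((if i = j then (cmod (y i))\<^sup>2 else 1) * exp (- (cmod (y i))\<^sup>2)))
        \<partial>PiM K (\<lambda>_. lborel)) = (\<Prod>i\<in>K. ennreal pi)" for j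
      by (subst product_nn_integral_prod[OF K(1), of
            "\<lambda>i z. ennreal ((if i = j then (cmod z)\<^sup>2 else 1) * exp (- (cmod z)\<^sup>2))"])
        (simp_all only: mom, measurable)
    then show ?thesis by (simp only:)
  qed
  also have "\<dots> = ennreal (pi * C / pi ^ CARD('n) * (real (card K) * pi ^ card K))"
  proof -
    have "(\<Sum>j\<in>K. \<Prod>i\<in>K. ennreal pi) = ennreal (real (card K) * pi ^ card K)"
      by (simp add: ennreal_power ennreal_mult ennreal_of_nat_eq_real_of_nat)
    then show ?thesis by (simp only:) (rule ennreal_mult'[symmetric], simp add: C0)
  qed
  also have "pi * C / pi ^ CARD('n) * (real (card K) * pi ^ card K) = C * (real CARD('n) - 1)"
  proof -
    have "CARD('n) = Suc (card K)"
      using card_insert_disjoint[OF K(1,2)] by (simp only: K(3)[symmetric])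
    then have pK: "pi ^ CARD('n) = pi * pi ^ card K" by (simp only: power_Suc)
    show ?thesis unfolding pK cardK using pi_gt_zero by (simp only: times_divide_eq_left) (simp add: field_simps)
  qed
  \<comment> \<open>\<open>4 \<delta> w / (w^2 - \<delta>^2)\<close> decreases in \<open>w\<close>,
    and the bound is its value at \<open>w = \<sigma> / 2\<close>.\<close>
  also have "ennreal (C * (real CARD('n) - 1)) \<le> ennreal (8 * \<delta> * \<sigma> / (\<sigma>\<^sup>2 - 4 * \<delta>\<^sup>2) * (real CARD('n) - 1))"
  proof (intro ennreal_leI mult_right_mono)
    have s0: "0 < \<sigma>" using d by linarith
    have sd: "0 < \<sigma>\<^sup>2 - 4 * \<delta>\<^sup>2" using power_strict_mono[of "2 * \<delta>" \<sigma> 2] d by (simp add: power_mult_distrib)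
    have "w * (\<sigma>\<^sup>2 - 4 * \<delta>\<^sup>2) \<le> 2 * \<sigma> * (w\<^sup>2 - \<delta>\<^sup>2)"
    proof -
      \<comment> \<open>This product is exactly the difference of the two sides of the
        claim.\<close>
      have "0 \<le> (2 * w - \<sigma>) * (w * \<sigma> + 2 * \<delta>\<^sup>2)"
        using sw s0 dw d by (intro mult_nonneg_nonneg add_nonneg_nonneg) auto
      then show ?thesis by (simp add: power2_eq_square algebra_simps)
    qed
    then have "4 * \<delta> * (w * (\<sigma>\<^sup>2 - 4 * \<delta>\<^sup>2)) \<le> 4 * \<delta> * (2 * \<sigma> * (w\<^sup>2 - \<delta>\<^sup>2))"
      using d by (intro mult_left_mono) auto
    then have ineq: "(4 * \<delta> * w) * (\<sigma>\<^sup>2 - 4 * \<delta>\<^sup>2) \<le> (8 * \<delta> * \<sigma>) * (w\<^sup>2 - \<delta>\<^sup>2)"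
      by (simp add: mult_ac)
    have "a / x \<le> b / y" if "a * y \<le> b * x" "0 < x" "0 < y" for a b x y :: real
      using that by (simp add: divide_simps)
    from this[OF ineq wd sd] show "C \<le> 8 * \<delta> * \<sigma> / (\<sigma>\<^sup>2 - 4 * \<delta>\<^sup>2)" by (simp only: C_def)
  qed (simp add: Suc_leI)
  finally show ?thesis unfolding E_def .
qed

section \<open>Resampling one column\<close>

lemma cdot_sum_right: "cdot x (\<Sum>j\<in>J. f j) = (\<Sum>j\<in>J. cdot x (f j))"
  by (induction J rule: infinite_finite_induct) auto

lemma cdot_sum_left: "cdot (\<Sum>j\<in>J. f j) x = (\<Sum>j\<in>J. cdot (f j) x)"
  by (induction J rule: infinite_finite_induct) auto

definition proj_compl :: "'l \<Rightarrow> complex^'l^'n \<Rightarrow> complex^'n \<Rightarrow> complex^'n" where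
  "proj_compl k Q g = g - (\<Sum>j\<in>UNIV - {k}. cdot (column j Q) g *s column j Q)"

text \<open>
  When the projection vanishes the old column is kept, so that \<open>resample\<close> always stays in
  \<open>orthonormal_columns\<close>.
\<close>

definition resample :: "'l \<Rightarrow> complex^'l^'n \<Rightarrow> complex^'n \<Rightarrow> complex^'l^'n" where
  "resample k Q g = (let p = proj_compl k Q g in
     \<chi> i j. if j = k \<and> p \<noteq> 0 then p $ i / of_real (norm p) else Q $ i $ j)"

lemma proj_compl_orth:
  assumes "Q \<in> orthonormal_columns" "j \<noteq> k"
  shows "cdot (column j Q) (proj_compl k Q g) = 0"
proof -
  have "(\<Sum>i\<in>UNIV - {k}. cdot (column i Q) g * cdot (column j Q) (column i Q)) =
      (\<Sum>i\<in>UNIV - {k}. if i = j then cdot (column i Q) g else 0)"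
    using assms(1) unfolding orthonormal_columns_iff by (intro sum.cong) auto
  then show ?thesis using assms(2) by (simp add: proj_compl_def cdot_sum_right)
qed

text \<open>Used to replace the projected length by \<open>|g|\<close> in the small ball event,
  which enlarges the event and leaves a condition on \<open>g\<close> with the same Gaussian law for
  every \<open>Q\<close>.\<close>

lemma norm_proj_compl_le:
  assumes "Q \<in> orthonormal_columns"
  shows "norm (proj_compl k Q g) \<le> norm g"
proof -
  let ?p = "proj_compl k Q g" and ?r = "\<Sum>j\<in>UNIV - {k}. cdot (column j Q) g *s column j Q"
  have "cdot ?r ?p = 0"
    using proj_compl_orth[OF assms] by (simp add: cdot_sum_left)
  then have "cdot ?p ?r = 0" by (rule cdot_eq_0_sym[THEN iffD1])
  moreover have "?p + ?r = g" by (simp add: proj_compl_def)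
  ultimately have "(norm g)\<^sup>2 = (norm ?p)\<^sup>2 + (norm ?r)\<^sup>2"
    using norm_add_sq[of ?p ?r] by simp
  then have "(norm ?p)\<^sup>2 \<le> (norm g)\<^sup>2" by simp
  then show ?thesis by (rule power2_le_imp_le) (rule norm_ge_zero)
qed

lemma column_resample:
  "column j (resample k Q g) = (let p = proj_compl k Q g in
     if j = k \<and> p \<noteq> 0 then of_real (1 / norm p) *s p else column j Q)"
  by (subst vec_eq_iff) (auto simp: resample_def column_def Let_def divide_inverse mult.commute)

lemma resample_orthonormal:
  assumes "Q \<in> orthonormal_columns"
  shows "resample k Q g \<in> orthonormal_columns"
proof (cases "proj_compl k Q g = 0")
  case True
  then have "resample k Q g = Q" by (simp add: resample_def Let_def vec_eq_iff)
  then show ?thesis using assms by simp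
next
  case False
  let ?p = "proj_compl k Q g"
  have 1: "cdot (column j Q) ?p = 0" if "j \<noteq> k" for j using proj_compl_orth[OF assms that] .
  have 2: "cdot ?p (column j Q) = 0" if "j \<noteq> k" for j using 1[OF that] by (rule cdot_eq_0_sym[THEN iffD1])
  have 3: "cdot (complex_of_real (1 / norm ?p) *s ?p) (complex_of_real (1 / norm ?p) *s ?p) = 1"
    using False by (simp add: cdot_self norm_vector_scalar_mult norm_divide del: cdot_simps)
  show ?thesis unfolding orthonormal_columns_iff column_resample Let_def
    using assms False 1 2 3 unfolding orthonormal_columns_iff by auto
qed

lemma smult_mult_right: "A *v (\<Sum>j\<in>J. f j) = (\<Sum>j\<in>J. A *v f j)" for A :: "complex^'m^'n"
  by (induction J rule: infinite_finite_induct) (auto simp: matrix_vector_right_distrib)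

lemma resample_unitary:
  assumes "unitary U"
  shows "resample k (U ** Q) (U *v g) = U ** resample k Q g"
proof -
  have U: "U \<in> orthonormal_columns" using assms by (simp add: unitary_iff)
  have p: "proj_compl k (U ** Q) (U *v g) = U *v proj_compl k Q g"
    unfolding proj_compl_def column_mult orthonormal_columns_cdot[OF U] matrix_vector_mult_diff_distrib
      smult_mult_right vector_scalar_commute ..
  have "column j (resample k (U ** Q) (U *v g)) = column j (U ** resample k Q g)" for j
  proof -
    have "U *v proj_compl k Q g = 0 \<longleftrightarrow> proj_compl k Q g = 0"
      using orthonormal_columns_norm[OF U, of "proj_compl k Q g"] by (metis norm_eq_zero)
    then show ?thesis
      unfolding column_resample column_mult p orthonormal_columns_norm[OF U] Let_def
      by (simp add: vector_scalar_commute)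
  qed
  then show ?thesis by (simp add: column_def vec_eq_iff)
qed

lemma resample_measurable:
  "(\<lambda>(Q, g). resample k Q g) \<in> borel_measurable
     ((borel :: (complex^'l^'n) measure) \<Otimes>\<^sub>M (borel :: (complex^'n) measure))"
proof -
  let ?P = "\<lambda>x :: (complex^'l^'n) \<times> (complex^'n). proj_compl k (fst x) (snd x)"
  have "continuous_on UNIV ?P"
    unfolding proj_compl_def cdot_def column_def vec_eq_iff vector_scalar_mult_def
    by (intro continuous_intros)
  then have P [measurable]: "?P \<in> borel_measurable borel"
    by (rule borel_measurable_continuous_onI)
  have Pi [measurable]: "(\<lambda>x. ?P x $ i) \<in> borel_measurable borel" for i
    by (rule measurable_compose[OF P]) (intro borel_measurable_continuous_onI continuous_intros)
  have Qij [measurable]: "(\<lambda>x :: (complex^'l^'n) \<times> (complex^'n). fst x $ i $ j) \<in> borel_measurable borel" for i j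
    by (intro borel_measurable_continuous_onI continuous_intros)
  have "(\<lambda>x :: (complex^'l^'n) \<times> (complex^'n). resample k (fst x) (snd x)) \<in> borel_measurable borel"
  proof (subst borel_measurable_euclidean_space, intro ballI)
    fix b :: "complex^'l^'n" assume "b \<in> Basis"
    then obtain i j c where b: "b = axis i (axis j c)" by (auto simp: Basis_vec_def)
    show "(\<lambda>x :: (complex^'l^'n) \<times> (complex^'n). resample k (fst x) (snd x) \<bullet> b) \<in> borel_measurable borel"
      unfolding b inner_axis resample_def Let_def vec_lambda_beta by measurable
  qed
  then show ?thesis by (simp add: borel_prod split_beta')
qed

lemma closed_orthonormal_columns: "closed (orthonormal_columns :: (complex^'l^'n) set)"
  unfolding orthonormal_columns_def by (intro closed_Collect_eq continuous_intros)

text \<open>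
  The resampling is equivariant under the unitary group, so the new law is again invariant and
  uniqueness applies; no disintegration of the Haar distribution is needed.
\<close>

lemma haar_resample:
  fixes \<mu> :: "(complex^'l^'n) measure"
  assumes "haar_distribution \<mu>"
  shows "distr (\<mu> \<Otimes>\<^sub>M gauss) borel (\<lambda>(Q, g). resample k Q g) = \<mu>"
proof (rule haar_distribution_unique[OF _ assms])
  let ?R = "\<lambda>(Q, g). resample k Q g :: complex^'l^'n"
  let ?M = "\<mu> \<Otimes>\<^sub>M (gauss :: (complex^'n) measure)"
  have sets_mu [measurable_cong]: "sets \<mu> = sets borel"
    and ae: "AE Q in \<mu>. Q \<in> orthonormal_columns"
    and inv: "\<And>U. unitary U \<Longrightarrow> distr \<mu> borel (\<lambda>Q. U ** Q) = \<mu>"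
    and "prob_space \<mu>"
    using assms by (auto simp: haar_distribution_def)
  interpret M: prob_space \<mu> by fact
  interpret G: prob_space "gauss :: (complex^'n) measure" by (rule prob_space_gauss)
  interpret MG: pair_prob_space \<mu> "gauss :: (complex^'n) measure" ..
  have R [measurable]: "?R \<in> borel_measurable ?M"
    using resample_measurable[of k]
    by (subst measurable_cong_sets[OF sets_pair_measure_cong[OF sets_mu sets_gauss] refl])
  have St [measurable]: "(orthonormal_columns :: (complex^'l^'n) set) \<in> sets borel"
    by (rule borel_closed[OF closed_orthonormal_columns])
  show "haar_distribution (distr ?M borel ?R)"
    unfolding haar_distribution_def
  proof (intro conjI allI impI)
    show "prob_space (distr ?M borel ?R)" by (rule MG.prob_space_distr[OF R])
    show "AE Q in distr ?M borel ?R. Q \<in> orthonormal_columns"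
    proof (subst AE_distr_iff[OF R])
      show "AE x in ?M. ?R x \<in> orthonormal_columns"
      proof (rule MG.AE_pair_measure)
        show "AE Q in \<mu>. AE g in gauss. ?R (Q, g) \<in> orthonormal_columns"
          using ae by eventually_elim (simp add: resample_orthonormal)
      qed measurable
    qed simp
    fix U :: "complex^'n^'n" assume U: "unitary U"
    have [measurable]: "(*v) U \<in> borel_measurable borel"
      by (intro borel_measurable_continuous_onI continuous_intros)
    have m1 [measurable]: "(\<lambda>Q. U ** Q) \<in> borel_measurable \<mu>" by measurable
    have m2 [measurable]: "(*v) U \<in> borel_measurable gauss" by measurable
    have MU: "distr ?M (borel \<Otimes>\<^sub>M borel) (\<lambda>(Q, g). (U ** Q, U *v g)) = ?M"
      using pair_measure_distr[OF m1 m2] G.sigma_finite_measure_axioms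
      unfolding inv[OF U] distr_gauss_unitary[OF U] by simp
    have "distr (distr ?M borel ?R) borel (\<lambda>Q. U ** Q) = distr ?M borel ((\<lambda>Q. U ** Q) \<circ> ?R)"
      by (rule distr_distr) simp_all
    also have "(\<lambda>Q. U ** Q) \<circ> ?R = ?R \<circ> (\<lambda>(Q, g). (U ** Q, U *v g))"
      by (auto simp: fun_eq_iff resample_unitary[OF U])
    also have "distr ?M borel \<dots> = distr (distr ?M (borel \<Otimes>\<^sub>M borel) (\<lambda>(Q, g). (U ** Q, U *v g))) borel ?R"
      by (rule distr_distr[symmetric, OF resample_measurable]) measurable
    finally show "distr (distr ?M borel ?R) borel (\<lambda>Q. U ** Q) = distr ?M borel ?R"
      unfolding MU .
  qed simp
qed

section \<open>The Schur complement\<close>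

text \<open>Zeroing the column instead of deleting it keeps the type; this matrix stands for the
  \<open>Q_1\<close> of the overview.\<close>

definition drop_column :: "'l \<Rightarrow> complex^'l^'n \<Rightarrow> complex^'l^'n" where
  "drop_column k Q = (\<chi> i j. if j = k then 0 else Q $ i $ j)"

text \<open>
  The minor of the compression without index \<open>k\<close> has no type of its own.  It is represented by
  the matrix \<open>bordered\<close> below, whose row and column \<open>k\<close> are those of the identity matrix.
\<close>

definition pad_one :: "'l \<Rightarrow> complex^'l^'l" where
  "pad_one k = (\<chi> i j. if i = k \<and> j = k then 1 else 0)"

definition replace_column :: "'l \<Rightarrow> complex^'l \<Rightarrow> complex^'l^'l \<Rightarrow> complex^'l^'l" where
  "replace_column k b M = (\<chi> i j. if j = k then b $ i else M $ i $ j)"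

abbreviation compression :: "complex^'n^'n \<Rightarrow> complex^'l^'n \<Rightarrow> complex^'l^'l" where
  "compression A X \<equiv> conj_transpose X ** A ** X"

lemma det_replace_column:
  fixes M :: "complex^'l^'l"
  assumes "M *v y = b"
  shows "det (replace_column k b M) = y $ k * det M"
  using cramer_lemma[of k M y] unfolding replace_column_def assms .

lemma solve_linear:
  fixes M :: "complex^'l^'l"
  assumes "det M \<noteq> 0"
  obtains y where "M *v y = b"
proof -
  obtain N where "M ** N = mat 1" using assms unfolding invertible_det_nz[symmetric] invertible_def by blast
  then have "M *v (N *v b) = b" by (simp add: matrix_vector_mul_assoc)
  with that show ?thesis by blast
qed

lemma det_nz_iff_ker:
  fixes M :: "complex^'l^'l"
  shows "det M \<noteq> 0 \<longleftrightarrow> (\<forall>x. M *v x = 0 \<longrightarrow> x = 0)"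
  unfolding invertible_det_nz[symmetric] invertible_left_inverse matrix_left_invertible_ker ..

lemma drop_column_vec:
  "drop_column k X *v y = X *v (\<chi> j. if j = k then 0 else y $ j)"
  unfolding drop_column_def matrix_vector_mult_def vec_eq_iff
  by (auto intro!: sum.cong)

lemma drop_column_split: "X *v y = y $ k *s column k X + drop_column k X *v y"
proof -
  have "y = y $ k *s axis k 1 + (\<chi> j. if j = k then 0 else y $ j)"
    by (auto simp: vec_eq_iff axis_def)
  then have "X *v y = X *v (y $ k *s axis k 1 + (\<chi> j. if j = k then 0 else y $ j))" by (rule arg_cong)
  then show ?thesis
    by (simp only: matrix_vector_right_distrib vector_scalar_commute column_eq_axis drop_column_vec)
qed

lemma conj_transpose_drop_column_vec:
  "conj_transpose (drop_column k X) *v z = (\<chi> j. if j = k then 0 else (conj_transpose X *v z) $ j)"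
  unfolding drop_column_def conj_transpose_def matrix_vector_mult_def vec_eq_iff by auto

lemma pad_one_vec: "pad_one k *v y = (\<chi> j. if j = k then y $ k else 0)"
proof -
  have "(\<Sum>j\<in>UNIV. (if i = k \<and> j = k then 1 else 0) * y $ j) = (\<Sum>j\<in>UNIV. if j = k then (if i = k then y $ k else 0) else 0)" for i
    by (rule sum.cong) auto
  then show ?thesis unfolding pad_one_def matrix_vector_mult_def vec_eq_iff by simp
qed

lemma column_drop_column: "j \<noteq> k \<Longrightarrow> column j (drop_column k X) = column j X"
  by (simp add: column_def drop_column_def)

context
  fixes A :: "complex^'n^'n" and X :: "complex^'l^'n" and k :: 'l
begin

definition "dropped = drop_column k X"
definition "bordered = compression A dropped + pad_one k"

lemma bordered_vec: "bordered *v y = conj_transpose dropped *v (A *v (dropped *v y)) + pad_one k *v y"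
  by (simp only: bordered_def matrix_vector_mult_add_rdistrib matrix_vector_mul_assoc matrix_mul_assoc)

text \<open>The minor is \<open>det M\<close> times the entry \<open>(k, k)\<close> of the inverse
  of \<open>M\<close>, which is \<open>y $ k\<close>. In terms of kernels: a kernel vector
  \<open>z\<close> of \<open>bordered\<close> has \<open>z $ k = 0\<close> and \<open>M z\<close> a
  multiple of the axis vector, so \<open>z\<close> is a multiple of \<open>y\<close>, and its entry
  \<open>k\<close> forces that multiple to be 0.\<close>

lemma det_bordered_nonzero:
  assumes M: "det (compression A X) \<noteq> 0"
    and y: "compression A X *v y = axis k 1" "y $ k \<noteq> 0"
  shows "det bordered \<noteq> 0"
  unfolding det_nz_iff_ker
proof (intro allI impI)
  fix z assume Kz: "bordered *v z = 0"
  let ?M = "compression A X"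
  have Mv: "?M *v z = conj_transpose X *v (A *v (X *v z))" for z
    by (simp only: matrix_vector_mul_assoc matrix_mul_assoc)
  have "(bordered *v z) $ k = z $ k"
    unfolding bordered_vec dropped_def conj_transpose_drop_column_vec pad_one_vec by simp
  then have zk: "z $ k = 0" using Kz by simp
  then have X1z: "dropped *v z = X *v z" using drop_column_split[of X z k] by (simp add: dropped_def)
  have "(?M *v z) $ j = 0" if "j \<noteq> k" for j
  proof -
    have "(bordered *v z) $ j = (conj_transpose X *v (A *v (dropped *v z))) $ j"
      unfolding bordered_vec pad_one_vec using that by (simp add: dropped_def conj_transpose_drop_column_vec)
    then show ?thesis using Kz by (simp add: Mv X1z)
  qed
  then have "?M *v z = (?M *v z) $ k *s axis k 1" by (auto simp: vec_eq_iff axis_def)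
  also have "\<dots> = ?M *v ((?M *v z) $ k *s y)" by (simp only: y(1)[symmetric] vector_scalar_commute)
  finally have "?M *v (z - (?M *v z) $ k *s y) = 0" by (simp add: matrix_vector_mult_diff_distrib)
  then have z: "z - (?M *v z) $ k *s y = 0" using M unfolding det_nz_iff_ker by blast
  then have "(z - (?M *v z) $ k *s y) $ k = 0" by simp
  then have "(?M *v z) $ k = 0" using zk y(2) by simp
  then show "z = 0" using z by simp
qed

text \<open>For \<open>N\<close> inverse to \<open>bordered\<close> this is the \<open>B\<close> of
  the overview: \<open>dropped\<close> annihilates row and column \<open>k\<close> of
  \<open>N\<close>, so only the inverse of the minor enters.\<close>

definition "schur_form N = A - A ** dropped ** N ** conj_transpose dropped ** A"

context
  fixes N :: "complex^'l^'l"
  assumes KN: "bordered ** N = mat 1" and NK: "N ** bordered = mat 1"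
begin

lemma schur_form_vec: "schur_form N *v x = A *v x - A *v (dropped *v (N *v (conj_transpose dropped *v (A *v x))))"
  by (simp only: schur_form_def matrix_vector_mult_diff_rdistrib matrix_vector_mul_assoc matrix_mul_assoc)

lemma KN_vec: "bordered *v (N *v x) = x" "N *v (bordered *v x) = x"
  by (simp_all add: matrix_vector_mul_assoc KN NK)

text \<open>Block elimination. The rows other than \<open>k\<close> of \<open>M y = axis k 1\<close>
  express the other entries of \<open>y\<close> through \<open>y $ k\<close>, and row
  \<open>k\<close> then reads as claimed. Here \<open>y $ k\<close> is the entry
  \<open>(k, k)\<close> of the inverse of \<open>M\<close>.\<close>

lemma schur_complement:
  assumes y: "compression A X *v y = axis k 1"
  shows "y $ k * cdot (column k X) (schur_form N *v column k X) = 1"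
proof -
  let ?q = "column k X" and ?y = "\<chi> j. if j = k then 0 else y $ j"
  have My: "conj_transpose X *v (A *v (X *v y)) = axis k 1"
    using y by (simp only: matrix_vector_mul_assoc matrix_mul_assoc)
  have Xy: "X *v y = y $ k *s ?q + dropped *v y" unfolding dropped_def by (rule drop_column_split)
  have X1y: "dropped *v ?y = dropped *v y" unfolding dropped_def drop_column_vec by (rule arg_cong[where f = "(*v) X"]) (simp add: vec_eq_iff)
  have "conj_transpose dropped *v (A *v (X *v y)) = 0"
    unfolding dropped_def conj_transpose_drop_column_vec My by (simp add: vec_eq_iff axis_def)
  then have "conj_transpose dropped *v (A *v (dropped *v y)) = - (y $ k *s (conj_transpose dropped *v (A *v ?q)))"
    unfolding Xy by (simp add: matrix_vector_right_distrib vector_scalar_commute add_eq_0_iff)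
  moreover have "pad_one k *v ?y = 0" by (simp add: pad_one_vec vec_eq_iff)
  ultimately have "bordered *v ?y = - (y $ k *s (conj_transpose dropped *v (A *v ?q)))"
    unfolding bordered_vec X1y by simp
  then have "?y = N *v (- (y $ k *s (conj_transpose dropped *v (A *v ?q))))" using KN_vec(2)[of ?y] by metis
  also have "\<dots> = - y $ k *s (N *v (conj_transpose dropped *v (A *v ?q)))"
    by (simp only: vector_scalar_commute[symmetric] vector_sneg_minus1) simp
  finally have "dropped *v ?y = dropped *v (- y $ k *s (N *v (conj_transpose dropped *v (A *v ?q))))"
    by (rule arg_cong)
  then have yy: "dropped *v y = - y $ k *s (dropped *v (N *v (conj_transpose dropped *v (A *v ?q))))"
    by (simp only: X1y vector_scalar_commute)
  have "1 = cdot (axis k 1) (conj_transpose X *v (A *v (X *v y)))"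
    unfolding My cdot_axis by (simp add: axis_def)
  also have "\<dots> = cdot ?q (A *v (X *v y))" by (simp add: cdot_conj_transpose column_eq_axis)
  also have "\<dots> = y $ k * cdot ?q (schur_form N *v ?q)"
    unfolding Xy yy schur_form_vec
    by (simp add: matrix_vector_right_distrib vector_scalar_commute algebra_simps)
  finally show ?thesis by simp
qed

text \<open>Vanishing on the other columns on both sides lets the form be evaluated at
  \<open>g\<close> instead of its projection.\<close>

lemma schur_form_column:
  assumes "j \<noteq> k"
  shows "schur_form N *v column j X = 0"
proof -
  have c: "column j X = dropped *v axis j 1"
    using column_drop_column[OF assms, of X] by (simp add: dropped_def column_eq_axis)
  have "pad_one k *v axis j 1 = 0" using assms by (simp add: pad_one_vec vec_eq_iff axis_def)
  then have "conj_transpose dropped *v (A *v (dropped *v axis j 1)) = bordered *v axis j 1" by (simp add: bordered_vec)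
  then show ?thesis unfolding c schur_form_vec by (simp add: KN_vec)
qed

lemma column_schur_form:
  assumes "j \<noteq> k"
  shows "cdot (column j X) (schur_form N *v x) = 0"
proof -
  have c: "column j X = dropped *v axis j 1"
    using column_drop_column[OF assms, of X] by (simp add: dropped_def column_eq_axis)
  define w where "w = conj_transpose dropped *v (A *v x)"
  have "cdot (column j X) (schur_form N *v x) = cdot (axis j 1) (conj_transpose dropped *v (schur_form N *v x))"
    unfolding c by (simp add: cdot_conj_transpose)
  also have "conj_transpose dropped *v (schur_form N *v x) = w - conj_transpose dropped *v (A *v (dropped *v (N *v w)))"
    unfolding schur_form_vec by (simp add: matrix_vector_mult_diff_distrib w_def)
  also have "conj_transpose dropped *v (A *v (dropped *v (N *v w))) = w - pad_one k *v (N *v w)"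
    using bordered_vec[of "N *v w"] by (simp add: KN_vec algebra_simps)
  finally show ?thesis using assms by (simp add: cdot_axis pad_one_vec)
qed

text \<open>The square matrix \<open>?T\<close> has row \<open>k\<close> equal to 0, hence a nonzero
  kernel vector \<open>c\<close>. At \<open>F c\<close> the correction term of the Schur complement
  vanishes, so \<open>B\<close> acts as \<open>A\<close> there. This is the rank argument in
  concrete form.\<close>

lemma schur_form_large:
  fixes F :: "complex^'l^'n"
  assumes F: "F \<in> orthonormal_columns" "\<And>c. \<sigma> * norm c \<le> norm (A *v (F *v c))"
  obtains u where "u \<noteq> 0" "\<sigma> * norm u \<le> norm (schur_form N *v u)"
proof -
  let ?T = "conj_transpose dropped ** A ** F"
  have Tv: "?T *v c = conj_transpose dropped *v (A *v (F *v c))" for c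
    by (simp only: matrix_vector_mul_assoc matrix_mul_assoc)
  have "det ?T = 0"
  proof (rule ccontr)
    assume "det ?T \<noteq> 0"
    then obtain y where "?T *v y = axis k 1" by (rule solve_linear)
    then have "(?T *v y) $ k = 1" by (simp add: axis_def)
    moreover have "(?T *v y) $ k = 0" unfolding Tv by (simp add: dropped_def conj_transpose_drop_column_vec)
    ultimately show False by simp
  qed
  then obtain c where c: "?T *v c = 0" "c \<noteq> 0" using det_nz_iff_ker by blast
  have "schur_form N *v (F *v c) = A *v (F *v c)"
    unfolding schur_form_vec Tv[symmetric] c(1) by simp
  moreover have "norm (F *v c) = norm c" by (rule orthonormal_columns_norm[OF F(1)])
  ultimately show ?thesis using that[of "F *v c"] F(2)[of c] c(2) by (metis norm_eq_zero)
qed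

lemma schur_form_proj_compl:
  "cdot (proj_compl k X g) (schur_form N *v proj_compl k X g) = cdot g (schur_form N *v g)"
proof -
  have Bp: "schur_form N *v proj_compl k X g = schur_form N *v g"
    by (simp add: proj_compl_def matrix_vector_mult_diff_distrib smult_mult_right vector_scalar_commute schur_form_column)
  show ?thesis unfolding Bp by (simp add: proj_compl_def cdot_sum_left column_schur_form)
qed

end
end

section \<open>Large diagonal entries of the inverse\<close>

text \<open>
  By Cramer's rule these are the \<open>Q\<close> for which the entry \<open>(k, k)\<close> of the inverse of \<open>Q\<^sup>* A Q\<close> is at
  least \<open>1 / \<delta>\<close> in modulus.
\<close>

definition bad_set :: "'l \<Rightarrow> complex^'n^'n \<Rightarrow> real \<Rightarrow> (complex^'l^'n) set" where
  "bad_set k A \<delta> = {Q. det (compression A Q) \<noteq> 0 \<and>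
     cmod (det (compression A Q)) \<le> \<delta> * cmod (det (replace_column k (axis k 1) (compression A Q)))}"

text \<open>Cramer's rule pays off here: the set is an open condition and a closed one on continuous
  functions of \<open>Q\<close>, with no inverse to be measured.\<close>

lemma bad_set_borel [measurable]: "bad_set k A \<delta> \<in> sets borel"
proof -
  have r: "continuous_on UNIV (\<lambda>Q. replace_column k (axis k 1) (compression A Q))"
  proof -
    have "continuous_on UNIV (\<lambda>Q. if j = k then axis k 1 $ i else compression A Q $ i $ j)" for i j
      by (cases "j = k") (auto intro!: continuous_intros)
    then show ?thesis unfolding replace_column_def by (intro continuous_intros)
  qed
  have 1: "open {Q. det (compression A Q) \<noteq> 0}"
    by (intro open_Collect_neq continuous_intros)
  have 2: "closed {Q. cmod (det (compression A Q)) \<le> \<delta> * cmod (det (replace_column k (axis k 1) (compression A Q)))}"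
    by (intro closed_Collect_le continuous_intros r)
  have "bad_set k A \<delta> = {Q. det (compression A Q) \<noteq> 0} \<inter>
      {Q. cmod (det (compression A Q)) \<le> \<delta> * cmod (det (replace_column k (axis k 1) (compression A Q)))}"
    by (auto simp: bad_set_def)
  then show ?thesis by (simp only: sets.Int borel_open[OF 1] borel_closed[OF 2])
qed

lemma bad_setD:
  assumes "Q \<in> bad_set k A \<delta>"
  obtains y where "det (compression A Q) \<noteq> 0" "compression A Q *v y = axis k 1" "y $ k \<noteq> 0" "1 \<le> \<delta> * cmod (y $ k)"
proof -
  let ?M = "compression A Q"
  have M: "det ?M \<noteq> 0" "cmod (det ?M) \<le> \<delta> * cmod (det (replace_column k (axis k 1) ?M))"
    using assms by (auto simp: bad_set_def)
  obtain y where y: "?M *v y = axis k 1" using solve_linear[OF M(1)] .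
  have "1 * cmod (det ?M) \<le> (\<delta> * cmod (y $ k)) * cmod (det ?M)"
    using M(2) unfolding det_replace_column[OF y] by (simp add: norm_mult mult_ac)
  then have 1: "1 \<le> \<delta> * cmod (y $ k)" using M(1) by (simp only: mult_le_cancel_right) auto
  then have "y $ k \<noteq> 0" by auto
  with that M y 1 show ?thesis by blast
qed

text \<open>With \<open>x = V *v axis k 1\<close>, the form of the inverse of the compression at
  \<open>x\<close> is the entry \<open>(k, k)\<close> of the inverse of the compression by
  \<open>Q ** V\<close>. Any unit vector is thereby reduced to one diagonal entry.\<close>

lemma bad_setI:
  fixes Q :: "complex^'l^'n" and V :: "complex^'l^'l"
  assumes V: "unitary V" and M: "det (compression A Q) \<noteq> 0"
    and y: "compression A Q *v y = V *v axis k 1"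
    and le: "1 \<le> \<delta> * cmod (cdot (V *v axis k 1) y)"
  shows "Q ** V \<in> bad_set k A \<delta>"
proof -
  let ?M = "compression A (Q ** V)" and ?y = "conj_transpose V *v y"
  have VV: "conj_transpose V ** V = mat 1" "V ** conj_transpose V = mat 1"
    using V by (simp_all add: unitary_def)
  have M_eq: "?M = conj_transpose V ** compression A Q ** V"
    by (simp add: conj_transpose_mult matrix_mul_assoc)
  have "det (conj_transpose V) * det V = 1" using arg_cong[OF VV(1), of det] by (simp add: det_mul)
  then have "det (conj_transpose V) \<noteq> 0" "det V \<noteq> 0" by auto
  then have detM: "det ?M \<noteq> 0" unfolding M_eq det_mul using M by simp
  have "?M *v ?y = conj_transpose V *v (compression A Q *v ((V ** conj_transpose V) *v y))"
    unfolding M_eq by (simp only: matrix_vector_mul_assoc matrix_mul_assoc)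
  also have "\<dots> = (conj_transpose V ** V) *v axis k 1"
    unfolding VV(2) by (simp only: matrix_vector_mul_lid y matrix_vector_mul_assoc)
  finally have My: "?M *v ?y = axis k 1" by (simp add: VV(1))
  have "?y $ k = cdot (V *v axis k 1) y"
    by (simp only: cdot_axis[symmetric] cdot_conj_transpose)
  then have "1 * cmod (det ?M) \<le> (\<delta> * cmod (?y $ k)) * cmod (det ?M)"
    using le by (intro mult_right_mono) simp_all
  then have "cmod (det ?M) \<le> \<delta> * cmod (det (replace_column k (axis k 1) ?M))"
    unfolding det_replace_column[OF My] by (simp add: norm_mult mult_ac)
  with detM show ?thesis by (simp add: bad_set_def)
qed

text \<open>Resampling keeps the columns other than \<open>k\<close>, so \<open>bordered\<close>,
  \<open>N\<close> and \<open>B\<close> do not depend on \<open>g\<close>. One bad \<open>g0\<close>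
  certifies that the minor is invertible; if there is none, the event is empty.\<close>

lemma gauss_resample_bad_set:
  fixes A :: "complex^'n^'n" and Q F :: "complex^'l^'n"
  assumes Q: "Q \<in> orthonormal_columns" and F: "F \<in> orthonormal_columns" "\<And>c. \<sigma> * norm c \<le> norm (A *v (F *v c))"
    and d: "0 < \<delta>" "2 * \<delta> < \<sigma>"
  shows "emeasure gauss {g. resample k Q g \<in> bad_set k A \<delta>}
    \<le> ennreal (8 * \<delta> * \<sigma> / (\<sigma>\<^sup>2 - 4 * \<delta>\<^sup>2) * (real CARD('n) - 1))"
proof (cases "\<exists>g0. resample k Q g0 \<in> bad_set k A \<delta>")
  case False
  then have "{g. resample k Q g \<in> bad_set k A \<delta>} = {}" by auto
  then show ?thesis by simp
next
  case True
  have drop: "dropped (resample k Q g) k = dropped Q k" for g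
    by (simp add: dropped_def drop_column_def resample_def Let_def vec_eq_iff)
  then have bord: "bordered A (resample k Q g) k = bordered A Q k" for g
    by (simp add: bordered_def)
  from True obtain g0 where "resample k Q g0 \<in> bad_set k A \<delta>" ..
  then obtain y0 where "det (compression A (resample k Q g0)) \<noteq> 0"
      "compression A (resample k Q g0) *v y0 = axis k 1" "y0 $ k \<noteq> 0"
    by (rule bad_setD)
  then have "det (bordered A (resample k Q g0) k) \<noteq> 0" by (rule det_bordered_nonzero)
  then have "det (bordered A Q k) \<noteq> 0" unfolding bord .
  then obtain N where N: "bordered A Q k ** N = mat 1" "N ** bordered A Q k = mat 1"
    unfolding invertible_det_nz[symmetric] invertible_def by blast
  define B where "B = schur_form A Q k N"
  have BR: "schur_form A (resample k Q g) k N = B" for g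
    by (simp add: B_def schur_form_def drop)
  obtain u where u: "u \<noteq> 0" "\<sigma> * norm u \<le> norm (B *v u)"
    unfolding B_def by (rule schur_form_large[OF N F])
  have "cmod (cdot g (B *v g)) \<le> \<delta> * (norm g)\<^sup>2" if bad: "resample k Q g \<in> bad_set k A \<delta>" for g
  proof -
    let ?R = "resample k Q g" and ?p = "proj_compl k Q g"
    obtain y where y: "compression A ?R *v y = axis k 1" "1 \<le> \<delta> * cmod (y $ k)"
      by (rule bad_setD[OF bad])
    have "y $ k * cdot (column k ?R) (B *v column k ?R) = 1"
      using schur_complement[where N = N, OF _ _ y(1)] N unfolding bord BR by blast
    then have 1: "cmod (y $ k) * cmod (cdot (column k ?R) (B *v column k ?R)) = 1"
      unfolding norm_mult[symmetric] by simp
    have q: "cmod (cdot (column k ?R) (B *v column k ?R)) \<le> \<delta>"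
    proof -
      let ?c = "cmod (cdot (column k ?R) (B *v column k ?R))"
      have "1 * ?c \<le> (\<delta> * cmod (y $ k)) * ?c" using y(2) by (intro mult_right_mono) auto
      then show ?thesis using 1 by (simp add: mult.assoc)
    qed
    have "cmod (cdot ?p (B *v ?p)) \<le> \<delta> * (norm ?p)\<^sup>2"
    proof (cases "?p = 0")
      case False
      then have c: "column k ?R = of_real (1 / norm ?p) *s ?p" by (simp add: column_resample Let_def)
      then have p: "?p = of_real (norm ?p) *s column k ?R" using False by (simp add: vec_eq_iff)
      have "cdot ?p (B *v ?p) = of_real ((norm ?p)\<^sup>2) * cdot (column k ?R) (B *v column k ?R)"
        by (subst (1 2) p, simp only: cdot_smult_form)
      then have "cmod (cdot ?p (B *v ?p)) = (norm ?p)\<^sup>2 * cmod (cdot (column k ?R) (B *v column k ?R))"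
        by (simp add: norm_mult norm_power)
      also have "\<dots> \<le> (norm ?p)\<^sup>2 * \<delta>" using q by (intro mult_left_mono) auto
      finally show ?thesis by (simp add: mult.commute)
    qed simp
    also have "\<dots> \<le> \<delta> * (norm g)\<^sup>2"
      using norm_proj_compl_le[OF Q] d by (intro mult_left_mono power_mono) auto
    finally show ?thesis unfolding B_def schur_form_proj_compl[OF N] .
  qed
  then have "emeasure gauss {g. resample k Q g \<in> bad_set k A \<delta>} \<le>
      emeasure gauss {g. cmod (cdot g (B *v g)) \<le> \<delta> * (norm g)\<^sup>2}"
  proof (intro emeasure_mono subsetI)
    have "closed {g. cmod (cdot g (B *v g)) \<le> \<delta> * (norm g)\<^sup>2}"
      by (intro closed_Collect_le continuous_intros)
    then show "{g. cmod (cdot g (B *v g)) \<le> \<delta> * (norm g)\<^sup>2} \<in> sets gauss" by simp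
  qed auto
  also have "\<dots> \<le> ennreal (8 * \<delta> * \<sigma> / (\<sigma>\<^sup>2 - 4 * \<delta>\<^sup>2) * (real CARD('n) - 1))"
    by (rule gauss_quadratic_form_small_ball[OF u d])
  finally show ?thesis .
qed

text \<open>Redrawing column \<open>k\<close> leaves the law unchanged, so the measure of the bad
  set is an average over \<open>Q\<close> of Gaussian probabilities, each bounded for orthonormal
  \<open>Q\<close>.\<close>

lemma haar_bad_set:
  fixes A :: "complex^'n^'n" and F :: "complex^'l^'n" and \<mu> :: "(complex^'l^'n) measure"
  assumes mu: "haar_distribution \<mu>"
    and F: "F \<in> orthonormal_columns" "\<And>c. \<sigma> * norm c \<le> norm (A *v (F *v c))"
    and d: "0 < \<delta>" "2 * \<delta> < \<sigma>"
  shows "emeasure \<mu> (bad_set k A \<delta>) \<le> ennreal (8 * \<delta> * \<sigma> / (\<sigma>\<^sup>2 - 4 * \<delta>\<^sup>2) * (real CARD('n) - 1))"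
    (is "_ \<le> ?b")
proof -
  let ?R = "\<lambda>(Q, g). resample k Q g :: complex^'l^'n"
  let ?M = "\<mu> \<Otimes>\<^sub>M (gauss :: (complex^'n) measure)"
  have sets_mu: "sets \<mu> = sets borel" and ae: "AE Q in \<mu>. Q \<in> orthonormal_columns" and "prob_space \<mu>"
    using mu by (auto simp: haar_distribution_def)
  interpret M: prob_space \<mu> by fact
  interpret G: prob_space "gauss :: (complex^'n) measure" by (rule prob_space_gauss)
  have R [measurable]: "?R \<in> borel_measurable ?M"
    using resample_measurable[of k]
    by (subst measurable_cong_sets[OF sets_pair_measure_cong[OF sets_mu sets_gauss] refl])
  have sp: "space \<mu> = UNIV" using sets_eq_imp_space_eq[OF sets_mu] by simp
  have "emeasure \<mu> (bad_set k A \<delta>) = emeasure (distr ?M borel ?R) (bad_set k A \<delta>)"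
    by (simp add: haar_resample[OF mu])
  also have "\<dots> = emeasure ?M (?R -` bad_set k A \<delta> \<inter> space ?M)"
    by (rule emeasure_distr[OF R bad_set_borel])
  also have "\<dots> = (\<integral>\<^sup>+ Q. emeasure gauss (Pair Q -` (?R -` bad_set k A \<delta> \<inter> space ?M)) \<partial>\<mu>)"
    by (rule G.emeasure_pair_measure_alt[OF measurable_sets[OF R bad_set_borel]])
  also have "\<dots> \<le> (\<integral>\<^sup>+ Q. ?b \<partial>\<mu>)"
  proof (rule nn_integral_mono_AE)
    show "AE Q in \<mu>. emeasure gauss (Pair Q -` (?R -` bad_set k A \<delta> \<inter> space ?M)) \<le> ?b"
      using ae
    proof eventually_elim
      case (elim Q)
      have "Pair Q -` (?R -` bad_set k A \<delta> \<inter> space ?M) = {g. resample k Q g \<in> bad_set k A \<delta>}"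
        by (auto simp: space_pair_measure sp)
      then show ?case using gauss_resample_bad_set[OF elim F d] by simp
    qed
  qed
  also have "\<dots> = ?b" by (simp add: M.emeasure_space_1)
  finally show ?thesis .
qed

text \<open>Right multiplication commutes with the left action, so the image measure is again left
  invariant, and uniqueness identifies it.\<close>

lemma haar_distribution_mult_right:
  fixes \<mu> :: "(complex^'l^'n) measure"
  assumes mu: "haar_distribution \<mu>" and V: "unitary V"
  shows "distr \<mu> borel (\<lambda>Q. Q ** V) = \<mu>"
proof (rule haar_distribution_unique[OF _ mu])
  have sets_mu [measurable_cong]: "sets \<mu> = sets borel" and ae: "AE Q in \<mu>. Q \<in> orthonormal_columns"
    and "prob_space \<mu>" and inv: "\<And>U. unitary U \<Longrightarrow> distr \<mu> borel (\<lambda>Q. U ** Q) = \<mu>"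
    using mu by (auto simp: haar_distribution_def)
  interpret M: prob_space \<mu> by fact
  have [measurable]: "(orthonormal_columns :: (complex^'l^'n) set) \<in> sets borel"
    by (rule borel_closed[OF closed_orthonormal_columns])
  show "haar_distribution (distr \<mu> borel (\<lambda>Q. Q ** V))"
    unfolding haar_distribution_def
  proof (intro conjI allI impI)
    show "prob_space (distr \<mu> borel (\<lambda>Q. Q ** V))" by (rule M.prob_space_distr) measurable
    show "AE Q in distr \<mu> borel (\<lambda>Q. Q ** V). Q \<in> orthonormal_columns"
    proof (subst AE_distr_iff)
      show "AE Q in \<mu>. Q ** V \<in> orthonormal_columns"
        using ae by eventually_elim (use V in \<open>auto simp: unitary_iff orthonormal_columns_mult\<close>)
    qed simp_all
    fix U :: "complex^'n^'n" assume U: "unitary U"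
    have "distr (distr \<mu> borel (\<lambda>Q. Q ** V)) borel (\<lambda>Q. U ** Q) = distr \<mu> borel ((\<lambda>Q. U ** Q) \<circ> (\<lambda>Q. Q ** V))"
      by (rule distr_distr) simp_all
    also have "(\<lambda>Q. U ** Q) \<circ> (\<lambda>Q. Q ** V) = (\<lambda>Q. Q ** V) \<circ> (\<lambda>Q. U ** Q)"
      by (simp add: fun_eq_iff matrix_mul_assoc)
    also have "distr \<mu> borel \<dots> = distr (distr \<mu> borel (\<lambda>Q. U ** Q)) borel (\<lambda>Q. Q ** V)"
      by (rule distr_distr[symmetric]) simp_all
    finally show "distr (distr \<mu> borel (\<lambda>Q. Q ** V)) borel (\<lambda>Q. U ** Q) = distr \<mu> borel (\<lambda>Q. Q ** V)"
      unfolding inv[OF U] .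
  qed simp
qed

lemma haar_bad_set_rotated:
  fixes A :: "complex^'n^'n" and F :: "complex^'l^'n" and \<mu> :: "(complex^'l^'n) measure"
  assumes mu: "haar_distribution \<mu>" and V: "unitary V"
    and F: "F \<in> orthonormal_columns" "\<And>c. \<sigma> * norm c \<le> norm (A *v (F *v c))"
    and d: "0 < \<delta>" "2 * \<delta> < \<sigma>"
  shows "emeasure \<mu> {Q. Q ** V \<in> bad_set k A \<delta>} \<le> ennreal (8 * \<delta> * \<sigma> / (\<sigma>\<^sup>2 - 4 * \<delta>\<^sup>2) * (real CARD('n) - 1))"
proof -
  have sets_mu: "sets \<mu> = sets borel" using mu by (simp add: haar_distribution_def)
  have sp: "space \<mu> = UNIV" using sets_eq_imp_space_eq[OF sets_mu] by simp
  have "emeasure \<mu> (bad_set k A \<delta>) = emeasure (distr \<mu> borel (\<lambda>Q. Q ** V)) (bad_set k A \<delta>)"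
    by (simp add: haar_distribution_mult_right[OF mu V])
  also have "\<dots> = emeasure \<mu> ((\<lambda>Q. Q ** V) -` bad_set k A \<delta> \<inter> space \<mu>)"
    by (rule emeasure_distr) (simp_all add: measurable_cong_sets[OF sets_mu refl])
  finally show ?thesis
    using haar_bad_set[OF mu F d, of k] by (simp add: sp vimage_def)
qed

section \<open>Test vectors\<close>

lemma cdot_form_entries:
  fixes N :: "complex^'l^'l"
  shows "cdot (axis j 1 + c *s axis k 1) (N *v (axis j 1 + c *s axis k 1)) =
    N $ j $ j + c * N $ j $ k + cnj c * N $ k $ j + c * cnj c * N $ k $ k"
proof -
  have "cdot (axis p 1) (N *v axis q 1) = N $ p $ q" for p q
    unfolding column_eq_axis[symmetric] cdot_axis by (simp add: column_def)
  then show ?thesis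
    by (simp add: matrix_vector_right_distrib vector_scalar_commute algebra_simps)
qed

text \<open>
  Three points on the unit circle suffice for the polarisation, instead of the usual four, which is
  what keeps the number of test vectors below \<open>3 l\<^sup>2 / 2\<close>.
\<close>

lemma polarization_cube_roots:
  fixes N :: "complex^'l^'l"
  assumes jk: "j \<noteq> k"
  defines "\<omega> \<equiv> Complex (- 1 / 2) (sqrt 3 / 2)"
  defines "x \<equiv> \<lambda>c. complex_of_real (1 / sqrt 2) *s (axis j 1 + c *s axis k 1) :: complex^'l"
  shows "c \<in> {1, \<omega>, cnj \<omega>} \<Longrightarrow> norm (x c) = 1"
    "\<exists>c\<in>{1, \<omega>, cnj \<omega>}. cmod (N $ j $ k) \<le> 2 * cmod (cdot (x c) (N *v x c))"
    "\<exists>c\<in>{1, \<omega>, cnj \<omega>}. cmod (N $ k $ j) \<le> 2 * cmod (cdot (x c) (N *v x c))"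
proof -
  have w: "\<omega> * cnj \<omega> = 1" "1 + \<omega> + cnj \<omega> = 0" "\<omega> * \<omega> = cnj \<omega>" "cnj \<omega> * cnj \<omega> = \<omega>"
    by (simp_all add: \<omega>_def complex_eq_iff)
  have cc: "c * cnj c = 1" if "c \<in> {1, \<omega>, cnj \<omega>}" for c using that w by (auto simp: mult.commute)
  then have c1: "cmod c = 1" if "c \<in> {1, \<omega>, cnj \<omega>}" for c
    using that complex_norm_square[of c] by (metis norm_ge_zero of_real_eq_1_iff power2_eq_1_iff
      neg_0_le_iff_le not_one_le_zero)
  show "norm (x c) = 1" if "c \<in> {1, \<omega>, cnj \<omega>}"
  proof -
    have "cdot (axis j 1 :: complex^'l) (axis k 1) = 0" using jk unfolding cdot_axis by (simp add: axis_def)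
    then have "(norm (axis j 1 + c *s axis k 1 :: complex^'l))\<^sup>2 = 2"
      unfolding norm_add_sq norm_vector_scalar_mult norm_axis_complex c1[OF that] by simp
    then have "norm (axis j 1 + c *s axis k 1 :: complex^'l) = sqrt 2" by (metis norm_ge_zero real_sqrt_unique)
    then show ?thesis unfolding x_def norm_vector_scalar_mult by (simp add: norm_divide)
  qed
  define T where "T c = cdot (x c) (N *v x c)" for c
  have T: "2 * T c = N $ j $ j + N $ k $ k + c * N $ j $ k + cnj c * N $ k $ j" if "c \<in> {1, \<omega>, cnj \<omega>}" for c
  proof -
    have half: "(1 / sqrt 2)\<^sup>2 = 1 / 2" by (simp add: power_divide)
    then have "T c = (1 / 2) * cdot (axis j 1 + c *s axis k 1) (N *v (axis j 1 + c *s axis k 1))"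
      unfolding T_def x_def cdot_smult_form half by simp
    then show ?thesis unfolding cdot_form_entries using cc[OF that] by (simp add: algebra_simps)
  qed
  \<comment> \<open>If three numbers with unimodular weights sum to \<open>3 * z\<close>, one of
    them has modulus at least that of \<open>z\<close>.\<close>
  have *: "\<exists>c\<in>{1, \<omega>, cnj \<omega>}. cmod z \<le> 2 * cmod (T c)"
    if z: "3 * z = 2 * T 1 + a * (2 * T \<omega>) + b * (2 * T (cnj \<omega>))" and ab: "cmod a = 1" "cmod b = 1" for z a b
  proof (rule ccontr)
    assume "\<not> ?thesis"
    then have "2 * cmod (T 1) < cmod z" "2 * cmod (T \<omega>) < cmod z" "2 * cmod (T (cnj \<omega>)) < cmod z" by auto
    moreover have "3 * cmod z = cmod (2 * T 1 + a * (2 * T \<omega>) + b * (2 * T (cnj \<omega>)))"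
      unfolding z[symmetric] by (simp add: norm_mult)
    moreover have "\<dots> \<le> cmod (2 * T 1) + cmod (a * (2 * T \<omega>)) + cmod (b * (2 * T (cnj \<omega>)))"
      by (intro norm_triangle_le add_right_mono norm_triangle_ineq)
    moreover have "\<dots> = 2 * cmod (T 1) + 2 * cmod (T \<omega>) + 2 * cmod (T (cnj \<omega>))"
      using ab by (simp add: norm_mult)
    ultimately show False by linarith
  qed
  have T3: "2 * T 1 = N $ j $ j + N $ k $ k + N $ j $ k + N $ k $ j"
    "2 * T \<omega> = N $ j $ j + N $ k $ k + \<omega> * N $ j $ k + cnj \<omega> * N $ k $ j"
    "2 * T (cnj \<omega>) = N $ j $ j + N $ k $ k + cnj \<omega> * N $ j $ k + \<omega> * N $ k $ j"
    using T[of 1] T[of \<omega>] T[of "cnj \<omega>"] by simp_all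
  have id: "p + q + u + v + a * (p + q + \<omega> * u + cnj \<omega> * v) + b * (p + q + cnj \<omega> * u + \<omega> * v) =
      (p + q) * (1 + a + b) + u * (1 + a * \<omega> + b * cnj \<omega>) + v * (1 + a * cnj \<omega> + b * \<omega>)" for a b p q u v
    by (simp add: algebra_simps)
  have w': "cnj \<omega> * \<omega> = 1" "1 + cnj \<omega> + \<omega> = 0" using w by (simp_all add: mult.commute add_ac)
  \<comment> \<open>Fourier inversion on the cube roots of unity: these weights keep the coefficient
    of \<open>c\<close> and kill the constant term and the coefficient of \<open>cnj c\<close>.
    Exchanging the two weights isolates the other entry.\<close>
  have "3 * N $ j $ k = 2 * T 1 + cnj \<omega> * (2 * T \<omega>) + \<omega> * (2 * T (cnj \<omega>))"
    unfolding T3 id w w' by simp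
  from *[OF this] c1 show "\<exists>c\<in>{1, \<omega>, cnj \<omega>}. cmod (N $ j $ k) \<le> 2 * cmod (cdot (x c) (N *v x c))"
    unfolding T_def by simp
  have "3 * N $ k $ j = 2 * T 1 + \<omega> * (2 * T \<omega>) + cnj \<omega> * (2 * T (cnj \<omega>))"
    unfolding T3 id w w' by simp
  from *[OF this] c1 show "\<exists>c\<in>{1, \<omega>, cnj \<omega>}. cmod (N $ k $ j) \<le> 2 * cmod (cdot (x c) (N *v x c))"
    unfolding T_def by simp
qed

text \<open>The numbering \<open>f\<close> picks one ordered pair from each two-element set of
  indices; the same test vectors serve both entries \<open>(j, k)\<close> and
  \<open>(k, j)\<close>.\<close>

lemma card_ordered_pairs:
  fixes f :: "'l::finite \<Rightarrow> nat"
  assumes "inj f"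
  shows "2 * card {(j, k). f j < f k} + CARD('l) = CARD('l) * CARD('l)"
proof -
  let ?P = "{(j, k). f j < f k}" and ?R = "{(j, k). f k < f j}"
  have "?R = prod.swap ` ?P" by (auto simp: image_iff)
  then have R: "card ?R = card ?P" by (simp add: card_image)
  have "(UNIV :: ('l \<times> 'l) set) = (?P \<union> ?R) \<union> range (\<lambda>j. (j, j))"
    using assms by (auto simp: inj_eq)
  then have "card (UNIV :: ('l \<times> 'l) set) = card ((?P \<union> ?R) \<union> range (\<lambda>j. (j, j)))" by simp
  also have "\<dots> = card (?P \<union> ?R) + card (range (\<lambda>j::'l. (j, j)))"
    by (rule card_Un_disjoint) auto
  also have "card (?P \<union> ?R) = card ?P + card ?R"
    by (rule card_Un_disjoint) auto
  also have "card (range (\<lambda>j::'l. (j, j))) = CARD('l)"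
    by (rule card_image) (auto simp: inj_on_def)
  finally show ?thesis using R by (simp add: card_cartesian_product flip: UNIV_Times_UNIV)
qed

text \<open>There are \<open>l\<close> axis vectors for the diagonal and three vectors per unordered
  pair, at most \<open>l + 3 l (l - 1) / 2\<close> in all. The term \<open>CARD('l)\<close> in the
  bound records the slack that \<open>final_constant\<close> spends.\<close>

lemma test_vectors:
  obtains T :: "(complex^'l) set" where "finite T" "2 * card T + CARD('l) \<le> 3 * CARD('l) * CARD('l)"
    "\<And>x. x \<in> T \<Longrightarrow> norm x = 1"
    "\<And>(N :: complex^'l^'l) j k. \<exists>x\<in>T. cmod (N $ j $ k) \<le> 2 * cmod (cdot x (N *v x))"
proof -
  obtain f :: "'l \<Rightarrow> nat" where f: "inj f"
    using finite_imp_inj_to_nat_seg[of "UNIV :: 'l set"] by auto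
  define \<omega> where "\<omega> = Complex (- 1 / 2) (sqrt 3 / 2)"
  define x where "x = (\<lambda>((j, k), c). complex_of_real (1 / sqrt 2) *s (axis j 1 + c *s axis k 1) :: complex^'l)"
  have x: "x ((j, k), c) = complex_of_real (1 / sqrt 2) *s (axis j 1 + c *s axis k 1)" for j k c
    by (simp add: x_def)
  let ?P = "{(j, k). f j < f k}" and ?C = "{1, \<omega>, cnj \<omega>}"
  define T where "T = range (\<lambda>j. axis j 1) \<union> x ` (?P \<times> ?C)"
  have C: "card ?C \<le> 3" by (metis card.empty card_insert_le_m1 diff_Suc_1 le_refl numeral_3_eq_3 zero_less_Suc)
  have "card T \<le> CARD('l) + card ?P * 3"
  proof -
    have "card T \<le> card (range (\<lambda>j::'l. axis j (1::complex))) + card (x ` (?P \<times> ?C))"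
      unfolding T_def by (rule card_Un_le)
    also have "\<dots> \<le> CARD('l) + card (?P \<times> ?C)"
      by (intro add_mono card_image_le) auto
    also have "card (?P \<times> ?C) \<le> card ?P * 3" using C by (simp add: card_cartesian_product)
    finally show ?thesis by simp
  qed
  then have "2 * card T + CARD('l) \<le> 3 * CARD('l) * CARD('l)"
    using card_ordered_pairs[OF f] by simp
  moreover have "finite T" by (simp add: T_def)
  moreover have "norm y = 1" if "y \<in> T" for y
    using that unfolding T_def
  proof
    assume "y \<in> x ` (?P \<times> ?C)"
    then obtain j k c where "f j < f k" "c \<in> ?C" "y = x ((j, k), c)" by auto
    then show ?thesis using polarization_cube_roots(1)[of j k c] unfolding x \<omega>_def[symmetric] by auto
  qed (auto simp: norm_axis_complex)
  moreover have "\<exists>y\<in>T. cmod (N $ j $ k) \<le> 2 * cmod (cdot y (N *v y))" for N :: "complex^'l^'l" and j k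
  proof -
    consider "j = k" | "f j < f k" | "f k < f j" using f by (metis injD linorder_neqE_nat)
    then show ?thesis
    proof cases
      case 1
      have "cdot (axis j 1) (N *v axis j 1) = N $ j $ j"
        unfolding column_eq_axis[symmetric] cdot_axis by (simp add: column_def)
      then have "cmod (N $ j $ k) \<le> 2 * cmod (cdot (axis j 1) (N *v axis j 1))" using 1 by simp
      then show ?thesis unfolding T_def by blast
    next
      case 2
      then have "j \<noteq> k" by auto
      then obtain c where "c \<in> ?C" "cmod (N $ j $ k) \<le> 2 * cmod (cdot (x ((j, k), c)) (N *v x ((j, k), c)))"
        using polarization_cube_roots(2)[of j k N] unfolding x \<omega>_def[symmetric] by blast
      moreover have "x ((j, k), c) \<in> T" if "c \<in> ?C" for c using 2 that unfolding T_def by blast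
      ultimately show ?thesis by blast
    next
      case 3
      then have "k \<noteq> j" by auto
      then obtain c where "c \<in> ?C" "cmod (N $ j $ k) \<le> 2 * cmod (cdot (x ((k, j), c)) (N *v x ((k, j), c)))"
        using polarization_cube_roots(3)[of k j N] unfolding x \<omega>_def[symmetric] by blast
      moreover have "x ((k, j), c) \<in> T" if "c \<in> ?C" for c using 3 that unfolding T_def by blast
      ultimately show ?thesis by blast
    qed
  qed
  ultimately show ?thesis using that by blast
qed

text \<open>Cauchy-Schwarz in each row. This is the factor \<open>l\<close> lost between the norm of
  the inverse and its largest entry.\<close>

lemma norm_matrix_vector_le_entries:
  fixes N :: "complex^'l^'l"
  assumes m: "\<And>j k. cmod (N $ j $ k) \<le> m"
  shows "norm (N *v b) \<le> real CARD('l) * m * norm b"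
proof -
  have m0: "0 \<le> m" using m[of undefined undefined] norm_ge_zero order_trans by blast
  have "(cmod ((N *v b) $ j))\<^sup>2 \<le> real CARD('l) * m\<^sup>2 * (norm b)\<^sup>2" for j
  proof -
    have "cmod ((N *v b) $ j) \<le> (\<Sum>k\<in>UNIV. cmod (N $ j $ k) * cmod (b $ k))"
      unfolding matrix_vector_mult_def by (simp add: norm_mult[symmetric] norm_sum)
    also have "\<dots> \<le> (\<Sum>k\<in>UNIV. m * cmod (b $ k))" by (intro sum_mono mult_right_mono m) simp
    finally have "cmod ((N *v b) $ j) \<le> m * (\<Sum>k\<in>UNIV. cmod (b $ k))" by (simp add: sum_distrib_left)
    then have "(cmod ((N *v b) $ j))\<^sup>2 \<le> (m * (\<Sum>k\<in>UNIV. cmod (b $ k)))\<^sup>2" by (intro power_mono) auto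
    also have "\<dots> = m\<^sup>2 * (\<Sum>k\<in>UNIV. cmod (b $ k))\<^sup>2" by (simp add: power_mult_distrib)
    also have "\<dots> \<le> m\<^sup>2 * ((\<Sum>k\<in>UNIV. (cmod (b $ k))\<^sup>2) * real CARD('l))"
      by (intro mult_left_mono sum_squared_le_sum_of_squares) auto
    finally show ?thesis by (simp add: norm_vec_sq mult_ac)
  qed
  then have "(norm (N *v b))\<^sup>2 \<le> (\<Sum>j\<in>(UNIV::'l set). real CARD('l) * m\<^sup>2 * (norm b)\<^sup>2)"
    unfolding norm_vec_sq[of "N *v b"] by (intro sum_mono)
  also have "\<dots> = (real CARD('l) * m * norm b)\<^sup>2" by (simp add: power2_eq_square)
  finally show ?thesis by (rule power2_le_imp_le) (simp add: m0)
qed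

section \<open>Avoiding singular compressions, and passage to the limit\<close>

lemma det_shift_finite:
  fixes M :: "complex^'l^'l"
  shows "finite {t. det (M + mat t) = 0}"
proof -
  define m where "m = (\<Sum>j\<in>UNIV. \<Sum>k\<in>UNIV. cmod (M $ j $ k))"
  have m: "cmod (M $ j $ k) \<le> m" for j k
  proof -
    have "cmod (M $ j $ k) \<le> (\<Sum>k\<in>UNIV. cmod (M $ j $ k))" by (rule member_le_sum) auto
    also have "\<dots> \<le> m" unfolding m_def by (rule member_le_sum) (auto intro: sum_nonneg)
    finally show ?thesis .
  qed
  have m0: "0 \<le> m" unfolding m_def by (intro sum_nonneg) auto
  \<comment> \<open>Beyond the bound \<open>l * m\<close> for the norm of \<open>M\<close> there is
    no eigenvalue, so the characteristic polynomial is not 0 at \<open>z\<close> and has finitely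
    many roots.\<close>
  define z where "z = complex_of_real (real CARD('l) * m + 1)"
  have "det (mat z - M) \<noteq> 0"
    unfolding det_nz_iff_ker
  proof (intro allI impI)
    fix x assume "(mat z - M) *v x = 0"
    then have "M *v x = z *s x" by (simp add: matrix_vector_mult_diff_rdistrib mat_vec)
    then have "cmod z * norm x \<le> real CARD('l) * m * norm x"
      using norm_matrix_vector_le_entries[OF m, of x] by (simp add: norm_vector_scalar_mult)
    moreover have "cmod z = real CARD('l) * m + 1" using m0 unfolding z_def norm_of_real by simp
    ultimately have "norm x \<le> 0" by (simp add: algebra_simps)
    then show "x = 0" by simp
  qed
  then have "poly (charpoly M) z \<noteq> 0" by (simp add: poly_charpoly)
  then have "charpoly M \<noteq> 0" by auto
  then have fin: "finite {t. poly (charpoly M) t = 0}" by (rule poly_roots_finite)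
  have "{t. det (M + mat t) = 0} \<subseteq> uminus ` {t. poly (charpoly M) t = 0}"
  proof
    fix t assume "t \<in> {t. det (M + mat t) = 0}"
    then obtain x where x: "x \<noteq> 0" "(M + mat t) *v x = 0" using det_nz_iff_ker by blast
    then have "M *v x = (- t) *s x"
      by (simp add: matrix_vector_mult_add_rdistrib mat_vec add_eq_0_iff2)
    then have "(mat (- t) - M) *v x = 0" by (simp add: matrix_vector_mult_diff_rdistrib mat_vec)
    then have "det (mat (- t) - M) = 0" using x(1) det_nz_iff_ker by blast
    then have "poly (charpoly M) (- t) = 0" by (simp add: poly_charpoly)
    then show "t \<in> uminus ` {t. poly (charpoly M) t = 0}" by (intro image_eqI[of _ _ "- t"]) auto
  qed
  then show ?thesis using fin finite_surj by blast
qed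

text \<open>If all entries of the inverse were below \<open>1 / (l e)\<close>, applying it to
  \<open>M u\<close> would give a vector shorter than \<open>u\<close>. The factor 2 comes from the
  polarisation.\<close>

lemma large_inverse_form:
  fixes M :: "complex^'l^'l"
  assumes M: "det M \<noteq> 0" and u: "norm u = 1" "norm (M *v u) \<le> e" and e: "0 < e"
    and T: "\<And>(N :: complex^'l^'l) j k. \<exists>x\<in>T. cmod (N $ j $ k) \<le> 2 * cmod (cdot x (N *v x))"
  obtains x y where "x \<in> T" "M *v y = x" "1 \<le> 2 * real CARD('l) * e * cmod (cdot x y)"
proof -
  obtain N where N: "M ** N = mat 1" "N ** M = mat 1"
    using M unfolding invertible_det_nz[symmetric] invertible_def by blast
  have "\<exists>j k. 1 \<le> real CARD('l) * e * cmod (N $ j $ k)"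
  proof (rule ccontr)
    assume "\<not> ?thesis"
    then have lt: "real CARD('l) * e * cmod (N $ j $ k) < 1" for j k by (auto simp: not_le)
    define m where "m = Max (range (\<lambda>(j, k). cmod (N $ j $ k)))"
    have "m \<in> range (\<lambda>(j, k). cmod (N $ j $ k))" unfolding m_def by (intro Max_in) auto
    then have m1: "real CARD('l) * e * m < 1" using lt by auto
    have m: "cmod (N $ j $ k) \<le> m" for j k
      unfolding m_def by (rule Max_ge) (auto intro!: image_eqI[of _ _ "(j, k)"])
    have m0: "0 \<le> m" using m[of undefined undefined] norm_ge_zero order_trans by blast
    have "N *v (M *v u) = u" by (simp add: matrix_vector_mul_assoc N)
    then have "1 \<le> real CARD('l) * m * norm (M *v u)"
      using norm_matrix_vector_le_entries[OF m, of "M *v u"] u(1) by simp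
    also have "\<dots> \<le> real CARD('l) * m * e" using u(2) m0 by (intro mult_left_mono) auto
    finally show False using m1 by (simp add: mult_ac)
  qed
  then obtain j k where jk: "1 \<le> real CARD('l) * e * cmod (N $ j $ k)" by blast
  obtain x where x: "x \<in> T" "cmod (N $ j $ k) \<le> 2 * cmod (cdot x (N *v x))" using T by blast
  have "real CARD('l) * e * cmod (N $ j $ k) \<le> real CARD('l) * e * (2 * cmod (cdot x (N *v x)))"
    using x(2) e by (intro mult_left_mono) auto
  then have "1 \<le> 2 * real CARD('l) * e * cmod (cdot x (N *v x))" using jk by (simp add: mult_ac)
  moreover have "M *v (N *v x) = x" by (simp add: matrix_vector_mul_assoc N)
  ultimately show ?thesis using that x(1) by blast
qed

text \<open>A given \<open>Q\<close> may fail to lie in \<open>U m\<close> for the finitely many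
  shifts that leave its compression singular, so it is the limit inferior of the sets that has to be
  measured.\<close>

lemma emeasure_eventually_le_limit:
  fixes c :: "nat \<Rightarrow> real"
  assumes U: "\<And>m. U m \<in> sets M" and le: "eventually (\<lambda>m. emeasure M (U m) \<le> ennreal (c m)) sequentially"
    and c: "c \<longlonglongrightarrow> l"
  shows "emeasure M (\<Union>n. \<Inter>m\<in>{n..}. U m) \<le> ennreal l"
proof -
  have sets: "(\<Inter>m\<in>{n..}. U m) \<in> sets M" for n by (intro sets.countable_INT') (auto simp: U)
  have "emeasure M (\<Inter>m\<in>{n..}. U m) \<le> ennreal l" for n
  proof (rule tendsto_lowerbound)
    show "(\<lambda>m. ennreal (c m)) \<longlonglongrightarrow> ennreal l" using c by (rule tendsto_ennrealI)
    show "eventually (\<lambda>m. emeasure M (\<Inter>m\<in>{n..}. U m) \<le> ennreal (c m)) sequentially"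
      using le eventually_ge_at_top[of n]
    proof eventually_elim
      case (elim m)
      have "emeasure M (\<Inter>m\<in>{n..}. U m) \<le> emeasure M (U m)"
        using elim(2) by (intro emeasure_mono U) auto
      then show ?case using elim(1) by simp
    qed
  qed simp
  moreover have "incseq (\<lambda>n. \<Inter>m\<in>{n..}. U m)" by (intro incseq_SucI) auto
  ultimately show ?thesis
    using SUP_emeasure_incseq[of "\<lambda>n. \<Inter>m\<in>{n..}. U m" M] sets by (metis (no_types, lifting) SUP_le_iff image_subset_iff)
qed

section \<open>The small ball estimate\<close>

lemma compression_shift:
  assumes "Q \<in> orthonormal_columns"
  shows "compression (A + mat t) Q = compression A Q + mat t"
proof -
  have "conj_transpose Q ** mat t ** Q = (\<chi> i j. t * (conj_transpose Q ** Q) $ i $ j)"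
    by (simp add: matrix_matrix_mult_def mat_def vec_eq_iff if_distrib[of "\<lambda>s. _ * s"] sum_distrib_left mult_ac cong: if_cong)
  also have "\<dots> = mat t" using assms by (simp add: orthonormal_columns_def mat_def vec_eq_iff)
  moreover have "conj_transpose Q ** (A + mat t) ** Q = conj_transpose Q ** A ** Q + conj_transpose Q ** mat t ** Q"
    by (simp add: matrix_matrix_mult_def vec_eq_iff sum.distrib algebra_simps)
  ultimately show ?thesis by simp
qed

text \<open>The event is enclosed in a Borel set \<open>B\<close>: monotonicity of the measure then
  asks for measurability of \<open>B\<close>, which is built from determinants, and not of a
  condition on \<open>sigma_min\<close>.\<close>

lemma haar_sigma_min_bound:
  fixes A :: "complex^'n^'n" and F :: "complex^'l^'n" and \<mu> :: "(complex^'l^'n) measure"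
  assumes mu: "haar_distribution \<mu>"
    and F: "F \<in> orthonormal_columns" "\<And>c. s * norm c \<le> norm (A *v (F *v c))"
    and e: "0 < \<epsilon>" and small: "4 * real CARD('l) * \<epsilon> < s"
    and T: "finite T" "\<And>x. x \<in> T \<Longrightarrow> norm x = 1"
      "\<And>(N :: complex^'l^'l) j k. \<exists>x\<in>T. cmod (N $ j $ k) \<le> 2 * cmod (cdot x (N *v x))"
  obtains B where "B \<in> sets borel"
    "{Q \<in> orthonormal_columns. sigma_min (compression A Q) \<le> \<epsilon>} \<subseteq> B"
    "emeasure \<mu> B \<le> ennreal (real (card T) * (16 * real CARD('l) * \<epsilon> * s / (s\<^sup>2 - 16 * (real CARD('l))\<^sup>2 * \<epsilon>\<^sup>2)
        * (real CARD('n) - 1)))"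
proof -
  define L where "L = real CARD('l)"
  have L: "1 \<le> L" by (simp add: L_def Suc_leI)
  \<comment> \<open>\<open>Q\<^sup>* A Q\<close> may be singular; for each fixed \<open>Q\<close>, only finitely many shifts \<open>A + t m\<close> leave it so.\<close>
  define t where "t m = inverse (real (Suc m))" for m
  have t0: "0 < t m" for m by (simp add: t_def)
  have t_lim: "t \<longlonglongrightarrow> 0" unfolding t_def by (rule LIMSEQ_inverse_real_of_nat)
  \<comment> \<open>The threshold of \<open>large_inverse_form\<close> for
    \<open>e = \<epsilon> + t m\<close>, since the shift moves \<open>M u\<close> by
    \<open>t m\<close>.\<close>
  define \<delta> where "\<delta> m = 2 * L * (\<epsilon> + t m)" for m
  \<comment> \<open>By the triangle inequality the shift lowers the bound on the range of
    \<open>F\<close> by at most \<open>t m\<close>.\<close>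
  define \<sigma> where "\<sigma> m = s - t m" for m
  define A' where "A' m = A + mat (complex_of_real (t m))" for m
  define k :: 'l where "k = undefined"
  have "\<exists>V. \<forall>x\<in>T. unitary (V x) \<and> V x *v axis k 1 = x"
    by (rule bchoice) (metis T(2) unitary_first_column)
  then obtain V where V: "\<And>x. x \<in> T \<Longrightarrow> unitary (V x)" "\<And>x. x \<in> T \<Longrightarrow> V x *v axis k 1 = x" by blast
  define U where "U m = (\<Union>x\<in>T. {Q. Q ** V x \<in> bad_set k (A' m) (\<delta> m)})" for m
  define b where "b m = 8 * \<delta> m * \<sigma> m / ((\<sigma> m)\<^sup>2 - 4 * (\<delta> m)\<^sup>2) * (real CARD('n) - 1)" for m
  define c where "c m = real (card T) * b m" for m
  define B where "B = (\<Union>n. \<Inter>m\<in>{n..}. U m)"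
  have sets_mu: "sets \<mu> = sets borel" using mu by (simp add: haar_distribution_def)
  have d0: "0 < \<delta> m" for m using L e t0[of m] by (simp add: \<delta>_def)
  have F': "\<sigma> m * norm c \<le> norm (A' m *v (F *v c))" for m c
  proof -
    have "A' m *v (F *v c) = A *v (F *v c) + of_real (t m) *s (F *v c)"
      by (simp add: A'_def matrix_vector_mult_add_rdistrib mat_vec)
    moreover have "norm (of_real (t m) *s (F *v c)) = t m * norm c"
      using t0[of m] by (simp add: norm_vector_scalar_mult orthonormal_columns_norm[OF F(1)])
    ultimately have "norm (A *v (F *v c)) \<le> norm (A' m *v (F *v c)) + t m * norm c"
      using norm_triangle_ineq2[of "A *v (F *v c)" "- (of_real (t m) *s (F *v c))"] by simp
    then show ?thesis using F(2)[of c] by (simp add: \<sigma>_def algebra_simps)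
  qed
  have bs: "{Q. Q ** V x \<in> bad_set k (A' m) (\<delta> m)} \<in> sets borel" for x m
  proof -
    have "(\<lambda>Q::complex^'l^'n. Q ** V x) -` bad_set k (A' m) (\<delta> m) \<inter> space borel \<in> sets borel"
      by (rule measurable_sets[OF matrix_mult_borel(2) bad_set_borel])
    then show ?thesis by (simp add: vimage_def)
  qed
  then have U_sets: "U m \<in> sets borel" for m unfolding U_def by (intro sets.finite_UN T(1))
  have d_lim: "\<delta> \<longlonglongrightarrow> 2 * L * \<epsilon>" unfolding \<delta>_def using t_lim by (auto intro!: tendsto_eq_intros)
  have s_lim: "\<sigma> \<longlonglongrightarrow> s" unfolding \<sigma>_def using t_lim by (auto intro!: tendsto_eq_intros)
  have "(\<lambda>m. \<sigma> m - 2 * \<delta> m) \<longlonglongrightarrow> s - 2 * (2 * L * \<epsilon>)" by (intro tendsto_intros d_lim s_lim)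
  \<comment> \<open>The condition \<open>2 * \<delta> < \<sigma>\<close> of the Gaussian estimate
    becomes \<open>4 l \<epsilon> < s\<close> in the limit. As that is strict, it holds for all
    large \<open>m\<close>.\<close>
  then have ev: "eventually (\<lambda>m. 0 < \<sigma> m - 2 * \<delta> m) sequentially"
    using small by (intro order_tendstoD(1)) (auto simp: L_def)
  have le: "eventually (\<lambda>m. emeasure \<mu> (U m) \<le> ennreal (c m)) sequentially"
    using ev
  proof eventually_elim
    case (elim m)
    then have sd: "2 * \<delta> m < \<sigma> m" by simp
    have "emeasure \<mu> (U m) \<le> (\<Sum>x\<in>T. emeasure \<mu> {Q. Q ** V x \<in> bad_set k (A' m) (\<delta> m)})"
      unfolding U_def
    proof (rule emeasure_subadditive_finite[OF T(1)])
      show "(\<lambda>x. {Q. Q ** V x \<in> bad_set k (A' m) (\<delta> m)}) ` T \<subseteq> sets \<mu>"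
        unfolding sets_mu image_subset_iff using bs by blast
    qed
    also have "\<dots> \<le> (\<Sum>x\<in>T. ennreal (b m))"
      unfolding b_def by (intro sum_mono haar_bad_set_rotated[OF mu V(1) F(1) F' d0 sd])
    also have "\<dots> = ennreal (c m)"
      by (simp add: c_def ennreal_mult' ennreal_of_nat_eq_real_of_nat)
    finally show ?case .
  qed
  have sq: "(4 * L * \<epsilon>)\<^sup>2 < s\<^sup>2" using small e L by (intro power_strict_mono) (auto simp: L_def)
  have "c \<longlonglongrightarrow> real (card T) * (8 * (2 * L * \<epsilon>) * s / (s\<^sup>2 - 4 * (2 * L * \<epsilon>)\<^sup>2) * (real CARD('n) - 1))"
      proof -
    have "s\<^sup>2 - 4 * (2 * L * \<epsilon>)\<^sup>2 \<noteq> 0" using sq by (simp add: power_mult_distrib)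
    then show ?thesis unfolding c_def b_def by (intro tendsto_intros d_lim s_lim)
  qed
  moreover have "8 * (2 * L * \<epsilon>) * s = 16 * L * \<epsilon> * s" "4 * (2 * L * \<epsilon>)\<^sup>2 = 16 * L\<^sup>2 * \<epsilon>\<^sup>2"
    by (simp_all add: power_mult_distrib)
  ultimately have c_lim: "c \<longlonglongrightarrow> real (card T) * (16 * L * \<epsilon> * s / (s\<^sup>2 - 16 * L\<^sup>2 * \<epsilon>\<^sup>2) * (real CARD('n) - 1))"
    by (simp only:)
  have "emeasure \<mu> B \<le> ennreal (real (card T) * (16 * L * \<epsilon> * s / (s\<^sup>2 - 16 * L\<^sup>2 * \<epsilon>\<^sup>2) * (real CARD('n) - 1)))"
    unfolding B_def using U_sets sets_mu by (intro emeasure_eventually_le_limit[OF _ le c_lim]) simp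
  moreover have "B \<in> sets borel"
    unfolding B_def using U_sets by (intro sets.countable_UN'' sets.countable_INT') auto
  moreover have "{Q \<in> orthonormal_columns. sigma_min (compression A Q) \<le> \<epsilon>} \<subseteq> B"
  proof
    fix Q :: "complex^'l^'n" assume "Q \<in> {Q \<in> orthonormal_columns. sigma_min (compression A Q) \<le> \<epsilon>}"
    then have Q: "Q \<in> orthonormal_columns" "sigma_min (compression A Q) \<le> \<epsilon>" by auto
    let ?M = "compression A Q"
    obtain u where u: "norm u = 1" "norm (?M *v u) \<le> \<epsilon>"
      using sigma_min_attained[of ?M] Q(2) by metis
    \<comment> \<open>Distinct indices give distinct shifts, so finitely many singular shifts
      exclude only finitely many \<open>m\<close>.\<close>
    have inj: "inj (\<lambda>m. complex_of_real (t m))" by (auto simp: inj_def t_def)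
    have "finite ((\<lambda>m. complex_of_real (t m)) -` {z. det (?M + mat z) = 0})"
      by (rule finite_vimageI[OF det_shift_finite inj])
    then have "eventually (\<lambda>m. det (?M + mat (complex_of_real (t m))) \<noteq> 0) cofinite"
      by (simp add: eventually_cofinite vimage_def)
    then have "eventually (\<lambda>m. det (?M + mat (complex_of_real (t m))) \<noteq> 0) sequentially"
      by (simp add: cofinite_eq_sequentially)
    then obtain n where n: "\<And>m. n \<le> m \<Longrightarrow> det (?M + mat (complex_of_real (t m))) \<noteq> 0"
      unfolding eventually_sequentially by blast
    have "Q \<in> U m" if "n \<le> m" for m
    proof -
      have M': "compression (A' m) Q = ?M + mat (complex_of_real (t m))"
        unfolding A'_def by (rule compression_shift[OF Q(1)])
      have det: "det (compression (A' m) Q) \<noteq> 0" unfolding M' by (rule n[OF that])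
      have "compression (A' m) Q *v u = ?M *v u + of_real (t m) *s u"
        unfolding M' by (simp add: matrix_vector_mult_add_rdistrib mat_vec)
      also have "norm \<dots> \<le> norm (?M *v u) + norm (complex_of_real (t m) *s u)" by (rule norm_triangle_ineq)
      also have "\<dots> \<le> \<epsilon> + t m" using u t0[of m] by (simp add: norm_vector_scalar_mult)
      finally have "norm (compression (A' m) Q *v u) \<le> \<epsilon> + t m" .
      moreover have "0 < \<epsilon> + t m" using e t0[of m] by simp
      ultimately obtain x y where xy: "x \<in> T" "compression (A' m) Q *v y = x"
          "1 \<le> 2 * real CARD('l) * (\<epsilon> + t m) * cmod (cdot x y)"
        by (rule large_inverse_form[OF det u(1) _ _ T(3)])
      have "Q ** V x \<in> bad_set k (A' m) (\<delta> m)"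
        by (rule bad_setI[OF V(1)[OF xy(1)] det, of y])
          (use xy V(2)[OF xy(1)] in \<open>simp_all add: \<delta>_def L_def\<close>)
      then show ?thesis using xy(1) by (auto simp: U_def)
    qed
    then show "Q \<in> B" by (auto simp: B_def)
  qed
  ultimately show ?thesis using that unfolding L_def by blast
qed

text \<open>\<open>c\<close> is the number of test vectors. The part \<open>3 L^2 / 2\<close> of its
  bound times \<open>16 L\<close> gives \<open>24 L^3\<close>; the deficit \<open>L / 2\<close>
  yields \<open>8 L^2 s^2\<close>, which compensates \<open>16 L^2 e^2\<close> in the denominator
  because \<open>48 L^3 e^2 \<le> s^2\<close>.\<close>

lemma final_constant:
  fixes L s e c n :: real
  assumes L: "1 \<le> L" and e: "0 < e" and n: "1 \<le> n" and small: "24 * L ^ 3 * n * e < s"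
    and c: "2 * c + L \<le> 3 * L * L"
  shows "4 * L * e < s" "c * (16 * L * e * s / (s\<^sup>2 - 16 * L\<^sup>2 * e\<^sup>2) * n) \<le> 24 * L ^ 3 * n * (e / s)"
proof -
  have L3: "L \<le> L ^ 3" "1 \<le> L ^ 3" using L by (auto simp: self_le_power)
  have "24 * L ^ 3 * 1 * e \<le> 24 * L ^ 3 * n * e"
    using L L3 e n by (intro mult_right_mono mult_left_mono) auto
  then have s24: "24 * L ^ 3 * e < s" using small by simp
  have "24 * (L * e) \<le> 24 * (L ^ 3 * e)" using L3 e by (intro mult_left_mono mult_right_mono) auto
  moreover have "0 < L * e" using L e by simp
  ultimately show s4: "4 * L * e < s" using s24 by simp
  have s0: "0 < s" using s4 L e by (smt (verit) mult_pos_pos)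
  have D: "0 < s\<^sup>2 - 16 * L\<^sup>2 * e\<^sup>2"
    using power_strict_mono[OF s4, of 2] L e by (simp add: power_mult_distrib)
  \<comment> \<open>The quotient of the two sides is \<open>12 * L ^ 3\<close>, which is at least
    1.\<close>
  have "48 * L ^ 3 * e\<^sup>2 \<le> (24 * L ^ 3 * e)\<^sup>2"
  proof -
    have "48 * L ^ 3 * e\<^sup>2 * 1 \<le> 48 * L ^ 3 * e\<^sup>2 * (12 * L ^ 3)"
      using L3 L e by (intro mult_left_mono) auto
    then show ?thesis by (simp add: power_mult_distrib power2_eq_square mult_ac)
  qed
  also have "\<dots> \<le> s\<^sup>2" using s24 L e by (intro power_mono) auto
  finally have key: "48 * L ^ 3 * e\<^sup>2 \<le> s\<^sup>2" .
  have "(2 * c) * (8 * L * s\<^sup>2) \<le> (3 * L * L - L) * (8 * L * s\<^sup>2)"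
    using c L by (intro mult_right_mono) auto
  also have "\<dots> = 24 * L ^ 3 * s\<^sup>2 - 8 * L\<^sup>2 * s\<^sup>2"
    by (simp add: algebra_simps power2_eq_square power3_eq_cube)
  also have "\<dots> \<le> 24 * L ^ 3 * s\<^sup>2 - 8 * L\<^sup>2 * (48 * L ^ 3 * e\<^sup>2)"
    using key L by (intro diff_left_mono mult_left_mono) auto
  also have "\<dots> = 24 * L ^ 3 * (s\<^sup>2 - 16 * L\<^sup>2 * e\<^sup>2)"
    by (simp add: algebra_simps)
  finally have main: "c * (16 * L * s\<^sup>2) \<le> 24 * L ^ 3 * (s\<^sup>2 - 16 * L\<^sup>2 * e\<^sup>2)" by simp
  define D' where "D' = s\<^sup>2 - 16 * L\<^sup>2 * e\<^sup>2"
  have D': "0 < D'" using D by (simp add: D'_def)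
  have "c * (16 * L * e * s / D' * n) = c * (16 * L * s\<^sup>2) * (e * n / (s * D'))"
    using s0 D' by (simp add: field_simps power2_eq_square)
  also have "\<dots> \<le> 24 * L ^ 3 * D' * (e * n / (s * D'))"
    using main e n s0 D' unfolding D'_def[symmetric] by (intro mult_right_mono) auto
  also have "\<dots> = 24 * L ^ 3 * n * (e / s)" using D' by simp
  finally show "c * (16 * L * e * s / (s\<^sup>2 - 16 * L\<^sup>2 * e\<^sup>2) * n) \<le> 24 * L ^ 3 * n * (e / s)"
    unfolding D'_def .
qed

theorem proposition3p3:
  fixes A :: "complex^'n^'n" and \<epsilon> :: real
    and P :: "'a measure" and Q :: "'a \<Rightarrow> complex^'l^'n"
  assumes "CARD('n) \<ge> 2"
    and "\<epsilon> > 0"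
    and "prob_space P"
    and "Q \<in> borel_measurable P"
    and "haar_distribution (distr P borel Q)"
  shows "emeasure P {\<omega> \<in> space P. sigma_min (conj_transpose (Q \<omega>) ** A ** Q \<omega>) \<le> \<epsilon>}
       \<le> ennreal (24 * real CARD('l) ^ 3 * (real CARD('n) - 1))
           * (ennreal \<epsilon> / ennreal (singular_value CARD('l) A))"
proof -
  let ?E = "{\<omega> \<in> space P. sigma_min (conj_transpose (Q \<omega>) ** A ** Q \<omega>) \<le> \<epsilon>}"
  interpret P: prob_space P by fact
  define L n s where "L = real CARD('l)" and "n = real CARD('n) - 1" and "s = singular_value CARD('l) A"
  have L: "1 \<le> L" by (simp add: L_def Suc_leI)
  \<comment> \<open>\<open>n\<close> is the dimension minus 1. In dimension 1 the right side would
    be 0, while the event has probability 1 for large \<open>\<epsilon>\<close>.\<close>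
  have n: "1 \<le> n" using assms(1) by (simp add: n_def)
  have C0: "0 < 24 * L ^ 3 * n" using L n by simp
  have St: "AE X in distr P borel Q. X \<in> orthonormal_columns" and "prob_space (distr P borel Q)"
    using assms(5) by (auto simp: haar_distribution_def)
  interpret D: prob_space "distr P borel Q" by fact
  obtain X0 :: "complex^'l^'n" where "X0 \<in> orthonormal_columns"
    using eventually_happens'[OF D.ae_filter_bot St] by blast
  then have "CARD('l) \<le> CARD('n)" by (rule orthonormal_columns_card_le)
  then obtain F :: "complex^'l^'n" where F: "F \<in> orthonormal_columns"
      "\<And>c. s * norm c \<le> norm (A *v (F *v c))"
    unfolding s_def using singular_value_subspace[of A] by blast
  have "emeasure P ?E \<le> ennreal (24 * L ^ 3 * n) * (ennreal \<epsilon> / ennreal s)"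
  proof (cases "0 < s")
    \<comment> \<open>Division by 0 gives \<open>top\<close> in \<open>ennreal\<close>, so the claim
      is trivial when \<open>\<sigma>_l(A)\<close> is 0.\<close>
    case False
    then have "ennreal s = 0" by (simp add: ennreal_neg)
    moreover have "ennreal \<epsilon> / 0 = top" using assms(2) by (simp add: ennreal_divide_zero)
    moreover have "ennreal (24 * L ^ 3 * n) * top = top" using C0 L n by (simp add: ennreal_mult_top)
    ultimately show ?thesis by simp
  next
    case s0: True
    have rhs: "ennreal (24 * L ^ 3 * n) * (ennreal \<epsilon> / ennreal s) = ennreal (24 * L ^ 3 * n * (\<epsilon> / s))"
      using s0 C0 assms(2) by (simp add: divide_ennreal ennreal_mult'[symmetric])
    show ?thesis
    proof (cases "24 * L ^ 3 * n * \<epsilon> < s")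
      \<comment> \<open>The right side is at least 1 here. The remaining case supplies the smallness
        of \<open>\<epsilon>\<close> that the Gaussian estimate and the final constant need.\<close>
      case False
      then have "1 \<le> 24 * L ^ 3 * n * (\<epsilon> / s)" using s0 by (simp add: le_divide_eq)
      then have "1 \<le> ennreal (24 * L ^ 3 * n * (\<epsilon> / s))" by simp
      then show ?thesis unfolding rhs using P.emeasure_le_1 order_trans by blast
    next
      case True
      obtain T :: "(complex^'l) set" where T: "finite T" "2 * card T + CARD('l) \<le> 3 * CARD('l) * CARD('l)"
        "\<And>x. x \<in> T \<Longrightarrow> norm x = 1"
        "\<And>(N :: complex^'l^'l) j k. \<exists>x\<in>T. cmod (N $ j $ k) \<le> 2 * cmod (cdot x (N *v x))"
        using test_vectors[where 'l = 'l] by blast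
      have cT: "2 * real (card T) + L \<le> 3 * L * L"
        using of_nat_mono[OF T(2), where 'a = real] by (simp add: L_def)
      note const = final_constant[OF L assms(2) n True cT]
      obtain B where B: "B \<in> sets borel" "{Q \<in> orthonormal_columns. sigma_min (compression A Q) \<le> \<epsilon>} \<subseteq> B"
        "emeasure (distr P borel Q) B \<le> ennreal (real (card T) * (16 * L * \<epsilon> * s / (s\<^sup>2 - 16 * L\<^sup>2 * \<epsilon>\<^sup>2) * n))"
        unfolding L_def n_def
        by (rule haar_sigma_min_bound[OF assms(5) F assms(2) const(1)[unfolded L_def] T(1,3,4)])
      \<comment> \<open>The inclusion holds almost surely only, since \<open>B\<close> covers the
        event on \<open>orthonormal_columns\<close>.\<close>
      have "emeasure P ?E \<le> emeasure P (Q -` B \<inter> space P)"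
      proof (rule emeasure_mono_AE)
        show "AE \<omega> in P. \<omega> \<in> ?E \<longrightarrow> \<omega> \<in> Q -` B \<inter> space P"
          using AE_distrD[OF assms(4) St] by eventually_elim (use B(2) in auto)
        show "Q -` B \<inter> space P \<in> sets P" by (rule measurable_sets[OF assms(4) B(1)])
      qed
      also have "\<dots> = emeasure (distr P borel Q) B"
        by (rule emeasure_distr[OF assms(4) B(1), symmetric])
      also have "\<dots> \<le> ennreal (24 * L ^ 3 * n * (\<epsilon> / s))"
        using B(3) ennreal_leI[OF const(2)] order_trans by blast
      finally show ?thesis unfolding rhs .
    qed
  qed
  then show ?thesis unfolding L_def n_def s_def .
qed

end
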